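(* Let $n\in\mathbb N$, $1\le p\le\infty$ and $\frac1p+\frac1{p'}=1$. Then the Fourier transform $F$ maps $L_p(\mathbb R^n)$ continuously into $\mathcal C^{-n/p'}(\mathbb R^n)$, and this mapping $F: L_p(\mathbb R^n)\to \mathcal C^{-n/p'}(\mathbb R^n)$ is not compact. Furthermore: (a) if $1\le p\le 2$, then $F$ maps $L_p(\mathbb R^n)$ continuously into $L_{p'}(\mathbb R^n)$, and $L_{p'}(\mathbb R^n)$ is continuously embedded in $\mathcal C^{-n/p'}(\mathbb R^n)$; (b) if $2<p\le\infty$, then $F$ maps $L_p(\mathbb R^n)$ continuously into $B^{-n(\frac12-\frac1p)}_{2,p}(\mathbb R^n)$, and one has the continuous embeddings $$B^{-n(\frac12-\frac1p)}_{2,p}(\mathbb R^n)\hookrightarrow B^{d^n_p}_{p}(\mathbb R^n)\hookrightarrow \mathcal C^{-n/p'}(\mathbb R^n),$$ where $d^n_p=2n\big(\frac1p-\frac12\big)$.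
   Context: The Fourier transform is $(F\varphi)(\xi)=(2\pi)^{-n/2}\int_{\mathbb R^n}e^{-ix\xi}\varphi(x)\,dx$ for $\varphi\in S(\mathbb R^n)$, extended to tempered distributions $S'(\mathbb R^n)$ in the standard way; $F^{-1}g=g^\vee$ is the inverse Fourier transform. Fix $\varphi_0\in S(\mathbb R^n)$ with $\varphi_0(x)=1$ for $|x|\le1$ and $\varphi_0(x)=0$ for $|x|\ge3/2$, and put $\varphi_k(x)=\varphi_0(2^{-k}x)-\varphi_0(2^{-k+1}x)$, $k\in\mathbb N$. For $s\in\mathbb R$, $0<p,q\le\infty$, the Besov space $B^s_{p,q}(\mathbb R^n)$ consists of all $f\in S'(\mathbb R^n)$ with $\|f\,|B^s_{p,q}(\mathbb R^n)\|=\big(\sum_{j=0}^\infty 2^{jsq}\|(\varphi_j\widehat f)^\vee\,|L_p(\mathbb R^n)\|^q\big)^{1/q}<\infty$ (usual modification if $q=\infty$); different choices of $\varphi_0$ give equivalent quasi-norms. Notation: $B^s_p(\mathbb R^n)=B^s_{p,p}(\mathbb R^n)$ and $\mathcal C^s(\mathbb R^n)=B^s_{\infty,\infty}(\mathbb R^n)$. "$F$ maps $A$ continuously into $B$" means the restriction of $F$ (on $S'$) to $A$ takes values in $B$ and is a bounded linear map $A\to B$. *)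

theory Defs
  imports "HOL-Analysis.Analysis"
begin

definition partial_deriv :: "'n::finite \<Rightarrow> (real^'n \<Rightarrow> complex) \<Rightarrow> real^'n \<Rightarrow> complex" where
  "partial_deriv i f = (\<lambda>x. frechet_derivative f (at x) (axis i 1))"

fun iter_partial :: "'n::finite list \<Rightarrow> (real^'n \<Rightarrow> complex) \<Rightarrow> real^'n \<Rightarrow> complex" where
  "iter_partial [] f = f"
| "iter_partial (i # is) f = partial_deriv i (iter_partial is f)"

text \<open>Schwartz functions: all iterated partial derivatives exist (as Frechet-differentiable
  functions, hence f is C-infinity) and are rapidly decreasing.\<close>
definition schwartz :: "(real^'n::finite \<Rightarrow> complex) set" where
  "schwartz = {f. (\<forall>is x. iter_partial is f differentiable (at x)) \<and>
      (\<forall>is (k::nat). \<exists>C. \<forall>x. (1 + norm x) ^ k * norm (iter_partial is f x) \<le> C)}"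

definition schwartz_seminorm :: "nat \<Rightarrow> nat \<Rightarrow> (real^'n::finite \<Rightarrow> complex) \<Rightarrow> real" where
  "schwartz_seminorm k m f =
     Sup {(1 + norm x) ^ k * norm (iter_partial is f x) | x is. length is \<le> m}"

text \<open>Tempered distributions: continuous linear functionals on S (only their values on S matter).\<close>
definition tempered :: "((real^'n::finite \<Rightarrow> complex) \<Rightarrow> complex) set" where
  "tempered = {u. (\<forall>\<phi>\<in>schwartz. \<forall>\<psi>\<in>schwartz. u (\<lambda>x. \<phi> x + \<psi> x) = u \<phi> + u \<psi>) \<and>
      (\<forall>\<phi>\<in>schwartz. \<forall>c. u (\<lambda>x. c * \<phi> x) = c * u \<phi>) \<and>
      (\<exists>C k m. \<forall>\<phi>\<in>schwartz. norm (u \<phi>) \<le> C * schwartz_seminorm k m \<phi>)}"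

definition fourier :: "(real^'n::finite \<Rightarrow> complex) \<Rightarrow> real^'n \<Rightarrow> complex" where
  "fourier \<phi> \<xi> = complex_of_real ((2 * pi) powr (- real CARD('n) / 2)) *
      (LINT x|lborel. cis (- (x \<bullet> \<xi>)) * \<phi> x)"

definition inv_fourier :: "(real^'n::finite \<Rightarrow> complex) \<Rightarrow> real^'n \<Rightarrow> complex" where
  "inv_fourier \<phi> x = complex_of_real ((2 * pi) powr (- real CARD('n) / 2)) *
      (LINT \<xi>|lborel. cis (x \<bullet> \<xi>) * \<phi> \<xi>)"

definition fourier_dist :: "((real^'n::finite \<Rightarrow> complex) \<Rightarrow> complex) \<Rightarrow> (real^'n \<Rightarrow> complex) \<Rightarrow> complex" where
  "fourier_dist u = (\<lambda>\<psi>. u (fourier \<psi>))"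

definition epow :: "ennreal \<Rightarrow> real \<Rightarrow> ennreal" where
  "epow x a = (if x = \<infinity> then \<infinity> else ennreal (enn2real x powr a))"

definition inv_exp :: "ennreal \<Rightarrow> real" where
  "inv_exp p = (if p = \<infinity> then 0 else 1 / enn2real p)"

definition Lp_fun_norm :: "ennreal \<Rightarrow> (real^'n::finite \<Rightarrow> complex) \<Rightarrow> ennreal" where
  "Lp_fun_norm p g =
     (if p = \<infinity> then Inf {C. AE x in lborel. ennreal (norm (g x)) \<le> C}
      else epow (\<integral>\<^sup>+ x. ennreal (norm (g x) powr enn2real p) \<partial>lborel) (1 / enn2real p))"

definition represents :: "(real^'n::finite \<Rightarrow> complex) \<Rightarrow> ((real^'n \<Rightarrow> complex) \<Rightarrow> complex) \<Rightarrow> bool" where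
  "represents g u \<longleftrightarrow> g \<in> borel_measurable lborel \<and>
     (\<forall>\<psi>\<in>schwartz. integrable lborel (\<lambda>x. g x * \<psi> x) \<and> u \<psi> = (LINT x|lborel. g x * \<psi> x))"

text \<open>L_p quasi-norm of a distribution (infinity if it is not an L_p function).\<close>
definition Lp_norm :: "ennreal \<Rightarrow> ((real^'n::finite \<Rightarrow> complex) \<Rightarrow> complex) \<Rightarrow> ennreal" where
  "Lp_norm p u = Inf {Lp_fun_norm p g | g. represents g u}"

definition Lp_space :: "ennreal \<Rightarrow> ((real^'n::finite \<Rightarrow> complex) \<Rightarrow> complex) set" where
  "Lp_space p = {u. u \<in> tempered \<and> Lp_norm p u < \<infinity>}"

definition dyadic :: "(real^'n::finite \<Rightarrow> complex) \<Rightarrow> nat \<Rightarrow> real^'n \<Rightarrow> complex" where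
  "dyadic \<phi>0 j = (if j = 0 then \<phi>0 else
      (\<lambda>x. \<phi>0 ((2::real) powr (- real j) *\<^sub>R x) - \<phi>0 ((2::real) powr (1 - real j) *\<^sub>R x)))"

text \<open>(phi_j * F u)^vee as a distribution: psi \<mapsto> u(F(phi_j * F^{-1} psi)).\<close>
definition lp_piece :: "(real^'n::finite \<Rightarrow> complex) \<Rightarrow> nat \<Rightarrow> ((real^'n \<Rightarrow> complex) \<Rightarrow> complex)
     \<Rightarrow> (real^'n \<Rightarrow> complex) \<Rightarrow> complex" where
  "lp_piece \<phi>0 j u = (\<lambda>\<psi>. u (fourier (\<lambda>\<xi>. dyadic \<phi>0 j \<xi> * inv_fourier \<psi> \<xi>)))"

definition besov_norm :: "(real^'n::finite \<Rightarrow> complex) \<Rightarrow> real \<Rightarrow> ennreal \<Rightarrow> ennreal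
     \<Rightarrow> ((real^'n \<Rightarrow> complex) \<Rightarrow> complex) \<Rightarrow> ennreal" where
  "besov_norm \<phi>0 s p q u =
     (if q = \<infinity> then (SUP j. ennreal ((2::real) powr (real j * s)) * Lp_norm p (lp_piece \<phi>0 j u))
      else epow (\<Sum>j. ennreal ((2::real) powr (real j * s * enn2real q)) *
                        epow (Lp_norm p (lp_piece \<phi>0 j u)) (enn2real q)) (1 / enn2real q))"

definition besov :: "(real^'n::finite \<Rightarrow> complex) \<Rightarrow> real \<Rightarrow> ennreal \<Rightarrow> ennreal
     \<Rightarrow> ((real^'n \<Rightarrow> complex) \<Rightarrow> complex) set" where
  "besov \<phi>0 s p q = {u. u \<in> tempered \<and> besov_norm \<phi>0 s p q u < \<infinity>}"

definition admissible_phi0 :: "(real^'n::finite \<Rightarrow> complex) \<Rightarrow> bool" where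
  "admissible_phi0 \<phi>0 \<longleftrightarrow> \<phi>0 \<in> schwartz \<and> (\<forall>x. norm x \<le> 1 \<longrightarrow> \<phi>0 x = 1) \<and>
     (\<forall>x. norm x \<ge> 3/2 \<longrightarrow> \<phi>0 x = 0)"

text \<open>T maps A into B and is bounded w.r.t. the quasi-norms NA, NB (T is linear in all uses).\<close>
definition maps_boundedly :: "'a set \<Rightarrow> ('a \<Rightarrow> ennreal) \<Rightarrow> 'b set \<Rightarrow> ('b \<Rightarrow> ennreal) \<Rightarrow> ('a \<Rightarrow> 'b) \<Rightarrow> bool" where
  "maps_boundedly A NA B NB T \<longleftrightarrow>
     (\<forall>u\<in>A. T u \<in> B) \<and> (\<exists>C::real. \<forall>u\<in>A. NB (T u) \<le> ennreal C * NA u)"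

end

theory Submission
  imports Defs "HOL-Probability.Probability"
begin

text \<open>
  Since \<open>F F f = f(-x)\<close>, the \<open>j\<close>-th Littlewood--Paley piece of \<open>F f\<close> is the transform of \<open>f\<close> localised to
  \<open>|x| ~ 2^j\<close>. Bounding it by its \<open>L\<^sub>1\<close> norm and Hoelder's inequality gives the Hoelder--Zygmund bound; bounding it
  by the Plancherel inequality and Hoelder's inequality gives the Besov bound for \<open>p > 2\<close>. Compactness fails
  because rescaled indicators of a dyadic annulus have transforms living in different pieces, all of the
  same size. For \<open>1 < p < 2\<close> the Hausdorff--Young inequality comes from Marcinkiewicz interpolation, which
  suffices since the constant is irrelevant. The embeddings write a piece as a convolution with the
  transform of a dilated cutoff and use Hoelder's and Young's inequalities.
\<close>

section \<open>Schwartz functions\<close>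

text \<open>\<open>Lp_norm\<close> is an infimum over representing functions and is infinite when
  there are none. Upper bounds are proved for one representative at a time and then passed to the
  infimum. The lower bound behind the failure of compactness has to hold for all representatives at
  once; it comes from pairing with a test function, which sees only the distribution. The transform
  of an \<open>L_p\<close> function with \<open>p > 2\<close> is in general not a function, but
  multiplication by \<phi>_j makes the function integrable. So the pointwise transform is only ever
  taken of integrable functions, and inversion is only used on Schwartz functions. The interpolation
  constant for \<open>1 < p < 2\<close> blows up as \<open>p\<close> tends to 2, where the
  Plancherel inequality takes over. All smoothness exponents are dilation exponents: the
  \<open>L_q\<close> norm of \<phi>_j grows at most like \<open>2^(j n / q)\<close>, and that of its
  transform at most like \<open>2^(j n (1 - 1/q))\<close>.\<close>

lemma partial_deriv_eq:
  "(f has_derivative D) (at x) \<Longrightarrow> partial_deriv i f x = D (axis i 1)"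
  unfolding partial_deriv_def using frechet_derivative_at by metis

text \<open>The recursion makes the head of the list the outermost derivative. This form exposes the
  innermost one, so that replacing \<open>f\<close> by a partial derivative only lengthens the list
  at its end.\<close>

lemma iter_partial_snoc: "iter_partial (is @ [i]) f = iter_partial is (partial_deriv i f)"
  by (induction "is") auto

text \<open>The Schwartz space is the largest set of differentiable, rapidly decreasing functions
  that is closed under partial derivatives. Exhibiting one such set around \<open>f\<close> replaces
  every computation with iterated derivatives, such as a general Leibniz rule.\<close>

lemma schwartz_coinduct:
  fixes A :: "(real^'n::finite \<Rightarrow> complex) set"
  assumes "f \<in> A"
    and diff: "\<And>f x. f \<in> A \<Longrightarrow> f differentiable (at x)"
    and part: "\<And>f i. f \<in> A \<Longrightarrow> partial_deriv i f \<in> A"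
    and decr: "\<And>f k. f \<in> A \<Longrightarrow> \<exists>C. \<forall>x. (1 + norm x) ^ k * norm (f x) \<le> C"
  shows "f \<in> schwartz"
proof -
  have "iter_partial is f \<in> A" for "is"
    by (induction "is") (use \<open>f \<in> A\<close> part in auto)
  then show ?thesis unfolding schwartz_def using diff decr by blast
qed

lemma schwartz_differentiable: "f \<in> schwartz \<Longrightarrow> f differentiable (at x)"
  unfolding schwartz_def by (auto dest: spec[of _ "[]"])

lemma schwartz_partial: "f \<in> schwartz \<Longrightarrow> partial_deriv i f \<in> schwartz"
  unfolding schwartz_def by (auto simp: iter_partial_snoc[symmetric])

lemma schwartz_decr: "f \<in> schwartz \<Longrightarrow> \<exists>C. \<forall>x. (1 + norm x) ^ k * norm (f x) \<le> C"
  unfolding schwartz_def by (auto dest: spec[of _ "[]"])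

lemma schwartz_has_derivative:
  "f \<in> schwartz \<Longrightarrow> (f has_derivative frechet_derivative f (at x)) (at x)"
  using schwartz_differentiable frechet_derivative_works by blast

text \<open>The closure of the Schwartz functions under the operations below is itself closed under partial
  derivatives, so coinduction shows that it adds nothing new.\<close>

inductive_set schwartz_algebra :: "(real^'n::finite \<Rightarrow> complex) set" where
  base: "f \<in> schwartz \<Longrightarrow> f \<in> schwartz_algebra"
| add: "f \<in> schwartz_algebra \<Longrightarrow> g \<in> schwartz_algebra \<Longrightarrow> (\<lambda>x. f x + g x) \<in> schwartz_algebra"
| scale: "f \<in> schwartz_algebra \<Longrightarrow> (\<lambda>x. c * f x) \<in> schwartz_algebra"
| mult: "f \<in> schwartz_algebra \<Longrightarrow> g \<in> schwartz_algebra \<Longrightarrow> (\<lambda>x. f x * g x) \<in> schwartz_algebra"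
| coord: "f \<in> schwartz_algebra \<Longrightarrow> (\<lambda>x. complex_of_real (x $ i) * f x) \<in> schwartz_algebra"
| dil: "f \<in> schwartz_algebra \<Longrightarrow> a \<noteq> 0 \<Longrightarrow> (\<lambda>x. f (a *\<^sub>R x)) \<in> schwartz_algebra"

lemma schwartz_algebra_differentiable: "f \<in> schwartz_algebra \<Longrightarrow> f differentiable (at x)"
proof (induction arbitrary: x rule: schwartz_algebra.induct)
  case (coord f i)
  have "((\<lambda>x. complex_of_real (x $ i)) has_derivative (\<lambda>h. complex_of_real (h $ i))) (at x)" for x :: "real^'a"
    by (auto intro!: derivative_eq_intros bounded_linear.has_derivative[OF bounded_linear_vec_nth])
  then have "(\<lambda>x. complex_of_real (x $ i)) differentiable at x" unfolding differentiable_def by blast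
  then show ?case using coord by (intro differentiable_mult) auto
next
  case (dil f a)
  have "(\<lambda>x. a *\<^sub>R x) differentiable at x" by (intro derivative_intros)
  then show ?case using dil differentiable_chain_at[of "\<lambda>x. a *\<^sub>R x" x f] by (auto simp: o_def)
qed (auto intro!: derivative_intros simp: schwartz_differentiable)

lemma schwartz_algebra_has_derivative:
  "f \<in> schwartz_algebra \<Longrightarrow> (f has_derivative frechet_derivative f (at x)) (at x)"
  using schwartz_algebra_differentiable frechet_derivative_works by blast

lemma schwartz_algebra_partial: "f \<in> schwartz_algebra \<Longrightarrow> partial_deriv i f \<in> schwartz_algebra"
proof (induction rule: schwartz_algebra.induct)
  case (base f)
  then show ?case by (simp add: schwartz_algebra.base schwartz_partial)
next
  case (add f g)
  have "partial_deriv i (\<lambda>x. f x + g x) = (\<lambda>x. partial_deriv i f x + partial_deriv i g x)"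
    by (rule ext, subst partial_deriv_eq)
      (auto intro!: has_derivative_add schwartz_algebra_has_derivative add simp: partial_deriv_def)
  then show ?case using add by (simp add: schwartz_algebra.add)
next
  case (scale f c)
  have "partial_deriv i (\<lambda>x. c * f x) = (\<lambda>x. c * partial_deriv i f x)"
    by (rule ext, subst partial_deriv_eq)
      (auto intro!: has_derivative_mult_right schwartz_algebra_has_derivative scale simp: partial_deriv_def)
  then show ?case using scale by (simp add: schwartz_algebra.scale)
next
  case (mult f g)
  have "partial_deriv i (\<lambda>x. f x * g x) = (\<lambda>x. f x * partial_deriv i g x + partial_deriv i f x * g x)"
    by (rule ext, subst partial_deriv_eq)
      (auto intro!: has_derivative_mult schwartz_algebra_has_derivative mult simp: partial_deriv_def)
  then show ?case using mult by (simp add: schwartz_algebra.add schwartz_algebra.mult)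
next
  case (coord f j)
  have "((\<lambda>x. complex_of_real (x $ j)) has_derivative (\<lambda>h. complex_of_real (h $ j))) (at x)" for x :: "real^'a"
    by (auto intro!: derivative_eq_intros bounded_linear.has_derivative[OF bounded_linear_vec_nth])
  then have "partial_deriv i (\<lambda>x. complex_of_real (x $ j) * f x) =
      (\<lambda>x. complex_of_real (x $ j) * partial_deriv i f x + complex_of_real (axis i 1 $ j) * f x)"
    by (intro ext, subst partial_deriv_eq[OF has_derivative_mult])
      (auto intro!: schwartz_algebra_has_derivative coord simp: partial_deriv_def)
  then show ?case using coord
    by (auto intro!: schwartz_algebra.add schwartz_algebra.coord schwartz_algebra.scale)
next
  case (dil f a)
  have "partial_deriv i (\<lambda>x. f (a *\<^sub>R x)) = (\<lambda>x. complex_of_real a * partial_deriv i f (a *\<^sub>R x))"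
  proof
    fix x :: "real^'a"
    have lin: "linear (frechet_derivative f (at (a *\<^sub>R x)))"
      using schwartz_algebra_has_derivative[OF dil(1)] has_derivative_linear by blast
    have "((\<lambda>x. a *\<^sub>R x) has_derivative (\<lambda>h. a *\<^sub>R h)) (at x)"
      by (auto intro!: derivative_eq_intros)
    from diff_chain_at[OF this schwartz_algebra_has_derivative[OF dil(1)]]
    have "((\<lambda>x. f (a *\<^sub>R x)) has_derivative (\<lambda>h. frechet_derivative f (at (a *\<^sub>R x)) (a *\<^sub>R h))) (at x)"
      by (simp add: o_def)
    from partial_deriv_eq[OF this]
    show "partial_deriv i (\<lambda>x. f (a *\<^sub>R x)) x = complex_of_real a * partial_deriv i f (a *\<^sub>R x)"
      by (simp only: partial_deriv_def linear_cmul[OF lin] scaleR_conv_of_real[where 'a=complex])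
  qed
  then show ?case using dil by (auto intro!: schwartz_algebra.scale schwartz_algebra.dil)
qed

lemma schwartz_algebra_decr:
  "f \<in> schwartz_algebra \<Longrightarrow> \<exists>C. \<forall>x. (1 + norm x) ^ k * norm (f x) \<le> C"
proof (induction arbitrary: k rule: schwartz_algebra.induct)
  case (base f)
  then show ?case by (rule schwartz_decr)
next
  case (add f g)
  obtain C D where "\<forall>x. (1 + norm x) ^ k * norm (f x) \<le> C" "\<forall>x. (1 + norm x) ^ k * norm (g x) \<le> D"
    using add by metis
  moreover have "(1 + norm x) ^ k * norm (f x + g x) \<le> (1 + norm x) ^ k * norm (f x) + (1 + norm x) ^ k * norm (g x)" for x
    unfolding distrib_left[symmetric] by (intro mult_left_mono norm_triangle_ineq) auto
  ultimately have "\<forall>x. (1 + norm x) ^ k * norm (f x + g x) \<le> C + D"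
    by (meson add_mono order_trans)
  then show ?case by blast
next
  case (scale f c)
  obtain C where "\<forall>x. (1 + norm x) ^ k * norm (f x) \<le> C" using scale by metis
  then have "\<forall>x. (1 + norm x) ^ k * norm (c * f x) \<le> norm c * C"
    by (auto simp: norm_mult mult.left_commute[of _ "norm c"] intro!: mult_left_mono)
  then show ?case by blast
next
  case (mult f g)
  obtain C D where C: "\<forall>x. (1 + norm x) ^ k * norm (f x) \<le> C" and D: "\<forall>x. (1 + norm x) ^ 0 * norm (g x) \<le> D"
    using mult by metis
  have "(1 + norm x) ^ k * norm (f x * g x) \<le> C * D" for x
  proof -
    have "((1 + norm x) ^ k * norm (f x)) * norm (g x) \<le> C * D"
      using C D by (intro mult_mono) (auto intro: order_trans[OF _ C[rule_format, of x]])
    then show ?thesis by (simp add: norm_mult mult.assoc)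
  qed
  then show ?case by blast
next
  case (coord f i)
  \<comment> \<open>A coordinate grows at most like \<open>1 + norm x\<close>, so one extra power of
    decay of \<open>f\<close> is spent.\<close>
  obtain C where C: "\<forall>x. (1 + norm x) ^ Suc k * norm (f x) \<le> C" using coord by metis
  have "(1 + norm x) ^ k * norm (complex_of_real (x $ i) * f x) \<le> C" for x
  proof -
    have "(1 + norm x) ^ k * (\<bar>x $ i\<bar> * norm (f x)) \<le> (1 + norm x) ^ k * ((1 + norm x) * norm (f x))"
      using component_le_norm_cart[of x i] by (intro mult_left_mono mult_right_mono) auto
    also have "\<dots> \<le> C" using C[rule_format, of x] by (simp add: mult_ac)
    finally show ?thesis by (simp add: norm_mult)
  qed
  then show ?case by blast
next
  case (dil f a)
  obtain C where C: "\<forall>x. (1 + norm x) ^ k * norm (f x) \<le> C" using dil by metis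
  \<comment> \<open>\<open>M\<close> is chosen so that \<open>1 + norm x\<close> is at most
    \<open>M\<close> times \<open>1 + norm (a x)\<close>; the maximum with 1 takes care of the
    constant summand.\<close>
  define M where "M = max 1 (1 / \<bar>a\<bar>)"
  have "(1 + norm x) ^ k * norm (f (a *\<^sub>R x)) \<le> M ^ k * C" for x
  proof -
    have "norm x = (1/\<bar>a\<bar>) * norm (a *\<^sub>R x)" using dil(2) by simp
    also have "\<dots> \<le> M * norm (a *\<^sub>R x)" unfolding M_def by (intro mult_right_mono) auto
    finally have "1 + norm x \<le> M * (1 + norm (a *\<^sub>R x))" unfolding M_def
      by (simp add: algebra_simps) 
    then have "(1 + norm x) ^ k \<le> (M * (1 + norm (a *\<^sub>R x))) ^ k"
      by (intro power_mono) auto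
    then have "(1 + norm x) ^ k * norm (f (a *\<^sub>R x)) \<le> (M * (1 + norm (a *\<^sub>R x))) ^ k * norm (f (a *\<^sub>R x))"
      by (intro mult_right_mono) auto
    also have "\<dots> = M ^ k * ((1 + norm (a *\<^sub>R x)) ^ k * norm (f (a *\<^sub>R x)))"
      by (simp add: power_mult_distrib)
    also have "\<dots> \<le> M ^ k * C" using C by (intro mult_left_mono) (auto simp: M_def simp del: norm_scaleR)
    finally show ?thesis .
  qed
  then show ?case by blast
qed

lemma schwartz_algebra_eq: "schwartz_algebra = schwartz"
  using schwartz_coinduct[of _ schwartz_algebra] schwartz_algebra_differentiable
    schwartz_algebra_partial schwartz_algebra_decr schwartz_algebra.base by blast

lemmas schwartz_add = schwartz_algebra.add[unfolded schwartz_algebra_eq]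
lemmas schwartz_scale = schwartz_algebra.scale[unfolded schwartz_algebra_eq]
lemmas schwartz_mult = schwartz_algebra.mult[unfolded schwartz_algebra_eq]
lemmas schwartz_coord = schwartz_algebra.coord[unfolded schwartz_algebra_eq]
lemmas schwartz_dil = schwartz_algebra.dil[unfolded schwartz_algebra_eq]

lemma schwartz_diff: "f \<in> schwartz \<Longrightarrow> g \<in> schwartz \<Longrightarrow> (\<lambda>x. f x - g x) \<in> schwartz"
  using schwartz_add[of f "\<lambda>x. (-1) * g x"] schwartz_scale[of g "-1"] by simp

lemma schwartz_reflect: "f \<in> schwartz \<Longrightarrow> (\<lambda>x. f (- x)) \<in> schwartz"
  using schwartz_dil[of f "-1"] by simp

lemma schwartz_continuous: "f \<in> schwartz \<Longrightarrow> continuous_on UNIV f"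
  by (simp add: continuous_at_imp_continuous_on differentiable_imp_continuous_within schwartz_differentiable)

lemma schwartz_measurable[measurable_dest]: "f \<in> schwartz \<Longrightarrow> f \<in> borel_measurable borel"
  by (simp add: borel_measurable_continuous_onI schwartz_continuous)

text \<open>The exponent \<open>2n\<close> makes integrability a product of one-dimensional integrals of \<open>1 / (1 + t\<^sup>2)\<close>.\<close>

definition schwartz_weight :: "real^'n::finite \<Rightarrow> real" where
  "schwartz_weight x = inverse ((1 + norm x) ^ (2 * CARD('n)))"

lemma schwartz_weight_pos: "schwartz_weight x > 0"
  unfolding schwartz_weight_def by (simp add: add_pos_nonneg)

lemma schwartz_weight_measurable[measurable]: "schwartz_weight \<in> borel_measurable borel"
  unfolding schwartz_weight_def by measurable

lemma schwartz_weight_integrable: "integrable lborel (schwartz_weight :: real^'n::finite \<Rightarrow> real)"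
proof (rule integrableI_nonneg)
  have 1: "schwartz_weight x \<le> (\<Prod>b\<in>Basis. inverse (1 + (x \<bullet> b)\<^sup>2))" for x :: "real^'n"
  proof -
    have "(\<Prod>b\<in>(Basis::(real^'n) set). (1 + (x \<bullet> b)\<^sup>2)) \<le> (\<Prod>b\<in>(Basis::(real^'n) set). (1 + norm x)^2)"
    proof (intro prod_mono conjI)
      fix b :: "real^'n" assume "b \<in> Basis"
      then have "\<bar>x \<bullet> b\<bar> \<le> norm x" by (simp add: Basis_le_norm)
      then have "(x \<bullet> b)\<^sup>2 \<le> (norm x)\<^sup>2" by (metis abs_ge_zero power2_abs power_mono)
      then show "1 + (x \<bullet> b)\<^sup>2 \<le> (1 + norm x)\<^sup>2"
        by (simp add: power2_sum add_increasing2)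
    qed auto
    also have "\<dots> = (1 + norm x) ^ (2 * CARD('n))" by (simp add: power_mult)
    finally have "inverse ((1 + norm x) ^ (2 * CARD('n))) \<le> inverse (\<Prod>b\<in>(Basis::(real^'n) set). (1 + (x \<bullet> b)\<^sup>2))"
      by (intro le_imp_inverse_le) (auto intro!: prod_pos simp: add_pos_nonneg)
    then show ?thesis unfolding schwartz_weight_def
      using prod_inversef[of "\<lambda>b. 1 + (x \<bullet> b)\<^sup>2" Basis] by (simp only: o_def)
  qed
  have "(\<integral>\<^sup>+x. ennreal (schwartz_weight x) \<partial>(lborel :: (real^'n) measure)) \<le>
      (\<integral>\<^sup>+x. (\<Prod>b\<in>(Basis::(real^'n) set). ennreal (inverse (1 + (x \<bullet> b)\<^sup>2))) \<partial>lborel)"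
    by (intro nn_integral_mono) (subst prod_ennreal, auto simp: 1 ennreal_leI)
  also have "\<dots> = (\<Prod>b\<in>(Basis::(real^'n) set). (\<integral>\<^sup>+t. ennreal (inverse (1 + t\<^sup>2)) \<partial>lborel))"
    by (rule nn_integral_lborel_prod) auto
  also have "\<dots> < \<infinity>"
  proof -
    have "integrable lborel (\<lambda>t::real. inverse (1 + t\<^sup>2))"
      using integrable_inverse_1_plus_square by (simp add: set_integrable_def)
    then have "(\<integral>\<^sup>+t. ennreal (inverse (1 + t\<^sup>2)) \<partial>lborel) < \<infinity>"
      by (subst nn_integral_eq_integral) auto
    then show ?thesis by (auto simp: power_less_top_ennreal)
  qed
  finally show "(\<integral>\<^sup>+x. ennreal (schwartz_weight x) \<partial>(lborel :: (real^'n) measure)) < \<infinity>" .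
qed (auto intro!: less_imp_le[OF schwartz_weight_pos])

section \<open>Integrable majorants and seminorms\<close>

lemma le_schwartz_weight_iff:
  "a \<le> b * schwartz_weight (x :: real^'n::finite) \<longleftrightarrow> (1 + norm x) ^ (2 * CARD('n)) * a \<le> b"
  unfolding schwartz_weight_def divide_inverse[symmetric]
  by (subst pos_le_divide_eq) (simp_all add: add_pos_nonneg mult.commute[of a])

text \<open>Decay of order \<open>2 * CARD('n) + k\<close> leaves the full weight over after
  \<open>k\<close> powers have been spent, so every polynomial multiple of a Schwartz function has
  an integrable majorant.\<close>

lemma schwartz_power_le_weight:
  fixes f :: "real^'n::finite \<Rightarrow> complex"
  assumes "f \<in> schwartz"
  obtains C where "C \<ge> 0" "\<And>x. (1 + norm x) ^ k * norm (f x) \<le> C * schwartz_weight x"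
proof -
  obtain C where C: "\<And>x. (1 + norm x) ^ (2 * CARD('n) + k) * norm (f x) \<le> C"
    using schwartz_decr[OF assms] by blast
  have "C \<ge> 0" using C[of 0] order_trans[OF _ C[of 0]] by auto
  then show ?thesis using that C by (simp add: le_schwartz_weight_iff power_add mult.assoc)
qed

lemma schwartz_le_weight:
  assumes "f \<in> schwartz"
  obtains C where "C \<ge> 0" "\<And>x. norm (f x) \<le> C * schwartz_weight x"
  using schwartz_power_le_weight[OF assms, of 0] by auto

lemma schwartz_integrable: "f \<in> schwartz \<Longrightarrow> integrable lborel f"
proof -
  assume f: "f \<in> schwartz"
  obtain C where C: "C \<ge> 0" "\<And>x. norm (f x) \<le> C * schwartz_weight x" using schwartz_le_weight[OF f] by blast
  show ?thesis
    by (rule Bochner_Integration.integrable_bound[of _ "\<lambda>x. C * schwartz_weight x"])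
      (use C f in \<open>auto intro!: integrable_mult_right schwartz_weight_integrable AE_I2 order_trans[OF C(2)]\<close>)
qed

lemma schwartz_bounded:
  assumes "f \<in> schwartz" obtains C where "C \<ge> 0" "\<And>x. norm (f x) \<le> C"
proof -
  obtain C where C: "\<And>x. (1 + norm x) ^ 0 * norm (f x) \<le> C" using schwartz_decr[OF assms] by blast
  have "C \<ge> 0" using order_trans[OF _ C[of 0]] by simp
  then show ?thesis using that C by simp
qed

text \<open>A supremum of reals says nothing about an unbounded set, so this precedes every use of
  the seminorm. The index type is finite, hence only finitely many lists of length at most
  \<open>m\<close> occur and their individual constants have a maximum.\<close>

lemma schwartz_seminorm_bdd:
  fixes f :: "real^'n::finite \<Rightarrow> complex"
  assumes "f \<in> schwartz"
  shows "bdd_above {(1 + norm x) ^ k * norm (iter_partial is f x) | x is. length is \<le> m}"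
proof -
  have "\<forall>is. \<exists>C. \<forall>x. (1 + norm x) ^ k * norm (iter_partial is f x) \<le> C"
    using assms unfolding schwartz_def by blast
  then obtain C where C: "\<And>x is. (1 + norm x) ^ k * norm (iter_partial is f x) \<le> C is" by metis
  have fin: "finite {is :: 'n list. length is \<le> m}"
    using finite_lists_length_le[of "UNIV::'n set" m] by simp
  have "(1 + norm x) ^ k * norm (iter_partial is f x) \<le> Max (C ` {is. length is \<le> m})" if "length is \<le> m" for "is" x
    by (rule order_trans[OF C Max_ge]) (use fin that in auto)
  then show ?thesis unfolding bdd_above_def by blast
qed

lemma schwartz_seminorm_upper:
  assumes "f \<in> schwartz" "length is \<le> m"
  shows "(1 + norm x) ^ k * norm (iter_partial is f x) \<le> schwartz_seminorm k m f"
  unfolding schwartz_seminorm_def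
  by (rule cSup_upper) (use assms schwartz_seminorm_bdd[OF assms(1)] in auto)

lemma schwartz_seminorm_nonneg: "f \<in> schwartz \<Longrightarrow> schwartz_seminorm k m f \<ge> 0"
  using schwartz_seminorm_upper[of f "[]" m undefined k] by (auto intro: order_trans[rotated])

lemma schwartz_seminorm_mono: "f \<in> schwartz \<Longrightarrow> m \<le> m' \<Longrightarrow> schwartz_seminorm k m f \<le> schwartz_seminorm k m' f"
  unfolding schwartz_seminorm_def
  by (rule cSup_subset_mono[OF _ schwartz_seminorm_bdd]) (auto intro!: exI[of _ "[]"], metis le_trans)

lemma schwartz_seminorm_partial:
  "f \<in> schwartz \<Longrightarrow> schwartz_seminorm k m (partial_deriv i f) \<le> schwartz_seminorm k (Suc m) f"
  unfolding schwartz_seminorm_def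
proof (rule cSup_subset_mono[OF _ schwartz_seminorm_bdd])
  show "{(1 + norm x) ^ k * cmod (iter_partial is (partial_deriv i f) x) |x is. length is \<le> m}
    \<subseteq> {(1 + norm x) ^ k * cmod (iter_partial is f x) |x is. length is \<le> Suc m}"
  proof safe
    fix x and "is" :: "'a list" assume "length is \<le> m"
    then show "\<exists>xa is'. (1 + norm x) ^ k * cmod (iter_partial is (partial_deriv i f) x) =
         (1 + norm xa) ^ k * cmod (iter_partial is' f xa) \<and> length is' \<le> Suc m"
      by (intro exI[of _ x] exI[of _ "is @ [i]"]) (simp add: iter_partial_snoc)
  qed
qed (auto intro!: exI[of _ "[]"])

text \<open>The mean value inequality along a coordinate line. The majorant is integrable in
  \<open>x\<close> and, after division by \<open>t\<close>, independent of \<open>t\<close>, which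
  is what dominated convergence of difference quotients asks for.\<close>

lemma schwartz_increment:
  fixes f :: "real^'n::finite \<Rightarrow> complex"
  assumes "f \<in> schwartz"
  obtains C where "C \<ge> 0"
    "\<And>x t. \<bar>t\<bar> \<le> 1 \<Longrightarrow> norm (f (x + t *\<^sub>R axis i 1) - f x) \<le> C * schwartz_weight x * \<bar>t\<bar>"
proof -
  obtain C where C: "C \<ge> 0" "\<And>x. norm (partial_deriv i f x) \<le> C * schwartz_weight x"
    using schwartz_le_weight[OF schwartz_partial[OF assms]] by blast
  define D where "D = C * 2 ^ (2 * CARD('n))"
  \<comment> \<open>Moving by at most 1 changes \<open>1 + norm x\<close> by at most a factor 2,
    because \<open>2 + b \<le> 2 * (1 + b)\<close> for nonnegative \<open>b\<close>.\<close>
  have w: "schwartz_weight (x + s *\<^sub>R axis i 1) \<le> 2 ^ (2 * CARD('n)) * schwartz_weight x" if "\<bar>s\<bar> \<le> 1" for x :: "real^'n" and s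
  proof -
    have "norm x \<le> norm (x + s *\<^sub>R axis i 1) + norm (s *\<^sub>R axis i (1::real) :: real^'n)"
      by (metis add_diff_cancel_right' norm_triangle_ineq4)
    moreover have "norm (s *\<^sub>R axis i (1::real) :: real^'n) \<le> 1" using that by simp
    moreover have aux: "(1 + a) / 2 \<le> 1 + b" if "a \<le> b + c" "c \<le> 1" "0 \<le> b" for a b c :: real
      using that by (simp add: field_simps)
    ultimately have "(1 + norm x) / 2 \<le> 1 + norm (x + s *\<^sub>R axis i 1)"
      by (intro aux) (assumption | rule norm_ge_zero)+
    then have "((1 + norm x) / 2) ^ (2 * CARD('n)) \<le> (1 + norm (x + s *\<^sub>R axis i 1)) ^ (2 * CARD('n))"
      by (intro power_mono) auto
    then have "inverse ((1 + norm (x + s *\<^sub>R axis i 1)) ^ (2 * CARD('n))) \<le> inverse (((1 + norm x) / 2) ^ (2 * CARD('n)))"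
      by (intro le_imp_inverse_le) (auto simp: add_pos_nonneg)
    then show ?thesis unfolding schwartz_weight_def by (simp only: power_divide inverse_divide divide_inverse[symmetric])
  qed
  have "norm (f (x + t *\<^sub>R axis i 1) - f x) \<le> D * schwartz_weight x * \<bar>t\<bar>" if t: "\<bar>t\<bar> \<le> 1" for x t
  proof -
    have "norm ((\<lambda>s. f (x + s *\<^sub>R axis i 1)) t - (\<lambda>s. f (x + s *\<^sub>R axis i 1)) 0) \<le> (D * schwartz_weight x) * norm (t - 0)"
    proof (rule differentiable_bound[of "{-1..1}" _ "\<lambda>s h. h *\<^sub>R partial_deriv i f (x + s *\<^sub>R axis i 1)"])
      fix s :: real assume s: "s \<in> {-1..1}"
      have lin: "linear (frechet_derivative f (at (x + s *\<^sub>R axis i 1)))"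
        using schwartz_has_derivative[OF assms] has_derivative_linear by blast
      have "((\<lambda>s. x + s *\<^sub>R axis i 1) has_derivative (\<lambda>h. h *\<^sub>R axis i 1)) (at s)"
        by (auto intro!: derivative_eq_intros)
      from diff_chain_at[OF this schwartz_has_derivative[OF assms]]
      show "((\<lambda>s. f (x + s *\<^sub>R axis i 1)) has_derivative (\<lambda>h. h *\<^sub>R partial_deriv i f (x + s *\<^sub>R axis i 1))) (at s within {-1..1})"
        by - (rule has_derivative_at_withinI, simp add: o_def partial_deriv_def linear_cmul[OF lin])
      have "norm (partial_deriv i f (x + s *\<^sub>R axis i 1)) \<le> C * schwartz_weight (x + s *\<^sub>R axis i 1)" by (rule C)
      also have "\<dots> \<le> D * schwartz_weight x"
        using mult_left_mono[OF w[of s x] C(1)] s by (simp add: D_def mult_ac abs_le_iff)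
      finally have "norm (partial_deriv i f (x + s *\<^sub>R axis i 1)) \<le> D * schwartz_weight x" .
      then show "onorm (\<lambda>h. h *\<^sub>R partial_deriv i f (x + s *\<^sub>R axis i 1)) \<le> D * schwartz_weight x"
        by (intro onorm_le) (metis mult.commute mult_left_mono norm_ge_zero norm_scaleR real_norm_def)
    qed (use t in auto)
    then show ?thesis by simp
  qed
  moreover have "D \<ge> 0" using C by (simp add: D_def)
  ultimately show ?thesis using that by blast
qed

section \<open>The Fourier transform on Schwartz functions\<close>

lemma nn_integral_lborel_affine:
  fixes t :: "'a::euclidean_space"
  assumes [measurable]: "f \<in> borel_measurable borel" and c: "c \<noteq> 0"
  shows "(\<integral>\<^sup>+x. f x \<partial>lborel) = ennreal (\<bar>c\<bar> ^ DIM('a)) * (\<integral>\<^sup>+x. f (t + c *\<^sub>R x) \<partial>lborel)"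
  by (subst lborel_affine[OF c, of t])
    (simp add: nn_integral_density nn_integral_distr nn_integral_cmult)

lemma lborel_integrable_affine:
  fixes f :: "'a::euclidean_space \<Rightarrow> 'b :: {banach, second_countable_topology}"
  assumes f: "integrable lborel f" and c: "c \<noteq> 0"
  shows "integrable lborel (\<lambda>x. f (t + c *\<^sub>R x))"
  using c f f[THEN borel_measurable_integrable] unfolding integrable_iff_bounded
  by (subst (asm) nn_integral_lborel_affine[where c=c and t=t]) (auto simp: ennreal_mult_less_top)

lemma lborel_integral_affine:
  fixes f :: "'a::euclidean_space \<Rightarrow> 'b :: {banach, second_countable_topology}"
  assumes f[measurable]: "integrable lborel f" and c: "c \<noteq> 0"
  shows "(\<integral>x. f x \<partial>lborel) = (\<bar>c\<bar> ^ DIM('a)) *\<^sub>R (\<integral>x. f (t + c *\<^sub>R x) \<partial>lborel)"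
  using c f f[THEN borel_measurable_integrable] f[THEN lborel_integrable_affine, of c t]
  by (subst lborel_affine[OF c, of t]) (simp add: integral_density integral_distr)

lemma borel_measurable_cis[measurable]: "cis \<in> borel_measurable borel"
  by (intro borel_measurable_continuous_onI continuous_on_cis continuous_on_id)

lemma integrable_cis_mult:
  assumes f: "integrable lborel (f :: real^'n::finite \<Rightarrow> complex)"
  shows "integrable lborel (\<lambda>x. cis (- (x \<bullet> \<xi>)) * f x)"
proof -
  have [measurable]: "f \<in> borel_measurable borel" using f by auto
  show ?thesis
    by (rule Bochner_Integration.integrable_bound[OF f]) (auto simp: norm_mult)
qed

text \<open>The \<open>itself\<close> argument carries the dimension, so that the normalising factor
  can be treated as a single positive constant.\<close>

definition fourier_const :: "'n::finite itself \<Rightarrow> real" where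
  "fourier_const _ = (2 * pi) powr (- real CARD('n) / 2)"

lemma fourier_const_pos: "fourier_const TYPE('n::finite) > 0"
  by (simp add: fourier_const_def)

lemma fourier_eq:
  "fourier (f :: real^'n::finite \<Rightarrow> complex) \<xi> = of_real (fourier_const TYPE('n)) * (LINT x|lborel. cis (- (x \<bullet> \<xi>)) * f x)"
  by (simp add: fourier_def fourier_const_def)

lemma inv_fourier_eq: "inv_fourier f x = fourier f (- x)"
  by (simp add: fourier_def inv_fourier_def inner_commute[of x])

lemma fourier_reflect:
  assumes "integrable lborel (f :: real^'n::finite \<Rightarrow> complex)"
  shows "fourier (\<lambda>x. f (- x)) \<xi> = fourier f (- \<xi>)"
  using lborel_integral_affine[OF integrable_cis_mult[OF assms, of "- \<xi>"], of "-1" 0]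
  by (simp add: fourier_eq)

lemma norm_fourier_le:
  assumes "integrable lborel (f :: real^'n::finite \<Rightarrow> complex)"
  shows "norm (fourier f \<xi>) \<le> fourier_const TYPE('n) * (LINT x|lborel. norm (f x))"
proof -
  have "norm (LINT x|lborel. cis (- (x \<bullet> \<xi>)) * f x) \<le> (LINT x|lborel. norm (cis (- (x \<bullet> \<xi>)) * f x))"
    by (rule integral_norm_bound)
  also have "\<dots> = (LINT x|lborel. norm (f x))" by (simp add: norm_mult)
  finally show ?thesis
    using fourier_const_pos[where 'n='n] by (simp add: fourier_eq norm_mult)
qed

lemma fourier_measurable[measurable]:
  assumes "integrable lborel (f :: real^'n::finite \<Rightarrow> complex)"
  shows "fourier f \<in> borel_measurable borel"
proof -
  have [measurable]: "f \<in> borel_measurable borel" using assms by auto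
  have "(\<lambda>\<xi>. LINT x|lborel. cis (- (x \<bullet> \<xi>)) * f x) \<in> borel_measurable borel"
    by (rule lborel.borel_measurable_lebesgue_integral) measurable
  then show ?thesis unfolding fourier_eq by measurable
qed

lemma fourier_add:
  assumes "integrable lborel (f :: real^'n::finite \<Rightarrow> complex)" "integrable lborel g"
  shows "fourier (\<lambda>x. f x + g x) \<xi> = fourier f \<xi> + fourier g \<xi>"
  using integrable_cis_mult[OF assms(1), of \<xi>] integrable_cis_mult[OF assms(2), of \<xi>]
  by (simp add: fourier_eq distrib_left)

lemma fourier_cmult: "fourier (\<lambda>x. c * f x) \<xi> = c * fourier f \<xi>"
  unfolding fourier_eq by (simp add: mult.left_commute[of _ c])

lemma fourier_diff:
  assumes "integrable lborel (f :: real^'n::finite \<Rightarrow> complex)" "integrable lborel g"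
  shows "fourier (\<lambda>x. f x - g x) \<xi> = fourier f \<xi> - fourier g \<xi>"
  using fourier_add[of f "\<lambda>x. (-1) * g x" \<xi>] assms fourier_cmult[of "-1" g \<xi>] by simp

lemma fourier_translate:
  assumes "integrable lborel (f :: real^'n::finite \<Rightarrow> complex)"
  shows "fourier (\<lambda>x. f (x + y)) \<xi> = cis (y \<bullet> \<xi>) * fourier f \<xi>"
proof -
  have "cis (- (x \<bullet> \<xi>)) * f (x + y) = cis (y \<bullet> \<xi>) * (cis (- ((y + x) \<bullet> \<xi>)) * f (y + x))" for x
    by (simp add: mult.assoc[symmetric] cis_mult inner_add_left add.commute)
  then show ?thesis
    using lborel_integral_affine[OF integrable_cis_mult[OF assms, of \<xi>], of 1 y]
    by (simp add: fourier_eq)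
qed

lemma fourier_modulate:
  "fourier (\<lambda>x. cis (- (x \<bullet> y)) * f x) \<xi> = fourier f (\<xi> + y)"
  unfolding fourier_eq by (simp add: mult.assoc[symmetric] cis_mult inner_add_right)

lemma fourier_dilate:
  assumes "integrable lborel (f :: real^'n::finite \<Rightarrow> complex)" "a \<noteq> 0"
  shows "fourier (\<lambda>x. f (a *\<^sub>R x)) \<xi> = of_real (inverse (\<bar>a\<bar> ^ CARD('n))) * fourier f (inverse a *\<^sub>R \<xi>)"
  using lborel_integral_affine[OF integrable_cis_mult[OF assms(1), of "inverse a *\<^sub>R \<xi>"], of a 0] assms(2)
  by (simp add: fourier_eq scaleR_conv_of_real[where 'a=complex] field_simps)

section \<open>Exchange of derivatives and multiplication by coordinates\<close>

lemma has_vector_derivative_imp_quotient: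
  fixes g :: "real \<Rightarrow> 'a::real_normed_vector"
  assumes "(g has_vector_derivative d) (at 0)"
  shows "((\<lambda>s. (g s - g 0) /\<^sub>R s) \<longlongrightarrow> d) (at 0)"
proof -
  have "((\<lambda>y. norm (g y - g 0 - y *\<^sub>R d) / norm y) \<longlongrightarrow> 0) (at 0)"
    using assms by (simp add: has_vector_derivative_def has_derivative_iff_norm)
  moreover have "\<forall>\<^sub>F y in at 0. norm (g y - g 0 - y *\<^sub>R d) / norm y = norm ((g y - g 0) /\<^sub>R y - d)"
  proof (rule eventually_at_filter[THEN iffD2], rule always_eventually, intro allI impI)
    fix y :: real assume "y \<noteq> 0"
    then have "(g y - g 0) /\<^sub>R y - d = (g y - g 0 - y *\<^sub>R d) /\<^sub>R y" by (simp add: scaleR_diff_right)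
    then show "norm (g y - g 0 - y *\<^sub>R d) / norm y = norm ((g y - g 0) /\<^sub>R y - d)"
      by (simp add: divide_inverse mult.commute)
  qed
  ultimately have "((\<lambda>y. norm ((g y - g 0) /\<^sub>R y - d)) \<longlongrightarrow> 0) (at 0)"
    by (rule Lim_transform_eventually)
  then show ?thesis by (rule LIM_zero_cancel[OF tendsto_norm_zero_cancel])
qed

text \<open>Instead of integrating by parts, transform difference quotients: by translation invariance they turn
  into the factor \<open>(e^(it\<xi>\<^sub>i) - 1) / t\<close>.\<close>

lemma fourier_partial:
  fixes f :: "real^'n::finite \<Rightarrow> complex"
  assumes f: "f \<in> schwartz"
  shows "fourier (partial_deriv i f) \<xi> = \<i> * of_real (\<xi> $ i) * fourier f \<xi>"
proof -
  \<comment> \<open>Dominated convergence is applied to sequences, so the increments run through a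
    null sequence; its values stay in the range \<open>0 < t \<le> 1\<close> in which
    \<open>schwartz_increment\<close> is valid.\<close>
  define t where "t m = 1 / real (Suc m)" for m :: nat
  have t: "t m > 0" "t m \<le> 1" for m by (auto simp: t_def)
  have tlim: "t \<longlonglongrightarrow> 0" unfolding t_def using LIMSEQ_inverse_real_of_nat by (simp add: inverse_eq_divide)
  have tat: "filterlim t (at 0) sequentially"
    using tlim t(1) by (auto simp: filterlim_at intro!: always_eventually) (metis less_irrefl)
  note [measurable] = schwartz_measurable[OF f] schwartz_measurable[OF schwartz_partial[OF f]]
  have int: "integrable lborel f" by (rule schwartz_integrable[OF f])
  have inte: "integrable lborel (\<lambda>x. f (x + t m *\<^sub>R axis i 1))" for m
    using lborel_integrable_affine[OF int, of 1 "t m *\<^sub>R axis i 1"] by (simp add: add.commute)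
  define q where "q m x = (f (x + t m *\<^sub>R axis i 1) - f x) / of_real (t m)" for m x
  obtain C where C: "C \<ge> 0" "\<And>x t. \<bar>t\<bar> \<le> 1 \<Longrightarrow> norm (f (x + t *\<^sub>R axis i 1) - f x) \<le> C * schwartz_weight x * \<bar>t\<bar>"
    using schwartz_increment[OF f] by blast
  have qb: "norm (q m x) \<le> C * schwartz_weight x" for m x
    using C(2)[of "t m" x] t[of m] by (simp add: q_def norm_divide divide_le_eq)
  have qlim: "(\<lambda>m. q m x) \<longlonglongrightarrow> partial_deriv i f x" for x
  proof -
    have lin: "linear (frechet_derivative f (at x))"
      using schwartz_has_derivative[OF f] has_derivative_linear by blast
    have "((\<lambda>s. x + s *\<^sub>R axis i 1) has_derivative (\<lambda>h. h *\<^sub>R axis i 1)) (at (0::real))"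
      by (auto intro!: derivative_eq_intros)
    from diff_chain_at[OF this, of f "frechet_derivative f (at x)"] schwartz_has_derivative[OF f, of x]
    have "((\<lambda>s. f (x + s *\<^sub>R axis i 1)) has_derivative (\<lambda>h. h *\<^sub>R partial_deriv i f x)) (at 0)"
      by (simp add: o_def partial_deriv_def linear_cmul[OF lin])
    then have "((\<lambda>s. f (x + s *\<^sub>R axis i 1)) has_vector_derivative partial_deriv i f x) (at 0)"
      by (simp add: has_vector_derivative_def)
    then have "((\<lambda>s. (f (x + s *\<^sub>R axis i 1) - f x) /\<^sub>R s) \<longlongrightarrow> partial_deriv i f x) (at 0)"
      using has_vector_derivative_imp_quotient by fastforce
    from filterlim_compose[OF this tat] show ?thesis
      by (simp add: q_def[abs_def] scaleR_conv_of_real divide_inverse mult.commute)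
  qed
  have "(\<lambda>m. LINT x|lborel. cis (- (x \<bullet> \<xi>)) * q m x) \<longlonglongrightarrow> (LINT x|lborel. cis (- (x \<bullet> \<xi>)) * partial_deriv i f x)"
  proof (rule integral_dominated_convergence[where w = "\<lambda>x. C * schwartz_weight x"])
    show "integrable lborel (\<lambda>x. C * schwartz_weight (x :: real^'n))"
      by (intro integrable_mult_right schwartz_weight_integrable)
    show "(\<lambda>x. cis (- (x \<bullet> \<xi>)) * q m x) \<in> borel_measurable lborel" for m
      unfolding q_def by measurable
  qed (auto simp: norm_mult intro!: qb tendsto_mult qlim)
  then have "(\<lambda>m. fourier (q m) \<xi>) \<longlonglongrightarrow> fourier (partial_deriv i f) \<xi>"
    unfolding fourier_eq by (intro tendsto_mult tendsto_const)
  moreover have "fourier (q m) \<xi> = ((cis (t m * \<xi> $ i) - 1) / of_real (t m)) * fourier f \<xi>" for m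
  proof -
    have "fourier (q m) \<xi> = fourier (\<lambda>x. (1 / of_real (t m)) * (f (x + t m *\<^sub>R axis i 1) - f x)) \<xi>"
      by (simp add: q_def[abs_def])
    also have "\<dots> = (1 / of_real (t m)) * (cis (t m * \<xi> $ i) * fourier f \<xi> - fourier f \<xi>)"
      unfolding fourier_cmult by (subst fourier_diff[OF inte int], subst fourier_translate[OF int])
        (simp add: inner_axis' )
    finally show ?thesis by (simp add: field_simps)
  qed
  moreover have "(\<lambda>m. ((cis (t m * \<xi> $ i) - 1) / of_real (t m)) * fourier f \<xi>) \<longlonglongrightarrow> (\<i> * of_real (\<xi> $ i)) * fourier f \<xi>"
  proof (intro tendsto_mult tendsto_const)
    have "((\<lambda>z. exp (\<i> * (z * of_real (\<xi> $ i)))) has_field_derivative \<i> * of_real (\<xi> $ i)) (at (of_real 0))"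
      by (auto intro!: derivative_eq_intros)
    from has_vector_derivative_real_field[OF this]
    have "((\<lambda>s. cis (s * \<xi> $ i)) has_vector_derivative \<i> * of_real (\<xi> $ i)) (at 0)"
      unfolding cis_conv_exp by simp
    from has_vector_derivative_imp_quotient[OF this]
    have "((\<lambda>s. (cis (s * \<xi> $ i) - 1) /\<^sub>R s) \<longlongrightarrow> \<i> * of_real (\<xi> $ i)) (at 0)"
      by (simp add: scaleR_conv_of_real mult.commute)
    from filterlim_compose[OF this tat]
    show "(\<lambda>m. ((cis (t m * \<xi> $ i) - 1) / of_real (t m))) \<longlonglongrightarrow> \<i> * of_real (\<xi> $ i)"
      by (simp add: scaleR_conv_of_real divide_inverse mult.commute)
  qed
  ultimately show ?thesis using LIMSEQ_unique by fastforce
qed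

lemma iexp_taylor: "norm (cis t - 1 - \<i> * of_real t) \<le> t\<^sup>2"
proof -
  have "norm (cis t - 1 - \<i> * of_real t) \<le> t\<^sup>2 / 2"
    using iexp_approx1[of t 1] by (simp add: cis_conv_exp power2_eq_square algebra_simps)
  then show ?thesis by (rule order_trans) simp
qed

lemma fourier_sum:
  fixes f :: "'i \<Rightarrow> real^'n::finite \<Rightarrow> complex"
  assumes "\<And>i. i \<in> I \<Longrightarrow> integrable lborel (f i)"
  shows "fourier (\<lambda>x. \<Sum>i\<in>I. f i x) \<xi> = (\<Sum>i\<in>I. fourier (f i) \<xi>)"
proof -
  have "(LINT x|lborel. cis (- (x \<bullet> \<xi>)) * (\<Sum>i\<in>I. f i x)) = (\<Sum>i\<in>I. LINT x|lborel. cis (- (x \<bullet> \<xi>)) * f i x)"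
    unfolding sum_distrib_left
    by (rule Bochner_Integration.integral_sum) (rule integrable_cis_mult[OF assms])
  then show ?thesis unfolding fourier_eq by (simp only: sum_distrib_left)
qed

text \<open>The second-order Taylor bound for the exponential, integrated against
  \<open>(norm x)\<^sup>2 * norm (f x)\<close>, gives a remainder of size
  \<open>O((norm h)\<^sup>2)\<close>. This yields the full Frechet derivative at once, with no
  separate continuity argument for the partial derivatives.\<close>

lemma fourier_has_derivative:
  fixes f :: "real^'n::finite \<Rightarrow> complex"
  assumes f: "f \<in> schwartz"
  shows "(fourier f has_derivative
    (\<lambda>h. \<Sum>i\<in>UNIV. of_real (h $ i) * fourier (\<lambda>x. - \<i> * (of_real (x $ i) * f x)) \<xi>)) (at \<xi>)"
    (is "(_ has_derivative ?L) _")
proof -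
  note [measurable] = schwartz_measurable[OF f]
  obtain C where C: "C \<ge> 0" "\<And>x. (1 + norm x) ^ 2 * norm (f x) \<le> C * schwartz_weight x"
    using schwartz_power_le_weight[OF f] by blast
  have int2: "integrable lborel (\<lambda>x. (norm x)\<^sup>2 * norm (f x))"
  proof (rule Bochner_Integration.integrable_bound[of _ "\<lambda>x. C * schwartz_weight x"])
    show "integrable lborel (\<lambda>x. C * schwartz_weight x)"
      by (intro integrable_mult_right schwartz_weight_integrable)
    have "(norm x)\<^sup>2 * norm (f x) \<le> C * schwartz_weight x" for x
      by (rule order_trans[OF mult_right_mono C(2)]) (auto intro!: power_mono)
    then show "AE x in lborel. norm ((norm x)\<^sup>2 * norm (f x)) \<le> norm (C * schwartz_weight x)"
      by (auto intro!: order_trans[OF _ abs_ge_self])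
  qed measurable
  have intc: "integrable lborel (\<lambda>x. - \<i> * (of_real (x $ i) * f x))" for i
    by (intro schwartz_integrable schwartz_scale schwartz_coord f)
  have int: "integrable lborel f" by (rule schwartz_integrable[OF f])
  have intm: "integrable lborel (\<lambda>x. cis (- (x \<bullet> h)) * f x)" for h by (rule integrable_cis_mult[OF int])
  have sum_eq: "(\<Sum>i\<in>UNIV. of_real (h $ i) * (- \<i> * (of_real (x $ i) * f x))) = - \<i> * of_real (x \<bullet> h) * f x" for x h
    by (simp add: inner_vec_def sum_distrib_left sum_distrib_right algebra_simps sum_negf)
  have L: "?L h = fourier (\<lambda>x. - \<i> * of_real (x \<bullet> h) * f x) \<xi>" for h
    unfolding sum_eq[symmetric]
    by (subst fourier_sum, intro integrable_mult_right intc, subst fourier_cmult, rule refl)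
  define K where "K = fourier_const TYPE('n) * (LINT x|lborel. (norm x)\<^sup>2 * norm (f x))"
  have bd: "norm (fourier f (\<xi> + h) - fourier f \<xi> - ?L h) \<le> K * (norm h)\<^sup>2" for h
  proof -
    have intL: "integrable lborel (\<lambda>x. - \<i> * of_real (x \<bullet> h) * f x)"
      unfolding sum_eq[symmetric] by (intro Bochner_Integration.integrable_sum integrable_mult_right intc)
    let ?r = "\<lambda>x. (cis (- (x \<bullet> h)) * f x - f x) - (- \<i> * of_real (x \<bullet> h) * f x)"
    have intr: "integrable lborel ?r" by (intro Bochner_Integration.integrable_diff intm int intL)
    have "fourier f (\<xi> + h) - fourier f \<xi> - ?L h = fourier ?r \<xi>"
      unfolding L by (subst fourier_diff, intro Bochner_Integration.integrable_diff intm int, rule intL,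
        subst fourier_diff, rule intm, rule int, simp only: fourier_modulate)
    also have "norm \<dots> \<le> fourier_const TYPE('n) * (LINT x|lborel. norm (?r x))"
      by (rule norm_fourier_le[OF intr])
    also have "\<dots> \<le> fourier_const TYPE('n) * (LINT x|lborel. (norm h)\<^sup>2 * ((norm x)\<^sup>2 * norm (f x)))"
    proof (intro mult_left_mono integral_mono integrable_norm intr integrable_mult_right int2)
      fix x
      have "?r x = (cis (- (x \<bullet> h)) - 1 - \<i> * of_real (- (x \<bullet> h))) * f x" by (simp add: algebra_simps)
      then have "norm (?r x) \<le> (x \<bullet> h)\<^sup>2 * norm (f x)"
        using iexp_taylor[of "- (x \<bullet> h)"] by (simp only: norm_mult) (auto intro!: mult_right_mono)
      also have "(x \<bullet> h)\<^sup>2 \<le> (norm x * norm h)\<^sup>2"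
        using Cauchy_Schwarz_ineq2[of x h] by (metis abs_ge_zero power2_abs power_mono)
      finally show "norm (?r x) \<le> (norm h)\<^sup>2 * ((norm x)\<^sup>2 * norm (f x))"
        by (simp add: power_mult_distrib mult_ac mult_right_mono)
    qed (use fourier_const_pos[where 'n='n] in auto)
    also have "\<dots> = K * (norm h)\<^sup>2" by (simp add: K_def)
    finally show ?thesis .
  qed
  show ?thesis
  proof (rule has_derivativeI_sandwich[of 1])
    show "bounded_linear ?L"
      by (intro bounded_linear_sum bounded_linear_mult_const[THEN bounded_linear_compose]
          bounded_linear_compose[OF bounded_linear_of_real bounded_linear_vec_nth] bounded_linear_ident)
    show "((\<lambda>y. K * norm (y - \<xi>)) \<longlongrightarrow> 0) (at \<xi>)"
      by (auto intro!: tendsto_eq_intros)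
    fix y assume "y \<noteq> \<xi>"
    then show "norm (fourier f y - fourier f \<xi> - ?L (y - \<xi>)) / norm (y - \<xi>) \<le> K * norm (y - \<xi>)"
      using bd[of "y - \<xi>"] by (simp add: pos_divide_le_eq power2_eq_square mult.assoc)
  qed simp
qed

lemma partial_deriv_fourier:
  fixes f :: "real^'n::finite \<Rightarrow> complex"
  assumes f: "f \<in> schwartz"
  shows "partial_deriv i (fourier f) = fourier (\<lambda>x. - \<i> * (of_real (x $ i) * f x))"
proof
  fix \<xi>
  have "partial_deriv i (fourier f) \<xi> = (\<Sum>j\<in>UNIV. of_real (axis i 1 $ j) * fourier (\<lambda>x. - \<i> * (of_real (x $ j) * f x)) \<xi>)"
    by (rule partial_deriv_eq[OF fourier_has_derivative[OF f]])
  also have "\<dots> = (\<Sum>j\<in>UNIV. if j = i then fourier (\<lambda>x. - \<i> * (of_real (x $ j) * f x)) \<xi> else 0)"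
    by (intro sum.cong) (auto simp: axis_def)
  finally show "partial_deriv i (fourier f) \<xi> = fourier (\<lambda>x. - \<i> * (of_real (x $ i) * f x)) \<xi>" by simp
qed

text \<open>Each further power of \<open>1 + norm \<xi>\<close> is dominated by 1 plus the sum of
  the \<open>\<bar>\<xi> $ i\<bar>\<close>, and a factor \<open>\<xi> $ i\<close> is absorbed into
  the transform of the \<open>i\<close>-th derivative. Only the number of derivatives grows; the
  polynomial order stays at the \<open>2 * CARD('n)\<close> that makes the integral converge. A
  bound by a single seminorm is kept because it also gives the continuity of transformed
  distributions.\<close>

lemma fourier_decr:
  "\<exists>C\<ge>0. \<forall>f\<in>schwartz. \<forall>\<xi>::real^'n::finite. (1 + norm \<xi>) ^ k * norm (fourier f \<xi>) \<le> C * schwartz_seminorm (2 * CARD('n)) k f"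
proof (induction k)
  case 0
  define C where "C = fourier_const TYPE('n) * (LINT x|lborel. schwartz_weight (x::real^'n))"
  have "C \<ge> 0" unfolding C_def using fourier_const_pos[where 'n='n] schwartz_weight_pos
    by (intro mult_nonneg_nonneg Bochner_Integration.integral_nonneg) (auto intro: less_imp_le)
  moreover have "norm (fourier f \<xi>) \<le> C * schwartz_seminorm (2 * CARD('n)) 0 f" if f: "f \<in> schwartz" for f and \<xi> :: "real^'n"
  proof -
    let ?S = "schwartz_seminorm (2 * CARD('n)) 0 f"
    have "norm (f x) \<le> ?S * schwartz_weight x" for x
      using schwartz_seminorm_upper[OF f, of "[]" 0 x "2 * CARD('n)"] by (simp add: le_schwartz_weight_iff)
    then have "(LINT x|lborel. norm (f x)) \<le> (LINT x|lborel. ?S * schwartz_weight (x::real^'n))"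
      by (intro integral_mono integrable_norm schwartz_integrable f integrable_mult_right schwartz_weight_integrable)
    then have "fourier_const TYPE('n) * (LINT x|lborel. norm (f x)) \<le> C * ?S"
      using fourier_const_pos[where 'n='n] by (simp add: C_def mult_ac)
    then show ?thesis using norm_fourier_le[OF schwartz_integrable[OF f], of \<xi>] by linarith
  qed
  ultimately show ?case by auto
next
  case (Suc k)
  then obtain C where C: "C \<ge> 0" "\<And>f (\<xi>::real^'n). f \<in> schwartz \<Longrightarrow> (1 + norm \<xi>) ^ k * norm (fourier f \<xi>) \<le> C * schwartz_seminorm (2 * CARD('n)) k f"
    by blast
  have "(1 + norm \<xi>) ^ Suc k * norm (fourier f \<xi>) \<le> (C * (1 + real CARD('n))) * schwartz_seminorm (2 * CARD('n)) (Suc k) f"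
    if f: "f \<in> schwartz" for f and \<xi> :: "real^'n"
  proof -
    let ?S = "schwartz_seminorm (2 * CARD('n)) (Suc k) f"
    have "norm \<xi> \<le> (\<Sum>i\<in>UNIV. \<bar>\<xi> $ i\<bar>)" by (rule norm_le_l1_cart)
    then have "(1 + norm \<xi>) ^ Suc k * norm (fourier f \<xi>) \<le> ((1 + norm \<xi>) ^ k * (1 + (\<Sum>i\<in>UNIV. \<bar>\<xi> $ i\<bar>))) * norm (fourier f \<xi>)"
      by (simp only: power_Suc2) (intro mult_right_mono mult_left_mono, auto)
    also have "\<dots> = (1 + norm \<xi>) ^ k * norm (fourier f \<xi>) + (\<Sum>i\<in>UNIV. (1 + norm \<xi>) ^ k * norm (fourier (partial_deriv i f) \<xi>))"
      by (simp add: fourier_partial[OF f] norm_mult sum_distrib_left sum_distrib_right algebra_simps)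
    also have "\<dots> \<le> C * ?S + (\<Sum>i\<in>(UNIV::'n set). C * ?S)"
    proof (intro add_mono sum_mono)
      show "(1 + norm \<xi>) ^ k * norm (fourier f \<xi>) \<le> C * ?S"
        using C(2)[OF f, of \<xi>] mult_left_mono[OF schwartz_seminorm_mono[OF f, of k "Suc k" "2 * CARD('n)"] C(1)] by simp
      show "(1 + norm \<xi>) ^ k * norm (fourier (partial_deriv i f) \<xi>) \<le> C * ?S" for i
        using C(2)[OF schwartz_partial[OF f], of \<xi> i] mult_left_mono[OF schwartz_seminorm_partial[OF f, of "2 * CARD('n)" k i] C(1)] by linarith
    qed
    also have "\<dots> = (C * (1 + real CARD('n))) * ?S" by (simp add: algebra_simps)
    finally show ?thesis .
  qed
  then show ?case using C(1) by (intro exI[of _ "C * (1 + real CARD('n))"]) auto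
qed

text \<open>Coinduction on the set of all transforms: differentiating a transform multiplies the
  original function by a coordinate, and that function is again Schwartz.\<close>

lemma schwartz_fourier: "f \<in> schwartz \<Longrightarrow> fourier (f :: real^'n::finite \<Rightarrow> complex) \<in> schwartz"
proof (rule schwartz_coinduct[of _ "fourier ` schwartz"])
  fix g :: "real^'n \<Rightarrow> complex" assume "g \<in> fourier ` schwartz"
  then obtain f where f: "f \<in> schwartz" "g = fourier f" by blast
  show "g differentiable at x" for x
    using fourier_has_derivative[OF f(1)] f(2) differentiable_def by blast
  show "partial_deriv i g \<in> fourier ` schwartz" for i
    unfolding f(2) partial_deriv_fourier[OF f(1)] by (intro imageI schwartz_scale schwartz_coord f)
  show "\<exists>C. \<forall>x. (1 + norm x) ^ k * norm (g x) \<le> C" for k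
    using fourier_decr[where k=k and 'n='n] f by blast
qed simp

lemma schwartz_inv_fourier: "f \<in> schwartz \<Longrightarrow> inv_fourier f \<in> schwartz"
  unfolding inv_fourier_eq[abs_def] by (rule schwartz_reflect[OF schwartz_fourier])

section \<open>Inversion and the Plancherel inequality\<close>

lemma integrable_prod_mult:
  fixes f g :: "'a::euclidean_space \<Rightarrow> complex"
  assumes f: "integrable lborel f" and g: "integrable lborel g"
  shows "integrable (lborel \<Otimes>\<^sub>M lborel) (\<lambda>(x, y). f x * g y)"
proof (rule lborel_pair.Fubini_integrable)
  have [measurable]: "f \<in> borel_measurable borel" "g \<in> borel_measurable borel" using f g by auto
  show "(\<lambda>(x, y). f x * g y) \<in> borel_measurable (lborel \<Otimes>\<^sub>M lborel)" by measurable
  show "integrable lborel (\<lambda>x. LINT y|lborel. norm (case (x, y) of (x, y) \<Rightarrow> f x * g y))"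
    using f by (simp add: norm_mult)
  show "AE x in lborel. integrable lborel (\<lambda>y. case (x, y) of (x, y) \<Rightarrow> f x * g y)"
    using g by simp
qed

text \<open>Fubini for a kernel of modulus one that is symmetric in its two variables. The formula
  identifies the transform of an integrable function with the transform of the distribution it
  represents, and it carries both inversion and the Plancherel inequality.\<close>

theorem fourier_multiplication_formula:
  fixes f g :: "real^'n::finite \<Rightarrow> complex"
  assumes f: "integrable lborel f" and g: "integrable lborel g"
  shows "(LINT \<xi>|lborel. fourier f \<xi> * g \<xi>) = (LINT x|lborel. f x * fourier g x)"
proof -
  have [measurable]: "f \<in> borel_measurable borel" "g \<in> borel_measurable borel" using f g by auto
  have int: "integrable (lborel \<Otimes>\<^sub>M lborel) (\<lambda>(x, y). cis (- (x \<bullet> y)) * (f x * g y))"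
    by (rule Bochner_Integration.integrable_bound[OF integrable_prod_mult[OF f g]])
      (auto simp: norm_mult split: prod.split)
  have "(LINT \<xi>|lborel. fourier f \<xi> * g \<xi>) =
      of_real (fourier_const TYPE('n)) * (LINT \<xi>|lborel. LINT x|lborel. cis (- (x \<bullet> \<xi>)) * (f x * g \<xi>))"
    by (simp add: fourier_eq mult.assoc flip: integral_mult_left_zero integral_mult_right_zero)
  also have "(LINT \<xi>|lborel. LINT x|lborel. cis (- (x \<bullet> \<xi>)) * (f x * g \<xi>)) =
      (LINT x|lborel. LINT \<xi>|lborel. cis (- (x \<bullet> \<xi>)) * (f x * g \<xi>))"
    by (rule lborel_pair.Fubini_integral[OF int])
  also have "of_real (fourier_const TYPE('n)) * (LINT x|lborel. LINT \<xi>|lborel. cis (- (x \<bullet> \<xi>)) * (f x * g \<xi>)) = (LINT x|lborel. f x * fourier g x)"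
    by (simp add: fourier_eq mult_ac inner_commute flip: integral_mult_right_zero)
  finally show ?thesis .
qed

section \<open>Gaussians and Fourier inversion\<close>

lemma
  fixes f :: "'a::euclidean_space \<Rightarrow> real \<Rightarrow> 'b::{real_normed_field,banach,second_countable_topology}"
  assumes f: "\<And>b. b \<in> Basis \<Longrightarrow> integrable lborel (f b)"
  shows lborel_integral_prod: "(LINT x|lborel. (\<Prod>b\<in>Basis. f b (x \<bullet> b))) = (\<Prod>b\<in>Basis. LINT t|lborel. f b t)"
    and lborel_integrable_prod: "integrable lborel (\<lambda>x. \<Prod>b\<in>Basis. f b (x \<bullet> b))"
proof -
  interpret product_sigma_finite "\<lambda>_::'a. lborel :: real measure" by standard
  have [measurable]: "f b \<in> borel_measurable borel" if "b \<in> Basis" for b using f[OF that] by auto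
  let ?T = "\<lambda>v. \<Sum>b\<in>(Basis::'a set). v b *\<^sub>R b"
  have T[measurable]: "?T \<in> (\<Pi>\<^sub>M b\<in>Basis. lborel) \<rightarrow>\<^sub>M borel" by measurable
  have m: "(\<lambda>x::'a. \<Prod>b\<in>Basis. f b (x \<bullet> b)) \<in> borel_measurable borel" by measurable
  have eq: "(\<Prod>b\<in>Basis. f b (?T v \<bullet> b)) = (\<Prod>b\<in>Basis. f b (v b))" for v
    by (intro prod.cong) (auto simp: inner_sum_left inner_Basis if_distrib sum.delta cong: if_cong)
  show "(LINT x|lborel. (\<Prod>b\<in>Basis. f b (x \<bullet> b))) = (\<Prod>b\<in>Basis. LINT t|lborel. f b t)"
    by (subst lborel_eq, subst integral_distr[OF T m], simp only: eq, rule product_integral_prod)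
      (auto intro: f)
  show "integrable lborel (\<lambda>x. \<Prod>b\<in>Basis. f b (x \<bullet> b))"
    by (subst lborel_eq, subst integrable_distr_eq[OF T m], simp only: eq, rule product_integrable_prod)
      (auto intro: f)
qed

text \<open>With the factor 1/2 in the exponent this function is a fixed point of the transform in
  the present normalisation.\<close>

definition gaussian :: "'a::euclidean_space \<Rightarrow> real" where
  "gaussian x = exp (- (norm x)\<^sup>2 / 2)"

lemma gaussian_pos: "gaussian x > 0" by (simp add: gaussian_def)

lemma gaussian_le_1: "gaussian x \<le> 1" by (simp add: gaussian_def)

lemma gaussian_0: "gaussian 0 = 1" by (simp add: gaussian_def)

lemma gaussian_uminus: "gaussian (- x) = gaussian x" by (simp add: gaussian_def)

lemma gaussian_measurable[measurable]: "gaussian \<in> borel_measurable borel"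
  unfolding gaussian_def by measurable

lemma isCont_gaussian: "isCont gaussian x"
  unfolding gaussian_def by (intro continuous_intros) simp

lemma gaussian_scale_tendsto_1: "(\<lambda>m. gaussian ((1 / real (Suc m)) *\<^sub>R x)) \<longlonglongrightarrow> 1"
proof -
  have "(\<lambda>m. (1 / real (Suc m)) *\<^sub>R x) \<longlonglongrightarrow> 0 *\<^sub>R x"
    using LIMSEQ_inverse_real_of_nat by (intro tendsto_scaleR tendsto_const) (simp add: inverse_eq_divide)
  from isCont_tendsto_compose[OF isCont_gaussian this] show ?thesis by (simp add: gaussian_0)
qed

text \<open>Up to the factor \<open>sqrt (2 * pi)\<close> of the normal density, the integral is the
  characteristic function of the standard normal law.\<close>

lemma fourier_integral_gaussian_real:
  fixes s :: real
  shows "integrable lborel (\<lambda>t. cis (- (t * s)) * of_real (exp (- t\<^sup>2 / 2)))"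
    and "(LINT t|lborel. cis (- (t * s)) * of_real (exp (- t\<^sup>2 / 2))) = of_real (sqrt (2 * pi) * exp (- s\<^sup>2 / 2))"
proof -
  have d: "std_normal_density t *\<^sub>R iexp (- s * t) = of_real (1 / sqrt (2 * pi)) * (cis (- (t * s)) * of_real (exp (- t\<^sup>2 / 2)))" for t
    by (simp add: std_normal_density_def cis_conv_exp scaleR_conv_of_real mult_ac exp_of_real)
  have "integrable lborel (\<lambda>t. std_normal_density t)" by simp
  then have "integrable lborel (\<lambda>t. std_normal_density t *\<^sub>R iexp (- s * t))"
    by (rule Bochner_Integration.integrable_bound) (auto simp: cis_conv_exp[symmetric])
  then have "integrable lborel (\<lambda>t. of_real (sqrt (2 * pi)) * (std_normal_density t *\<^sub>R iexp (- s * t)))"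
    by (rule integrable_mult_right)
  moreover have e: "of_real (sqrt (2 * pi)) * (std_normal_density t *\<^sub>R iexp (- s * t)) = cis (- (t * s)) * of_real (exp (- t\<^sup>2 / 2))" for t
    unfolding d mult.assoc[symmetric] of_real_mult[symmetric] by simp
  ultimately show "integrable lborel (\<lambda>t. cis (- (t * s)) * of_real (exp (- t\<^sup>2 / 2)))" by simp
  have "(LINT t|lborel. std_normal_density t *\<^sub>R iexp (- s * t)) = char std_normal_distribution (- s)"
    unfolding char_def by (subst integral_density) auto
  also have "\<dots> = of_real (exp (- s\<^sup>2 / 2))" by (simp add: char_std_normal_distribution)
  finally have "of_real (sqrt (2 * pi)) * (LINT t|lborel. std_normal_density t *\<^sub>R iexp (- s * t)) = of_real (sqrt (2 * pi) * exp (- s\<^sup>2 / 2))" by simp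
  then show "(LINT t|lborel. cis (- (t * s)) * of_real (exp (- t\<^sup>2 / 2))) = of_real (sqrt (2 * pi) * exp (- s\<^sup>2 / 2))"
    by (simp only: e integral_mult_right_zero[symmetric])
qed

lemma prod_gaussian: "(\<Prod>b\<in>Basis. exp (- (x \<bullet> b)\<^sup>2 / 2)) = gaussian (x::'a::euclidean_space)"
proof -
  have "(\<Prod>b\<in>Basis. exp (- (x \<bullet> b)\<^sup>2 / 2)) = exp (\<Sum>b\<in>Basis. - (x \<bullet> b)\<^sup>2 / 2)"
    by (simp add: exp_sum)
  also have "(\<Sum>b\<in>Basis. - (x \<bullet> b)\<^sup>2 / 2) = - (x \<bullet> x) / 2"
    by (subst euclidean_inner) (simp add: sum_divide_distrib sum_negf power2_eq_square)
  finally show ?thesis by (simp add: gaussian_def power2_norm_eq_inner)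
qed

lemma prod_cis: "finite A \<Longrightarrow> (\<Prod>b\<in>A. cis (f b)) = cis (\<Sum>b\<in>A. f b)"
  by (induction A rule: finite_induct) (auto simp: cis_mult)

lemma
  fixes \<xi> :: "real^'n::finite"
  shows fourier_gaussian: "fourier (\<lambda>x. of_real (gaussian x)) \<xi> = of_real (gaussian \<xi>)"
    and integrable_complex_gaussian: "integrable lborel (\<lambda>x::real^'n. complex_of_real (gaussian x))"
proof -
  have e: "(\<Prod>b\<in>Basis. cis (- ((x \<bullet> b) * (\<xi> \<bullet> b))) * complex_of_real (exp (- (x \<bullet> b)\<^sup>2 / 2))) = cis (- (x \<bullet> \<xi>)) * of_real (gaussian x)"
    for x \<xi> :: "real^'n"
    unfolding prod.distrib of_real_prod[symmetric] prod_gaussian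
    by (subst prod_cis) (auto simp: sum_negf euclidean_inner[of x \<xi>])
  have "integrable lborel (\<lambda>x::real^'n. cis (- (x \<bullet> 0)) * complex_of_real (gaussian x))"
    unfolding e[symmetric] by (rule lborel_integrable_prod) (rule fourier_integral_gaussian_real)
  then show "integrable lborel (\<lambda>x::real^'n. complex_of_real (gaussian x))" by simp
  have "(LINT x|lborel. cis (- (x \<bullet> \<xi>)) * complex_of_real (gaussian x)) =
      (\<Prod>b\<in>Basis. LINT t|lborel. cis (- (t * (\<xi> \<bullet> b))) * complex_of_real (exp (- t\<^sup>2 / 2)))"
    unfolding e[symmetric] by (rule lborel_integral_prod) (rule fourier_integral_gaussian_real)
  also have "\<dots> = of_real (sqrt (2 * pi) ^ CARD('n) * gaussian \<xi>)"
    unfolding fourier_integral_gaussian_real(2) of_real_prod[symmetric] prod.distrib prod_gaussian by simp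
  also have "sqrt (2 * pi) ^ CARD('n) = (2 * pi) powr (real CARD('n) / 2)"
    by (simp add: powr_half_sqrt[symmetric] powr_realpow[symmetric] powr_powr)
  finally show "fourier (\<lambda>x. of_real (gaussian x)) \<xi> = of_real (gaussian \<xi>)"
    unfolding fourier_eq fourier_const_def
    by (simp add: powr_minus field_simps)
qed

lemma integrable_gaussian: "integrable lborel (gaussian :: real^'n::finite \<Rightarrow> real)"
  using integrable_complex_gaussian[where 'n='n] by (simp add: complex_of_real_integrable_eq)

text \<open>The fixed point property read at the origin. It says that \<open>fourier_const\<close>
  times a Gaussian is a probability density, so its contractions form an approximate
  identity.\<close>

lemma integral_gaussian: "fourier_const TYPE('n::finite) * (LINT x|lborel. gaussian (x::real^'n)) = 1"
proof -
  have "of_real (fourier_const TYPE('n) * (LINT x|lborel. gaussian (x::real^'n))) = (1::complex)"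
    using fourier_gaussian[of "0::real^'n"] by (simp add: fourier_eq gaussian_0)
  then show ?thesis by (metis of_real_1 of_real_eq_iff)
qed

lemma
  assumes "e > 0"
  shows integrable_gaussian_scale: "integrable lborel (\<lambda>x::real^'n::finite. complex_of_real (gaussian (e *\<^sub>R x)))"
    and fourier_gaussian_scale: "fourier (\<lambda>x::real^'n. of_real (gaussian (e *\<^sub>R x))) \<xi> =
      of_real (inverse (e ^ CARD('n)) * gaussian (inverse e *\<^sub>R \<xi>))"
  using lborel_integrable_affine[OF integrable_complex_gaussian[where 'n='n], of e 0]
    fourier_dilate[OF integrable_complex_gaussian[where 'n='n], of e \<xi>] assms
  by (simp_all add: fourier_gaussian)

text \<open>The multiplication formula is applied to \<open>f\<close> and a Gaussian of width
  tending to infinity. On one side the damping disappears and the integral of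
  \<open>fourier f\<close> remains; on the other side the transformed Gaussian averages
  \<open>f\<close> over shrinking balls around 0, where \<open>f\<close> is continuous.\<close>

lemma fourier_fourier_0:
  fixes f :: "real^'n::finite \<Rightarrow> complex"
  assumes f: "integrable lborel f" and Ff: "integrable lborel (fourier f)"
    and cont: "isCont f 0" and bd: "\<And>x. norm (f x) \<le> B"
  shows "fourier (fourier f) 0 = f 0"
proof -
  define e where "e m = 1 / real (Suc m)" for m :: nat
  have e: "e m > 0" for m by (auto simp: e_def)
  have elim: "e \<longlonglongrightarrow> 0" unfolding e_def using LIMSEQ_inverse_real_of_nat by (simp add: inverse_eq_divide)
  have [measurable]: "f \<in> borel_measurable borel" "fourier f \<in> borel_measurable borel" using f by auto
  have B: "B \<ge> 0" using bd[of 0] norm_ge_zero order_trans by blast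
  have eq: "(LINT \<xi>|lborel. fourier f \<xi> * of_real (gaussian (e m *\<^sub>R \<xi>))) = (LINT y|lborel. f (e m *\<^sub>R y) * of_real (gaussian y))" for m
  proof -
    have "integrable lborel (\<lambda>y::real^'n. B * gaussian (inverse (e m) *\<^sub>R y))"
      using integrable_gaussian_scale[of "inverse (e m)", where 'n='n] e[of m]
      by (simp add: complex_of_real_integrable_eq)
    then have i: "integrable lborel (\<lambda>y. f y * of_real (gaussian (inverse (e m) *\<^sub>R y)))"
      by (rule Bochner_Integration.integrable_bound)
        (use bd B in \<open>auto simp: norm_mult abs_mult gaussian_pos less_imp_le intro!: mult_right_mono\<close>)
    have "(LINT \<xi>|lborel. fourier f \<xi> * of_real (gaussian (e m *\<^sub>R \<xi>))) = (LINT y|lborel. f y * of_real (inverse (e m ^ CARD('n)) * gaussian (inverse (e m) *\<^sub>R y)))"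
      by (subst fourier_multiplication_formula[OF f integrable_gaussian_scale[OF e]]) (simp add: fourier_gaussian_scale[OF e])
    also have "\<dots> = of_real (inverse (e m ^ CARD('n))) * (LINT y|lborel. f y * of_real (gaussian (inverse (e m) *\<^sub>R y)))"
      by (simp add: mult_ac flip: integral_mult_right_zero)
    also have "(LINT y|lborel. f y * of_real (gaussian (inverse (e m) *\<^sub>R y))) =
        (e m ^ CARD('n)) *\<^sub>R (LINT y|lborel. f (e m *\<^sub>R y) * of_real (gaussian y))"
      using lborel_integral_affine[OF i, of "e m" 0] e[of m] by simp
    finally show ?thesis using e[of m] by (simp add: scaleR_conv_of_real)
  qed
  have glim: "(\<lambda>m. gaussian (e m *\<^sub>R x)) \<longlonglongrightarrow> 1" for x :: "real^'n"
    unfolding e_def by (rule gaussian_scale_tendsto_1)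
  have flim: "(\<lambda>m. f (e m *\<^sub>R x)) \<longlonglongrightarrow> f 0" for x :: "real^'n"
  proof -
    have "(\<lambda>m. e m *\<^sub>R x) \<longlonglongrightarrow> 0 *\<^sub>R x" by (intro tendsto_scaleR elim tendsto_const)
    then show ?thesis using isCont_tendsto_compose[OF cont] by simp
  qed
  have "(\<lambda>m. LINT \<xi>|lborel. fourier f \<xi> * of_real (gaussian (e m *\<^sub>R \<xi>))) \<longlonglongrightarrow> (LINT \<xi>|lborel. fourier f \<xi> * of_real 1)"
  proof (rule integral_dominated_convergence[where w = "\<lambda>\<xi>. norm (fourier f \<xi>)"])
    show "AE \<xi> in lborel. (\<lambda>m. fourier f \<xi> * of_real (gaussian (e m *\<^sub>R \<xi>))) \<longlonglongrightarrow> fourier f \<xi> * of_real 1"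
      by (intro AE_I2 tendsto_mult tendsto_const tendsto_of_real glim)
  qed (auto intro!: integrable_norm Ff simp: norm_mult mult_left_le gaussian_le_1 less_imp_le[OF gaussian_pos])
  moreover have "(\<lambda>m. LINT y|lborel. f (e m *\<^sub>R y) * of_real (gaussian y)) \<longlonglongrightarrow> (LINT y|lborel. f 0 * of_real (gaussian (y::real^'n)))"
    by (rule integral_dominated_convergence[where w = "\<lambda>y::real^'n. B * gaussian y"])
      (auto intro!: integrable_mult_right integrable_gaussian tendsto_mult flim mult_right_mono bd simp: norm_mult less_imp_le[OF gaussian_pos])
  ultimately have "(LINT \<xi>|lborel. fourier f \<xi>) = f 0 * of_real (LINT y|lborel. gaussian (y::real^'n))"
    unfolding eq using LIMSEQ_unique by fastforce
  then have "fourier (fourier f) 0 = f 0 * of_real (fourier_const TYPE('n) * (LINT y|lborel. gaussian (y::real^'n)))"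
    by (simp add: fourier_eq[of "fourier f"])
  then show ?thesis unfolding integral_gaussian by simp
qed

text \<open>Translation reduces the claim to the origin: the first transform turns the translation
  into a modulation, and the second turns the modulation into a shift of the evaluation point from 0
  to \<open>x\<close>.\<close>

theorem fourier_fourier:
  assumes f: "f \<in> schwartz"
  shows "fourier (fourier f) x = f (- x)"
proof -
  let ?g = "\<lambda>y. f (y + (- x))"
  have int: "integrable lborel f" by (rule schwartz_integrable[OF f])
  have intF: "integrable lborel (fourier f)" by (intro schwartz_integrable schwartz_fourier f)
  have ig: "integrable lborel ?g"
    using lborel_integrable_affine[OF int, of 1 "- x"] by (simp add: add.commute)
  obtain B where B: "\<And>x. norm (f x) \<le> B" using schwartz_bounded[OF f] by blast
  have Fg: "fourier ?g = (\<lambda>\<xi>. cis (- (\<xi> \<bullet> x)) * fourier f \<xi>)"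
    by (rule ext, subst fourier_translate[OF int]) (simp add: inner_commute)
  have "fourier (fourier ?g) 0 = ?g 0"
  proof (rule fourier_fourier_0[OF ig])
    show "integrable lborel (fourier ?g)" unfolding Fg by (rule integrable_cis_mult[OF intF])
    have "isCont f y" for y
      using schwartz_differentiable[OF f] differentiable_imp_continuous_within by blast
    then show "isCont ?g 0" by - (rule isCont_o2[where f="\<lambda>y. y + - x" and g=f], auto intro!: continuous_intros)
  qed (rule B)
  then show ?thesis unfolding Fg fourier_modulate by simp
qed

lemma inv_fourier_fourier: "f \<in> schwartz \<Longrightarrow> inv_fourier (fourier f) = f"
  unfolding inv_fourier_eq[abs_def] by (simp add: fourier_fourier)

section \<open>The Plancherel inequality\<close>

lemma borel_measurable_cnj[measurable]: "cnj \<in> borel_measurable borel"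
  by (intro borel_measurable_continuous_onI continuous_on_cnj continuous_on_id)

lemma cnj_fourier: "cnj (fourier h \<xi>) = fourier (\<lambda>y. cnj (h y)) (- \<xi>)"
  unfolding fourier_eq by (simp add: cis_cnj flip: Bochner_Integration.integral_cnj)

lemma nn_integral_gaussian_kernel:
  assumes e: "e > 0"
  shows "(\<integral>\<^sup>+z. ennreal (fourier_const TYPE('n::finite) * (inverse (e ^ CARD('n)) * gaussian (inverse e *\<^sub>R (z::real^'n)))) \<partial>lborel) = 1"
proof -
  have "(\<integral>\<^sup>+z. ennreal (fourier_const TYPE('n) * gaussian (z::real^'n)) \<partial>lborel) = 1"
    using integrable_gaussian[where 'n='n] fourier_const_pos[where 'n='n]
    by (subst nn_integral_eq_integral) (auto simp: integral_gaussian less_imp_le[OF gaussian_pos])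
  also have "(\<integral>\<^sup>+z. ennreal (fourier_const TYPE('n) * gaussian (z::real^'n)) \<partial>lborel) =
      (\<integral>\<^sup>+z. ennreal (inverse (e ^ CARD('n))) * ennreal (fourier_const TYPE('n) * gaussian (inverse e *\<^sub>R (z::real^'n))) \<partial>lborel)"
    using e by (subst nn_integral_lborel_affine[of _ "inverse e" 0]) (auto simp: nn_integral_cmult power_inverse)
  finally show ?thesis using e fourier_const_pos[where 'n='n]
    by (simp add: ennreal_mult'[symmetric] less_imp_le[OF gaussian_pos] mult_ac)
qed

lemma nn_integral_gaussian_kernel_shift:
  fixes x :: "real^'n::finite"
  assumes e: "e > 0"
  shows "(\<integral>\<^sup>+y. ennreal (fourier_const TYPE('n) * (inverse (e ^ CARD('n)) * gaussian (inverse e *\<^sub>R (x - y)))) \<partial>lborel) = 1"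
  using nn_integral_lborel_affine[of "\<lambda>z. ennreal (fourier_const TYPE('n) * (inverse (e ^ CARD('n)) * gaussian (inverse e *\<^sub>R (z::real^'n))))" "-1" x]
    nn_integral_gaussian_kernel[OF e, where 'n='n] by simp

text \<open>Damping by a Gaussian makes Fubini applicable and turns the left-hand side into a double integral of
  \<open>h(x) \<cdot> cnj h(y)\<close> against a probability density in \<open>x - y\<close>, to which AM-GM applies. No density
  argument is needed.\<close>

lemma plancherel_gaussian:
  fixes h :: "real^'n::finite \<Rightarrow> complex"
  assumes h: "integrable lborel h" and e: "e > 0"
  shows "(\<integral>\<^sup>+\<xi>. ennreal ((norm (fourier h \<xi>))\<^sup>2 * gaussian (e *\<^sub>R \<xi>)) \<partial>lborel) \<le> (\<integral>\<^sup>+x. ennreal ((norm (h x))\<^sup>2) \<partial>lborel)"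
proof -
  let ?c = "fourier_const TYPE('n)"
  note c = fourier_const_pos[where 'n='n]
  \<comment> \<open>\<open>K\<close> is the transform of the damping factor
    \<open>gaussian (e *\<^sub>R x)\<close>, and \<open>?c * K\<close> has total mass 1.\<close>
  define K where "K z = inverse (e ^ CARD('n)) * gaussian (inverse e *\<^sub>R (z::real^'n))" for z
  have K0: "K z \<ge> 0" for z using e by (simp add: K_def less_imp_le[OF gaussian_pos])
  have Kb: "K z \<le> inverse (e ^ CARD('n))" for z using e by (simp add: K_def gaussian_le_1 mult_left_le)
  have [measurable]: "h \<in> borel_measurable borel" "fourier h \<in> borel_measurable borel" using h by auto
  have [measurable]: "K \<in> borel_measurable borel" unfolding K_def by measurable
  define B where "B = ?c * (LINT x|lborel. norm (h x))"
  have B: "norm (fourier h \<xi>) \<le> B" for \<xi> unfolding B_def by (rule norm_fourier_le[OF h])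
  have B0: "B \<ge> 0" using order_trans[OF norm_ge_zero B] by blast
  \<comment> \<open>With this factor the damped integral becomes that of
    \<open>fourier h \<xi> * k \<xi>\<close>. The multiplication formula moves it to
    \<open>h x * fourier k x\<close>, where \<open>fourier k\<close> is the convolution of
    \<open>cnj h\<close> with \<open>?c * K\<close>.\<close>
  define k where "k \<xi> = cnj (fourier h \<xi>) * of_real (gaussian (e *\<^sub>R \<xi>))" for \<xi>
  have [measurable]: "k \<in> borel_measurable borel" unfolding k_def by measurable
  have ig: "integrable lborel (\<lambda>x::real^'n. gaussian (e *\<^sub>R x))"
    using integrable_gaussian_scale[OF e, where 'n='n] by (simp add: complex_of_real_integrable_eq)
  have ik: "integrable lborel k"
    by (rule Bochner_Integration.integrable_bound[OF integrable_mult_right[OF ig, of B]])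
      (use B B0 in \<open>auto simp: k_def norm_mult abs_mult less_imp_le[OF gaussian_pos] intro!: mult_right_mono\<close>)
  have ihs: "integrable lborel (\<lambda>y. cnj (h (- y)))"
    using lborel_integrable_affine[OF h, of "-1" 0] by simp
  have Fhs: "fourier (\<lambda>y. cnj (h (- y))) \<xi> = cnj (fourier h \<xi>)" for \<xi>
    using fourier_reflect[of "\<lambda>y. cnj (h y)" \<xi>] h by (simp add: cnj_fourier)
  have Fk: "fourier k x = of_real ?c * (LINT y|lborel. cnj (h y) * of_real (K (x - y)))" for x
  proof -
    have iG: "integrable lborel (\<lambda>\<xi>. cis (- (\<xi> \<bullet> x)) * complex_of_real (gaussian (e *\<^sub>R \<xi>)))"
      by (rule integrable_cis_mult[OF integrable_gaussian_scale[OF e]])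
    have "(LINT \<xi>|lborel. cis (- (\<xi> \<bullet> x)) * k \<xi>) = (LINT \<xi>|lborel. fourier (\<lambda>y. cnj (h (- y))) \<xi> * (cis (- (\<xi> \<bullet> x)) * of_real (gaussian (e *\<^sub>R \<xi>))))"
      by (simp add: Fhs k_def mult_ac)
    also have "\<dots> = (LINT y|lborel. cnj (h (- y)) * of_real (K (y + x)))"
      by (subst fourier_multiplication_formula[OF ihs iG], subst fourier_modulate) (simp add: fourier_gaussian_scale[OF e] K_def)
    also have "\<dots> = (LINT y|lborel. cnj (h y) * of_real (K (x - y)))"
    proof -
      have "integrable lborel (\<lambda>y. inverse (e ^ CARD('n)) * norm (h (- y)))"
        using ihs[THEN integrable_norm] by (intro integrable_mult_right) simp
      then have "integrable lborel (\<lambda>y. cnj (h (- y)) * of_real (K (y + x)))"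
        by (rule Bochner_Integration.integrable_bound)
          (use e Kb K0 in \<open>auto simp: norm_mult mult.commute[of "norm _"] abs_mult intro!: mult_right_mono\<close>)
      from lborel_integral_affine[OF this, of "-1" 0] show ?thesis by simp
    qed
    finally show ?thesis unfolding fourier_eq by simp
  qed
  have iprod: "integrable lborel (\<lambda>x. h x * fourier k x)"
  proof -
    have [measurable]: "fourier k \<in> borel_measurable borel" by (rule fourier_measurable[OF ik])
    have "integrable lborel (\<lambda>x. norm (h x) * (?c * (LINT x|lborel. norm (k x))))"
      by (intro integrable_mult_left integrable_norm h)
    then show ?thesis
    proof (rule Bochner_Integration.integrable_bound)
      have "norm (h x * fourier k x) \<le> norm (h x) * (?c * (LINT x|lborel. norm (k x)))" for x
        unfolding norm_mult by (intro mult_left_mono norm_fourier_le[OF ik]) simp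
      then show "AE x in lborel. norm (h x * fourier k x) \<le> norm (norm (h x) * (?c * (LINT x|lborel. norm (k x))))"
        by (intro AE_I2) (metis abs_ge_self order_trans real_norm_def)
    qed measurable
  qed
  have Fkb: "ennreal (norm (fourier k x)) \<le> (\<integral>\<^sup>+y. ennreal (?c * (norm (h y) * K (x - y))) \<partial>lborel)" for x
  proof -
    have i: "integrable lborel (\<lambda>y. cnj (h y) * of_real (K (x - y)))"
    proof -
      have "integrable lborel (\<lambda>y. inverse (e ^ CARD('n)) * norm (h y))"
        by (intro integrable_mult_right integrable_norm h)
      then show ?thesis
        by (rule Bochner_Integration.integrable_bound)
          (use e Kb K0 in \<open>auto simp: norm_mult mult.commute[of "norm _"] abs_mult intro!: mult_right_mono\<close>)
    qed
    have "ennreal (norm (fourier k x)) = ennreal ?c * ennreal (norm (LINT y|lborel. cnj (h y) * of_real (K (x - y))))"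
      unfolding Fk norm_mult using c by (simp add: ennreal_mult)
    also have "\<dots> \<le> ennreal ?c * (\<integral>\<^sup>+y. norm (cnj (h y) * of_real (K (x - y))) \<partial>lborel)"
      by (intro mult_left_mono integral_norm_bound_ennreal[OF i]) auto
    also have "\<dots> = (\<integral>\<^sup>+y. ennreal (?c * (norm (h y) * K (x - y))) \<partial>lborel)"
      using c K0 by (subst nn_integral_cmult[symmetric]) (auto simp: norm_mult ennreal_mult'[symmetric] intro!: nn_integral_cong)
    finally show ?thesis .
  qed
  have "(\<integral>\<^sup>+\<xi>. ennreal ((norm (fourier h \<xi>))\<^sup>2 * gaussian (e *\<^sub>R \<xi>)) \<partial>lborel) = ennreal (norm (LINT \<xi>|lborel. fourier h \<xi> * k \<xi>))"
  proof -
    have e1: "fourier h \<xi> * k \<xi> = of_real ((norm (fourier h \<xi>))\<^sup>2 * gaussian (e *\<^sub>R \<xi>))" for \<xi>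
      unfolding k_def mult.assoc[symmetric] complex_norm_square[symmetric] by simp
    have i: "integrable lborel (\<lambda>\<xi>. (norm (fourier h \<xi>))\<^sup>2 * gaussian (e *\<^sub>R \<xi>))"
      by (rule Bochner_Integration.integrable_bound[OF integrable_mult_right[OF ig, of "B\<^sup>2"]])
        (use B B0 in \<open>auto simp: abs_mult less_imp_le[OF gaussian_pos] intro!: mult_right_mono power_mono\<close>)
    have "(LINT \<xi>|lborel. fourier h \<xi> * k \<xi>) = of_real (LINT \<xi>|lborel. (norm (fourier h \<xi>))\<^sup>2 * gaussian (e *\<^sub>R \<xi>))"
      unfolding e1 by (rule integral_complex_of_real)
    moreover have "0 \<le> (LINT \<xi>|lborel. (norm (fourier h \<xi>))\<^sup>2 * gaussian (e *\<^sub>R \<xi>))"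
      by (intro Bochner_Integration.integral_nonneg) (simp add: less_imp_le[OF gaussian_pos])
    ultimately show ?thesis
      by (subst nn_integral_eq_integral[OF i]) (auto simp: less_imp_le[OF gaussian_pos])
  qed
  also have "\<dots> = ennreal (norm (LINT x|lborel. h x * fourier k x))"
    by (simp add: fourier_multiplication_formula[OF h ik])
  also have "\<dots> \<le> (\<integral>\<^sup>+x. ennreal (norm (h x * fourier k x)) \<partial>lborel)"
    by (rule integral_norm_bound_ennreal[OF iprod])
  also have "\<dots> \<le> (\<integral>\<^sup>+x. \<integral>\<^sup>+y. ennreal (norm (h x)) * ennreal (?c * (norm (h y) * K (x - y))) \<partial>lborel \<partial>lborel)"
    using Fkb by (intro nn_integral_mono) (auto simp: norm_mult ennreal_mult nn_integral_cmult intro!: mult_left_mono)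
  also have "\<dots> \<le> (\<integral>\<^sup>+x. \<integral>\<^sup>+y. ennreal ((norm (h x))\<^sup>2 / 2) * ennreal (?c * K (x - y)) + ennreal ((norm (h y))\<^sup>2 / 2) * ennreal (?c * K (x - y)) \<partial>lborel \<partial>lborel)"
  proof (intro nn_integral_mono)
    fix x y
    let ?a = "norm (h x)" and ?b = "norm (h y)"
    have "0 \<le> (?a - ?b)\<^sup>2" by simp
    then have "?a * ?b \<le> ?a\<^sup>2 / 2 + ?b\<^sup>2 / 2" by (simp add: power2_diff)
    then have "(?a * ?b) * (?c * K (x - y)) \<le> (?a\<^sup>2 / 2 + ?b\<^sup>2 / 2) * (?c * K (x - y))"
      using c K0 by (intro mult_right_mono) auto
    then have "ennreal ((?a * ?b) * (?c * K (x - y))) \<le> ennreal (?a\<^sup>2 / 2 * (?c * K (x - y)) + ?b\<^sup>2 / 2 * (?c * K (x - y)))"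
      by (intro ennreal_leI) (simp only: distrib_right)
    then show "ennreal ?a * ennreal (?c * (?b * K (x - y))) \<le> ennreal (?a\<^sup>2 / 2) * ennreal (?c * K (x - y)) + ennreal (?b\<^sup>2 / 2) * ennreal (?c * K (x - y))"
      using c K0 by (simp add: ennreal_mult'[symmetric] ennreal_plus[symmetric] mult_ac del: ennreal_plus)
  qed
  also have "\<dots> = (\<integral>\<^sup>+x. \<integral>\<^sup>+y. ennreal ((norm (h x))\<^sup>2 / 2) * ennreal (?c * K (x - y)) \<partial>lborel \<partial>lborel)
      + (\<integral>\<^sup>+x. \<integral>\<^sup>+y. ennreal ((norm (h y))\<^sup>2 / 2) * ennreal (?c * K (x - y)) \<partial>lborel \<partial>lborel)"
    by (subst nn_integral_add[symmetric]) (auto intro!: nn_integral_cong nn_integral_add)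
  \<comment> \<open>Exchanging the integrals and using that \<open>K\<close> is even turns the
    second half of the AM-GM bound into the first one.\<close>
  also have "(\<integral>\<^sup>+x. \<integral>\<^sup>+y. ennreal ((norm (h y))\<^sup>2 / 2) * ennreal (?c * K (x - y)) \<partial>lborel \<partial>lborel) =
      (\<integral>\<^sup>+y. \<integral>\<^sup>+x. ennreal ((norm (h y))\<^sup>2 / 2) * ennreal (?c * K (y - x)) \<partial>lborel \<partial>lborel)"
  proof (subst lborel_pair.Fubini'[symmetric])
    have "K (x - y) = K (y - x)" for x y
      unfolding K_def by (metis gaussian_uminus minus_diff_eq scaleR_minus_right)
    then show "(\<integral>\<^sup>+y. \<integral>\<^sup>+x. ennreal ((norm (h y))\<^sup>2 / 2) * ennreal (?c * K (x - y)) \<partial>lborel \<partial>lborel) =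
      (\<integral>\<^sup>+y. \<integral>\<^sup>+x. ennreal ((norm (h y))\<^sup>2 / 2) * ennreal (?c * K (y - x)) \<partial>lborel \<partial>lborel)" by simp
  qed measurable
  also have "(\<integral>\<^sup>+x. \<integral>\<^sup>+y. ennreal ((norm (h x))\<^sup>2 / 2) * ennreal (?c * K (x - y)) \<partial>lborel \<partial>lborel) = (\<integral>\<^sup>+x. ennreal ((norm (h x))\<^sup>2 / 2) \<partial>lborel)"
    by (subst nn_integral_cmult) (auto simp: K_def nn_integral_gaussian_kernel_shift[OF e])
  also have "(\<integral>\<^sup>+x. ennreal ((norm (h x))\<^sup>2 / 2) \<partial>lborel) + (\<integral>\<^sup>+x. ennreal ((norm (h x))\<^sup>2 / 2) \<partial>lborel) = (\<integral>\<^sup>+x. ennreal ((norm (h x))\<^sup>2) \<partial>lborel)"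
    by (subst nn_integral_add[symmetric]) (auto simp: ennreal_plus[symmetric] simp del: ennreal_plus)
  finally show ?thesis .
qed

text \<open>The right-hand side of the damped inequality does not depend on the width of the
  Gaussian, so Fatou's lemma removes the damping. Square integrability of \<open>h\<close> is no
  issue, since the right-hand side may be infinite.\<close>

theorem plancherel_le:
  fixes h :: "real^'n::finite \<Rightarrow> complex"
  assumes h: "integrable lborel h"
  shows "(\<integral>\<^sup>+\<xi>. ennreal ((norm (fourier h \<xi>))\<^sup>2) \<partial>lborel) \<le> (\<integral>\<^sup>+x. ennreal ((norm (h x))\<^sup>2) \<partial>lborel)" (is "_ \<le> ?R")
proof -
  have [measurable]: "fourier h \<in> borel_measurable borel" using h by auto
  define e where "e m = 1 / real (Suc m)" for m :: nat
  have e: "e m > 0" for m by (auto simp: e_def)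
  let ?u = "\<lambda>m \<xi>. ennreal ((norm (fourier h \<xi>))\<^sup>2 * gaussian (e m *\<^sub>R \<xi>))"
  have lim: "(\<lambda>m. ?u m \<xi>) \<longlonglongrightarrow> ennreal ((norm (fourier h \<xi>))\<^sup>2)" for \<xi>
  proof -
    have "(\<lambda>m. (norm (fourier h \<xi>))\<^sup>2 * gaussian (e m *\<^sub>R \<xi>)) \<longlonglongrightarrow> (norm (fourier h \<xi>))\<^sup>2 * 1"
      unfolding e_def by (intro tendsto_mult tendsto_const gaussian_scale_tendsto_1)
    then show ?thesis by (intro tendsto_ennrealI) simp
  qed
  have "(\<integral>\<^sup>+\<xi>. ennreal ((norm (fourier h \<xi>))\<^sup>2) \<partial>lborel) = (\<integral>\<^sup>+\<xi>. liminf (\<lambda>m. ?u m \<xi>) \<partial>lborel)"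
    using lim_imp_Liminf[OF _ lim] by simp
  also have "\<dots> \<le> liminf (\<lambda>m. \<integral>\<^sup>+\<xi>. ?u m \<xi> \<partial>lborel)" by (rule nn_integral_liminf) measurable
  also have "\<dots> \<le> ?R"
    by (intro Liminf_le) (auto intro!: always_eventually plancherel_gaussian[OF h e])
  finally show ?thesis .
qed

section \<open>Lebesgue norms\<close>

lemma epow_ennreal: "r \<ge> 0 \<Longrightarrow> epow (ennreal r) a = ennreal (r powr a)"
  by (simp add: epow_def)

lemma epow_top [simp]: "epow top a = top" by (simp add: epow_def)

lemma epow_0 [simp]: "epow 0 a = 0" by (simp add: epow_def)

lemma epow_one [simp]: "epow x 1 = x"
  by (cases x) (auto simp: epow_def)

lemma epow_eq_top_iff [simp]: "epow x a = top \<longleftrightarrow> x = top"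
  by (cases x) (auto simp: epow_def)

lemma epow_less_top_iff [simp]: "epow x a < top \<longleftrightarrow> x < top"
  using epow_eq_top_iff[of x a] by (metis less_top)

lemma epow_eq_0_iff [simp]: "epow x a = 0 \<longleftrightarrow> x = 0"
  by (cases x) (auto simp: epow_def ennreal_eq_0_iff)

lemma epow_mono: "0 \<le> a \<Longrightarrow> x \<le> y \<Longrightarrow> epow x a \<le> epow y a"
  by (cases x; cases y) (auto simp: epow_def powr_mono2 top_unique intro!: ennreal_leI)

text \<open>Zero is sent to zero and infinity to infinity for every real exponent, negative ones
  included. Multiplicativity therefore agrees with the convention that zero times infinity is
  zero.\<close>

lemma epow_mult: "epow (x * y) a = epow x a * epow y a"
proof (cases "x = \<infinity> \<or> y = \<infinity>")
  case True
  have "epow x a = 0 \<longleftrightarrow> x = 0" "epow y a = 0 \<longleftrightarrow> y = 0" by auto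
  then show ?thesis using True
    by (cases "x = 0 \<or> y = 0") (auto simp: ennreal_mult_top ennreal_top_mult)
next
  case False
  then obtain r s where "x = ennreal r" "y = ennreal s" "r \<ge> 0" "s \<ge> 0" by (cases x; cases y) auto
  then show ?thesis
    by (simp add: ennreal_mult[symmetric] epow_ennreal powr_mult)
qed

lemma epow_epow: "epow (epow x a) b = epow x (a * b)"
  by (cases x) (auto simp: epow_def powr_powr)

lemma epow_add: "epow x (a + b) = epow x a * epow x b"
  by (cases x) (auto simp: epow_def powr_add ennreal_mult)

lemma epow_inverse_le_iff:
  assumes "r > 0" shows "x \<le> epow y (1 / r) \<longleftrightarrow> epow x r \<le> y"
proof
  assume "x \<le> epow y (1 / r)"
  then have "epow x r \<le> epow (epow y (1 / r)) r" using assms by (intro epow_mono) auto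
  then show "epow x r \<le> y" using assms by (simp add: epow_epow)
next
  assume "epow x r \<le> y"
  then have "epow (epow x r) (1 / r) \<le> epow y (1 / r)" using assms by (intro epow_mono) auto
  then show "x \<le> epow y (1 / r)" using assms by (simp add: epow_epow)
qed

lemma ennreal_ge_1_cases:
  assumes "(p::ennreal) \<ge> 1"
  obtains "p = \<infinity>" | r where "p = ennreal r" "r \<ge> 1"
  using assms by (cases p) auto

lemma inv_exp_ennreal: "r \<ge> 0 \<Longrightarrow> inv_exp (ennreal r) = 1 / r"
  by (simp add: inv_exp_def)

lemma inv_exp_top [simp]: "inv_exp top = 0" by (simp add: inv_exp_def)

lemma inv_exp_eq_0: "p \<ge> 1 \<Longrightarrow> inv_exp p = 0 \<Longrightarrow> p = \<infinity>"
  by (cases p rule: ennreal_ge_1_cases) (auto simp: inv_exp_ennreal)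

lemma inv_exp_eq_1: "p \<ge> 1 \<Longrightarrow> inv_exp p = 1 \<Longrightarrow> p = 1"
  by (cases p rule: ennreal_ge_1_cases) (auto simp: inv_exp_ennreal)

text \<open>Young's inequality for \<open>u\<close> and \<open>v\<close> divided by their norms
  \<alpha> and \<beta>. A vanishing norm is treated first: the product on the right is then 0 even
  if the other norm is infinite, so the integrand has to be shown to vanish almost
  everywhere.\<close>

theorem nn_integral_Hoelder:
  fixes u v :: "'a \<Rightarrow> real"
  assumes [measurable]: "u \<in> borel_measurable M" "v \<in> borel_measurable M"
    and u0: "\<And>x. u x \<ge> 0" and v0: "\<And>x. v x \<ge> 0"
    and rs: "r > 1" "s > 1" "1 / r + 1 / s = 1"
  shows "(\<integral>\<^sup>+x. ennreal (u x * v x) \<partial>M) \<le>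
    epow (\<integral>\<^sup>+x. ennreal (u x powr r) \<partial>M) (1 / r) * epow (\<integral>\<^sup>+x. ennreal (v x powr s) \<partial>M) (1 / s)"
    (is "_ \<le> epow ?A _ * epow ?B _")
proof (cases "?A = 0 \<or> ?B = 0")
  case True
  then have "AE x in M. u x * v x = 0"
  proof
    assume "?A = 0"
    then have "AE x in M. ennreal (u x powr r) = 0" by (subst (asm) nn_integral_0_iff_AE) auto
    then show ?thesis by eventually_elim (auto simp: ennreal_eq_0_iff powr_nonneg_iff)
  next
    assume "?B = 0"
    then have "AE x in M. ennreal (v x powr s) = 0" by (subst (asm) nn_integral_0_iff_AE) auto
    then show ?thesis by eventually_elim (auto simp: ennreal_eq_0_iff powr_nonneg_iff)
  qed
  then have "(\<integral>\<^sup>+x. ennreal (u x * v x) \<partial>M) = 0" by (subst nn_integral_0_iff_AE) auto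
  then show ?thesis by simp
next
  case ne: False
  show ?thesis
  proof (cases "?A = \<infinity> \<or> ?B = \<infinity>")
    case True
    then have "epow ?A (1/r) * epow ?B (1/s) = \<infinity>"
      using ne by (auto simp: ennreal_mult_top ennreal_top_mult)
    then show ?thesis by simp
  next
    case False
    obtain a where a: "?A = ennreal a" "a > 0" using ne False by (cases ?A) (auto simp: order.order_iff_strict)
    obtain b where b: "?B = ennreal b" "b > 0" using ne False by (cases ?B) (auto simp: order.order_iff_strict)
    define \<alpha> where "\<alpha> = a powr (1/r)"
    define \<beta> where "\<beta> = b powr (1/s)"
    have ab: "\<alpha> > 0" "\<beta> > 0" using a b by (auto simp: \<alpha>_def \<beta>_def)
    have ab': "\<alpha> powr r = a" "\<beta> powr s = b" using a b rs by (auto simp: \<alpha>_def \<beta>_def powr_powr)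
    have y: "u x * v x \<le> (\<alpha> * \<beta>) * (u x powr r / (a * r) + v x powr s / (b * s))" for x
    proof -
      have "(u x / \<alpha>) * (v x / \<beta>) \<le> (u x / \<alpha>) powr r / r + (v x / \<beta>) powr s / s"
        using u0 v0 ab rs by (intro Youngs_inequality) auto
      then have "(\<alpha> * \<beta>) * ((u x / \<alpha>) * (v x / \<beta>)) \<le> (\<alpha> * \<beta>) * ((u x / \<alpha>) powr r / r + (v x / \<beta>) powr s / s)"
        using ab by (intro mult_left_mono) auto
      then show ?thesis using ab u0 v0 by (simp add: powr_divide ab' less_imp_le)
    qed
    have "(\<integral>\<^sup>+x. ennreal (u x * v x) \<partial>M) \<le> (\<integral>\<^sup>+x. ennreal (\<alpha> * \<beta>) * (ennreal (1 / (a * r)) * ennreal (u x powr r) + ennreal (1 / (b * s)) * ennreal (v x powr s)) \<partial>M)"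
    proof (intro nn_integral_mono)
      fix x
      have "ennreal (u x * v x) \<le> ennreal ((\<alpha> * \<beta>) * (u x powr r / (a * r) + v x powr s / (b * s)))"
        by (intro ennreal_leI y)
      also have "\<dots> = ennreal (\<alpha> * \<beta>) * (ennreal (1 / (a * r)) * ennreal (u x powr r) + ennreal (1 / (b * s)) * ennreal (v x powr s))"
        using ab a b rs by (simp add: ennreal_mult'[symmetric] ennreal_plus[symmetric] del: ennreal_plus)
      finally show "ennreal (u x * v x) \<le> ennreal (\<alpha> * \<beta>) * (ennreal (1 / (a * r)) * ennreal (u x powr r) + ennreal (1 / (b * s)) * ennreal (v x powr s))" .
    qed
    also have "\<dots> = ennreal (\<alpha> * \<beta>) * (ennreal (1 / (a * r)) * ennreal a + ennreal (1 / (b * s)) * ennreal b)"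
      by (simp add: nn_integral_cmult nn_integral_add a b)
    also have "\<dots> = ennreal (\<alpha> * \<beta>)"
      using ab a b rs by (simp add: ennreal_mult'[symmetric] ennreal_plus[symmetric] del: ennreal_plus)
    also have "\<dots> = epow ?A (1/r) * epow ?B (1/s)"
      using a b by (simp add: epow_ennreal \<alpha>_def \<beta>_def ennreal_mult')
    finally show ?thesis .
  qed
qed

section \<open>Norms of functions\<close>

lemma Lp_fun_norm_top: "Lp_fun_norm \<infinity> g = Inf {C. AE x in lborel. ennreal (norm (g x)) \<le> C}"
  by (simp add: Lp_fun_norm_def)

lemma Lp_fun_norm_real:
  "r \<ge> 0 \<Longrightarrow> Lp_fun_norm (ennreal r) g = epow (\<integral>\<^sup>+ x. ennreal (norm (g x) powr r) \<partial>lborel) (1 / r)"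
  by (simp add: Lp_fun_norm_def)

lemma Lp_fun_norm_1: "Lp_fun_norm 1 g = (\<integral>\<^sup>+ x. ennreal (norm (g x)) \<partial>lborel)"
  using Lp_fun_norm_real[of 1 g] by simp

text \<open>The infimum of the essential bounds is attained: it is the infimum of countably many of
  them, and countably many null sets can be discarded together.\<close>

lemma Lp_fun_norm_top_AE: "AE x in lborel. ennreal (norm (g x)) \<le> Lp_fun_norm \<infinity> g"
proof -
  let ?A = "{C. AE x in lborel. ennreal (norm (g x)) \<le> C}"
  have "\<infinity> \<in> ?A" by simp
  then have "?A \<noteq> {}" by blast
  from ennreal_Inf_countable_INF[OF this] obtain f :: "nat \<Rightarrow> ennreal"
    where f: "range f \<subseteq> ?A" "Inf ?A = (INF i. f i)" by blast
  then have "AE x in lborel. \<forall>i. ennreal (norm (g x)) \<le> f i"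
    by (subst AE_all_countable) blast
  then show ?thesis unfolding Lp_fun_norm_top f(2)
    by eventually_elim (auto intro: INF_greatest)
qed

lemma Lp_fun_norm_top_le: "AE x in lborel. ennreal (norm (g x)) \<le> C \<Longrightarrow> Lp_fun_norm \<infinity> g \<le> C"
  unfolding Lp_fun_norm_top by (rule Inf_lower) simp

lemma Lp_fun_norm_mono:
  assumes p: "p \<ge> 1" and le: "AE x in lborel. norm (f x) \<le> norm (g x)"
  shows "Lp_fun_norm p f \<le> Lp_fun_norm p g"
  using p
proof (cases p rule: ennreal_ge_1_cases)
  case 1
  have "AE x in lborel. ennreal (norm (f x)) \<le> Lp_fun_norm \<infinity> g"
    using le Lp_fun_norm_top_AE[of g]
    by eventually_elim (meson ennreal_leI order_trans)
  then show ?thesis unfolding 1 by (rule Lp_fun_norm_top_le)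
next
  case (2 r)
  have "(\<integral>\<^sup>+ x. ennreal (norm (f x) powr r) \<partial>lborel) \<le> (\<integral>\<^sup>+ x. ennreal (norm (g x) powr r) \<partial>lborel)"
    by (rule nn_integral_mono_AE) (use le in \<open>eventually_elim\<close>, use 2 in \<open>auto intro!: ennreal_leI powr_mono2\<close>)
  then show ?thesis using 2 by (simp add: Lp_fun_norm_real epow_mono)
qed

lemma Lp_fun_norm_cmult_le:
  assumes p: "p \<ge> 1" and [measurable]: "f \<in> borel_measurable borel"
  shows "Lp_fun_norm p (\<lambda>x. c * f x) \<le> ennreal (norm c) * Lp_fun_norm p f"
  using p
proof (cases p rule: ennreal_ge_1_cases)
  case 1
  have "AE x in lborel. ennreal (norm (c * f x)) \<le> ennreal (norm c) * Lp_fun_norm \<infinity> f"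
    using Lp_fun_norm_top_AE[of f] by eventually_elim (auto simp: norm_mult ennreal_mult intro!: mult_left_mono)
  then show ?thesis unfolding 1 by (rule Lp_fun_norm_top_le)
next
  case (2 r)
  then show ?thesis
    by (simp add: Lp_fun_norm_real norm_mult powr_mult ennreal_mult nn_integral_cmult epow_mult)
      (simp add: epow_ennreal powr_powr)
qed

theorem Lp_fun_norm_Hoelder:
  fixes f g :: "real^'n::finite \<Rightarrow> complex"
  assumes p: "p \<ge> 1" "q \<ge> 1" "inv_exp p + inv_exp q = 1"
    and [measurable]: "f \<in> borel_measurable borel" "g \<in> borel_measurable borel"
  shows "(\<integral>\<^sup>+x. ennreal (norm (f x) * norm (g x)) \<partial>lborel) \<le> Lp_fun_norm p f * Lp_fun_norm q g"
proof -
  have inf: "(\<integral>\<^sup>+x. ennreal (norm (f x) * norm (g x)) \<partial>lborel) \<le> Lp_fun_norm \<infinity> f * Lp_fun_norm 1 g"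
    if [measurable]: "g \<in> borel_measurable borel" for f g :: "real^'n \<Rightarrow> complex"
  proof -
    have "(\<integral>\<^sup>+x. ennreal (norm (f x) * norm (g x)) \<partial>lborel) \<le> (\<integral>\<^sup>+x. Lp_fun_norm \<infinity> f * ennreal (norm (g x)) \<partial>lborel)"
      by (rule nn_integral_mono_AE)
        (use Lp_fun_norm_top_AE[of f] in \<open>eventually_elim\<close>, auto simp: ennreal_mult intro!: mult_right_mono)
    then show ?thesis by (simp add: nn_integral_cmult Lp_fun_norm_1)
  qed
  from p(1) show ?thesis
  proof (cases p rule: ennreal_ge_1_cases)
    case 1
    then have "inv_exp q = 1" using p(3) by simp
    then have "q = 1" using p(2) inv_exp_eq_1 by blast
    then show ?thesis using inf[of g f] 1 by simp
  next
    case r: (2 r)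
    from p(2) show ?thesis
    proof (cases q rule: ennreal_ge_1_cases)
      case 1
      then have "inv_exp p = 1" using p(3) by simp
      then have "p = 1" using p(1) inv_exp_eq_1 by blast
      then show ?thesis using inf[of f g] 1 by (simp add: mult.commute)
    next
      case s: (2 s)
      have "1 / r + 1 / s = 1" using p r s by (simp add: inv_exp_ennreal)
      moreover have "r \<noteq> 1" "s \<noteq> 1" using calculation r s by (auto simp: field_simps)
      ultimately show ?thesis
        using r s nn_integral_Hoelder[of "\<lambda>x. norm (f x)" lborel "\<lambda>x. norm (g x)" r s] by (simp add: Lp_fun_norm_real)
    qed
  qed
qed

lemma AE_lborel_affine:
  fixes t :: "'a::euclidean_space"
  assumes c: "c \<noteq> 0" and [measurable]: "Measurable.pred borel P" and AE: "AE x in lborel. P x"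
  shows "AE x in lborel. P (t + c *\<^sub>R x)"
proof -
  have "AE x in density (distr lborel borel (\<lambda>x. t + c *\<^sub>R x)) (\<lambda>_. ennreal (\<bar>c\<bar>^DIM('a))). P x"
    using AE by (subst lborel_affine[OF c, of t, symmetric])
  then show ?thesis using c by (simp add: AE_density AE_distr_iff)
qed

lemma Lp_fun_norm_affine_le:
  fixes f :: "real^'n::finite \<Rightarrow> complex"
  assumes p: "p \<ge> 1" and a: "a \<noteq> 0" and [measurable]: "f \<in> borel_measurable borel"
  shows "Lp_fun_norm p (\<lambda>x. f (t + a *\<^sub>R x)) \<le> ennreal (\<bar>a\<bar> powr (- real CARD('n) * inv_exp p)) * Lp_fun_norm p f"
  using p
proof (cases p rule: ennreal_ge_1_cases)
  case 1
  have "AE x in lborel. ennreal (norm (f (t + a *\<^sub>R x))) \<le> Lp_fun_norm \<infinity> f"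
    by (rule AE_lborel_affine[OF a _ Lp_fun_norm_top_AE]) measurable
  from Lp_fun_norm_top_le[OF this] show ?thesis unfolding 1 using a by simp
next
  case (2 r)
  let ?I = "\<integral>\<^sup>+ x. ennreal (norm (f (t + a *\<^sub>R x)) powr r) \<partial>lborel"
  have "(\<integral>\<^sup>+ x. ennreal (norm (f x) powr r) \<partial>lborel) = ennreal (\<bar>a\<bar> ^ CARD('n)) * ?I"
    by (subst nn_integral_lborel_affine[OF _ a, of _ t]) auto
  then have "ennreal (\<bar>a\<bar> powr (- real CARD('n))) * (\<integral>\<^sup>+ x. ennreal (norm (f x) powr r) \<partial>lborel) = ?I"
    using a by (simp add: mult.assoc[symmetric] ennreal_mult'[symmetric] powr_minus powr_realpow)
  then have "Lp_fun_norm p (\<lambda>x. f (t + a *\<^sub>R x)) = epow (ennreal (\<bar>a\<bar> powr (- real CARD('n)))) (1 / r) * Lp_fun_norm p f"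
    using 2 by (simp add: Lp_fun_norm_real epow_mult[symmetric])
  then show ?thesis using 2 by (simp add: epow_ennreal powr_powr inv_exp_ennreal)
qed

lemma Lp_fun_norm_dilate_le:
  fixes f :: "real^'n::finite \<Rightarrow> complex"
  assumes "p \<ge> 1" "a \<noteq> 0" "f \<in> borel_measurable borel"
  shows "Lp_fun_norm p (\<lambda>x. f (a *\<^sub>R x)) \<le> ennreal (\<bar>a\<bar> powr (- real CARD('n) * inv_exp p)) * Lp_fun_norm p f"
  using Lp_fun_norm_affine_le[OF assms, of 0] by simp

lemma Lp_fun_norm_translate_le:
  fixes f :: "real^'n::finite \<Rightarrow> complex"
  assumes "p \<ge> 1" "f \<in> borel_measurable borel"
  shows "Lp_fun_norm p (\<lambda>x. f (x - y)) \<le> Lp_fun_norm p f"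
  using Lp_fun_norm_affine_le[of p 1 f "- y"] assms by simp

lemma Lp_fun_norm_reflect_le:
  fixes f :: "real^'n::finite \<Rightarrow> complex"
  assumes "p \<ge> 1" "f \<in> borel_measurable borel"
  shows "Lp_fun_norm p (\<lambda>x. f (- x)) \<le> Lp_fun_norm p f"
  using Lp_fun_norm_affine_le[of p "-1" f 0] assms by simp

text \<open>Pointwise, \<open>\<bar>f\<bar>^r\<close> is at most
  \<open>B^(r-1) * \<bar>f\<bar>\<close>. This supplies all finite norms of concrete functions:
  Schwartz functions, the weight, and indicators of balls and of the annulus.\<close>

lemma Lp_fun_norm_bounded_integrable:
  fixes f :: "real^'n::finite \<Rightarrow> complex"
  assumes p: "p \<ge> 1" and f: "integrable lborel f" and B: "\<And>x. norm (f x) \<le> B"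
  shows "Lp_fun_norm p f < \<infinity>"
  using p
proof (cases p rule: ennreal_ge_1_cases)
  case 1
  have "Lp_fun_norm \<infinity> f \<le> ennreal B"
    by (rule Lp_fun_norm_top_le) (auto intro!: ennreal_leI B)
  then show ?thesis unfolding 1 using ennreal_less_top le_less_trans by (metis infinity_ennreal_def)
next
  case (2 r)
  have [measurable]: "f \<in> borel_measurable borel" using f by auto
  have B0: "B \<ge> 0" using order_trans[OF norm_ge_zero B] by blast
  have "(\<integral>\<^sup>+ x. ennreal (norm (f x) powr r) \<partial>lborel) \<le> (\<integral>\<^sup>+ x. ennreal (B powr (r - 1)) * ennreal (norm (f x)) \<partial>lborel)"
  proof (rule nn_integral_mono)
    fix x
    have "norm (f x) powr r = norm (f x) powr (r - 1) * norm (f x)"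
      by (metis diff_add_cancel norm_ge_zero powr_add powr_one)
    also have "\<dots> \<le> B powr (r - 1) * norm (f x)"
      using B 2 by (intro mult_right_mono powr_mono2) auto
    finally show "ennreal (norm (f x) powr r) \<le> ennreal (B powr (r - 1)) * ennreal (norm (f x))"
      by (simp add: ennreal_mult[symmetric] ennreal_leI)
  qed
  also have "\<dots> < \<infinity>"
    using f by (subst nn_integral_cmult) (auto simp: integrable_iff_bounded ennreal_mult_less_top)
  finally show ?thesis using 2 by (simp add: Lp_fun_norm_real)
qed

lemma integrable_complex_indicator:
  assumes "A \<in> sets M" "emeasure M A < \<infinity>"
  shows "integrable M (indicator A :: 'a \<Rightarrow> complex)"
proof -
  have "integrable M (\<lambda>x. complex_of_real (indicator A x))"
    using integrable_real_indicator[OF assms] by (simp only: complex_of_real_integrable_eq)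
  then show ?thesis by (simp add: of_real_indicator)
qed

lemma Lp_fun_norm_schwartz: "p \<ge> 1 \<Longrightarrow> f \<in> schwartz \<Longrightarrow> Lp_fun_norm p f < \<infinity>"
  using schwartz_bounded Lp_fun_norm_bounded_integrable schwartz_integrable by metis

lemma Lp_Hoelder_integrable:
  fixes f g :: "real^'n::finite \<Rightarrow> complex"
  assumes "p \<ge> 1" "q \<ge> 1" "inv_exp p + inv_exp q = 1"
    and [measurable]: "f \<in> borel_measurable borel" "g \<in> borel_measurable borel"
    and "Lp_fun_norm p f < \<infinity>" "Lp_fun_norm q g < \<infinity>"
  shows "integrable lborel (\<lambda>x. f x * g x)"
proof (rule integrableI_bounded)
  have "(\<integral>\<^sup>+x. ennreal (norm (f x * g x)) \<partial>lborel) \<le> Lp_fun_norm p f * Lp_fun_norm q g"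
    unfolding norm_mult by (rule Lp_fun_norm_Hoelder) (use assms in auto)
  also have "\<dots> < \<infinity>" using assms by (simp add: ennreal_mult_less_top)
  finally show "(\<integral>\<^sup>+x. ennreal (norm (f x * g x)) \<partial>lborel) < \<infinity>" .
qed measurable

section \<open>Distributions represented by functions\<close>

lemma representsD:
  assumes "represents g u"
  shows "g \<in> borel_measurable borel" "\<psi> \<in> schwartz \<Longrightarrow> integrable lborel (\<lambda>x. g x * \<psi> x)"
    "\<psi> \<in> schwartz \<Longrightarrow> u \<psi> = (LINT x|lborel. g x * \<psi> x)"
  using assms by (auto simp: represents_def)

lemma Lp_norm_le: "represents g u \<Longrightarrow> Lp_norm p u \<le> Lp_fun_norm p g"
  unfolding Lp_norm_def by (rule Inf_lower) blast

text \<open>The step from representatives to the infimum. Positivity of \<open>C\<close> matters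
  when there is no representative of finite norm: then \<open>Lp_norm\<close> is infinite, and only
  a positive constant keeps the right-hand side infinite.\<close>

lemma le_Lp_normI:
  assumes C: "C > 0"
    and le: "\<And>g. represents g u \<Longrightarrow> Lp_fun_norm p g < \<infinity> \<Longrightarrow> N \<le> ennreal C * Lp_fun_norm p g"
  shows "N \<le> ennreal C * Lp_norm p u"
proof -
  have eq: "ennreal C * (N / ennreal C) = N"
    using C by (simp add: ennreal_times_divide mult.commute[of "ennreal C"] ennreal_mult_divide_eq)
  have "N / ennreal C \<le> Lp_norm p u" unfolding Lp_norm_def
  proof (rule Inf_greatest, safe)
    fix g assume g: "represents g u"
    show "N / ennreal C \<le> Lp_fun_norm p g"
    proof (cases "Lp_fun_norm p g < \<infinity>")
      case True
      then show ?thesis using le[OF g True] C by (intro divide_le_posI_ennreal) (auto simp: mult.commute)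
    next
      case False
      then have "Lp_fun_norm p g = \<infinity>" by (metis infinity_ennreal_def less_top)
      then show ?thesis by simp
    qed
  qed
  then have "ennreal C * (N / ennreal C) \<le> ennreal C * Lp_norm p u" by (intro mult_left_mono) auto
  then show ?thesis unfolding eq .
qed

lemma Lp_norm_lessD:
  assumes "Lp_norm p u < \<infinity>"
  obtains g where "represents g u" "Lp_fun_norm p g < \<infinity>"
  using assms unfolding Lp_norm_def Inf_less_iff by blast

section \<open>The Hausdorff--Young inequality\<close>

lemma nn_integral_powr_from_0:
  fixes a T :: real
  assumes a: "a > -1" and T: "T \<ge> 0"
  shows "(\<integral>\<^sup>+t. ennreal (t powr a) * indicator {0..T} t \<partial>lborel) = ennreal (T powr (a + 1) / (a + 1))"
proof -
  have "((\<lambda>t. if t \<in> {0..T} then t powr a else 0) has_integral (T powr (a + 1) / (a + 1))) UNIV"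
    using has_integral_powr_from_0[OF a T] by (subst has_integral_restrict_UNIV)
  then have "(\<integral>\<^sup>+t. ennreal (if t \<in> {0..T} then t powr a else 0) \<partial>lborel) = ennreal (T powr (a + 1) / (a + 1))"
    by (intro nn_integral_has_integral_lborel) auto
  moreover have "(\<integral>\<^sup>+t. ennreal (t powr a) * indicator {0..T} t \<partial>lborel) = (\<integral>\<^sup>+t. ennreal (if t \<in> {0..T} then t powr a else 0) \<partial>lborel)"
    by (intro nn_integral_cong) (auto simp: indicator_def)
  ultimately show ?thesis by simp
qed

text \<open>For \<open>T = norm (fourier h \<xi>)\<close> the open interval corresponds, at positive
  height \<open>t\<close>, to the strict superlevel set that the next lemma estimates; the end
  points form a null set.\<close>

lemma nn_integral_powr_layer_cake:
  fixes T :: real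
  assumes q: "q > 0" and T: "T \<ge> 0"
  shows "ennreal (T powr q) = (\<integral>\<^sup>+t. ennreal (q * t powr (q - 1)) * indicator {0<..<T} t \<partial>lborel)"
proof -
  have "(\<integral>\<^sup>+t. ennreal (q * t powr (q - 1)) * indicator {0<..<T} t \<partial>lborel) = (\<integral>\<^sup>+t. ennreal q * (ennreal (t powr (q - 1)) * indicator {0..T} t) \<partial>lborel)"
  proof (rule nn_integral_cong_AE)
    have "AE t::real in lborel. t \<noteq> 0 \<and> t \<noteq> T" using AE_lborel_singleton[of "0::real"] AE_lborel_singleton[of T] by eventually_elim auto
    then show "AE t in lborel. ennreal (q * t powr (q - 1)) * indicator {0<..<T} t = ennreal q * (ennreal (t powr (q - 1)) * indicator {0..T} t)"
      by eventually_elim (use q in \<open>auto simp: indicator_def ennreal_mult\<close>)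
  qed
  also have "\<dots> = ennreal q * ennreal (T powr q / q)"
    using q T nn_integral_powr_from_0[of "q - 1" T] by (simp add: nn_integral_cmult)
  also have "\<dots> = ennreal (T powr q)" using q by (simp add: ennreal_mult[symmetric])
  finally show ?thesis ..
qed

text \<open>Split \<open>h\<close> at height \<open>l\<close>. Where
  \<open>\<bar>h\<bar> > l\<close> one has
  \<open>\<bar>h\<bar> \<le> l^(1-r) * \<bar>h\<bar>^r\<close>, so the large part has a small
  \<open>L_1\<close> norm and its transform stays below \<open>t/2\<close> everywhere. A value of
  the transform above \<open>t\<close> thus forces at least \<open>t/2\<close> from the bounded
  part, and Chebyshev's inequality with the Plancherel inequality finishes; the 4 is the square of
  this 2.\<close>

lemma nn_integral_fourier_level_set:
  fixes h :: "real^'n::finite \<Rightarrow> complex"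
  assumes h: "integrable lborel h" and r: "1 < r" and t: "t > 0" and l: "l > 0"
    and a: "(\<integral>\<^sup>+x. ennreal (norm (h x) powr r) \<partial>lborel) = ennreal a" "a \<ge> 0"
    and small: "fourier_const TYPE('n) * (l powr (1 - r) * a) \<le> t / 2"
  shows "(\<integral>\<^sup>+\<xi>. indicator {\<xi>. t < norm (fourier h \<xi>)} \<xi> \<partial>lborel) \<le>
    ennreal (4 / t\<^sup>2) * (\<integral>\<^sup>+x. ennreal ((norm (h x))\<^sup>2) * indicator {x. norm (h x) \<le> l} x \<partial>lborel)"
proof -
  have [measurable]: "h \<in> borel_measurable borel" "fourier h \<in> borel_measurable borel" using h by auto
  define b where "b x = (if norm (h x) \<le> l then h x else 0)" for x
  define g where "g x = (if norm (h x) \<le> l then 0 else h x)" for x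
  have [measurable]: "b \<in> borel_measurable borel" "g \<in> borel_measurable borel" unfolding b_def g_def by measurable
  have ib: "integrable lborel b" by (rule Bochner_Integration.integrable_bound[OF h]) (auto simp: b_def)
  have ig: "integrable lborel g" by (rule Bochner_Integration.integrable_bound[OF h]) (auto simp: g_def)
  have [measurable]: "fourier b \<in> borel_measurable borel" using ib by auto
  have h_eq: "h = (\<lambda>x. b x + g x)" by (auto simp: b_def g_def)
  have gn: "ennreal (LINT x|lborel. norm (g x)) \<le> ennreal (l powr (1 - r) * a)"
  proof -
    have "ennreal (LINT x|lborel. norm (g x)) = (\<integral>\<^sup>+x. ennreal (norm (g x)) \<partial>lborel)"
      by (subst nn_integral_eq_integral) (auto intro: integrable_norm ig)
    also have "\<dots> \<le> (\<integral>\<^sup>+x. ennreal (l powr (1 - r)) * ennreal (norm (h x) powr r) \<partial>lborel)"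
    proof (rule nn_integral_mono)
      fix x
      have "norm (g x) \<le> l powr (1 - r) * norm (h x) powr r"
      proof (cases "norm (h x) \<le> l")
        case False
        then have "norm (h x) = norm (h x) powr (1 - r) * norm (h x) powr r"
          using l by (simp add: powr_add[symmetric])
        also have "\<dots> \<le> l powr (1 - r) * norm (h x) powr r"
          using False l r by (intro mult_right_mono powr_mono2') auto
        finally show ?thesis using False by (simp add: g_def)
      qed (simp add: g_def)
      then show "ennreal (norm (g x)) \<le> ennreal (l powr (1 - r)) * ennreal (norm (h x) powr r)"
        by (simp add: ennreal_mult[symmetric] ennreal_leI)
    qed
    also have "\<dots> = ennreal (l powr (1 - r) * a)" using a by (simp add: nn_integral_cmult ennreal_mult)
    finally show ?thesis .
  qed
  have Fg: "norm (fourier g \<xi>) \<le> t / 2" for \<xi>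
  proof -
    have "norm (fourier g \<xi>) \<le> fourier_const TYPE('n) * (LINT x|lborel. norm (g x))" by (rule norm_fourier_le[OF ig])
    also have "\<dots> \<le> fourier_const TYPE('n) * (l powr (1 - r) * a)"
      using gn a(2) fourier_const_pos[where 'n='n] by (intro mult_left_mono) (auto simp: ennreal_le_iff)
    finally show ?thesis using small by simp
  qed
  have "(\<integral>\<^sup>+\<xi>. indicator {\<xi>. t < norm (fourier h \<xi>)} \<xi> \<partial>lborel) \<le> (\<integral>\<^sup>+\<xi>. ennreal (4 / t\<^sup>2) * ennreal ((norm (fourier b \<xi>))\<^sup>2) \<partial>lborel)"
  proof (rule nn_integral_mono)
    fix \<xi>
    show "indicator {\<xi>. t < norm (fourier h \<xi>)} \<xi> \<le> ennreal (4 / t\<^sup>2) * ennreal ((norm (fourier b \<xi>))\<^sup>2)"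
    proof (cases "t < norm (fourier h \<xi>)")
      case True
      have "fourier h \<xi> = fourier b \<xi> + fourier g \<xi>" by (subst h_eq, rule fourier_add[OF ib ig])
      then have "norm (fourier h \<xi>) \<le> norm (fourier b \<xi>) + norm (fourier g \<xi>)" by (simp add: norm_triangle_ineq)
      then have "t / 2 \<le> norm (fourier b \<xi>)" using True Fg[of \<xi>] by linarith
      then have "(t / 2)\<^sup>2 \<le> (norm (fourier b \<xi>))\<^sup>2" using t by (intro power_mono) auto
      then have "1 \<le> 4 / t\<^sup>2 * (norm (fourier b \<xi>))\<^sup>2" using t by (simp add: field_simps)
      then have "ennreal 1 \<le> ennreal (4 / t\<^sup>2 * (norm (fourier b \<xi>))\<^sup>2)" by (intro ennreal_leI)
      then show ?thesis using True by (simp add: ennreal_mult[symmetric])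
    qed simp
  qed
  also have "\<dots> = ennreal (4 / t\<^sup>2) * (\<integral>\<^sup>+\<xi>. ennreal ((norm (fourier b \<xi>))\<^sup>2) \<partial>lborel)"
    by (rule nn_integral_cmult) measurable
  also have "\<dots> \<le> ennreal (4 / t\<^sup>2) * (\<integral>\<^sup>+x. ennreal ((norm (b x))\<^sup>2) \<partial>lborel)"
    by (intro mult_left_mono plancherel_le ib) simp
  also have "(\<integral>\<^sup>+x. ennreal ((norm (b x))\<^sup>2) \<partial>lborel) = (\<integral>\<^sup>+x. ennreal ((norm (h x))\<^sup>2) * indicator {x. norm (h x) \<le> l} x \<partial>lborel)"
    by (intro nn_integral_cong) (auto simp: b_def indicator_def)
  finally show ?thesis .
qed

text \<open>Marcinkiewicz interpolation between the bounds \<open>L\<^sub>1 \<rightarrow> L\<^sub>\<infinity>\<close> and \<open>L\<^sub>2 \<rightarrow> L\<^sub>2\<close>: at height \<open>t\<close> the function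
  is cut at the level \<open>(2ca/t)^(s-1)\<close>, for which the transform of the large part stays below \<open>t/2\<close>.\<close>

lemma hausdorff_young_integrable_less_2:
  fixes r s :: real
  assumes r: "1 < r" "r < 2" and rs: "1 / r + 1 / s = 1"
  obtains C where "C > 0" "\<And>h::real^'n::finite \<Rightarrow> complex. integrable lborel h \<Longrightarrow>
    (\<integral>\<^sup>+\<xi>. ennreal (norm (fourier h \<xi>) powr s) \<partial>lborel) \<le> ennreal C * epow (\<integral>\<^sup>+x. ennreal (norm (h x) powr r) \<partial>lborel) (s / r)"
proof -
  have s_eq: "s = r / (r - 1)" using rs r by (cases "s = 0") (auto simp: field_simps)
  have s2: "s > 2" unfolding s_eq using r by (simp add: field_simps)
  have s1: "(s - 1) * (r - 1) = 1" unfolding s_eq using r by (simp add: field_simps)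
  have s3: "(r - 1) * (s - 2) = 2 - r" unfolding s_eq using r by (simp add: field_simps)
  have s4: "s / r = s - 1" unfolding s_eq using r by (simp add: field_simps)
  let ?c = "fourier_const TYPE('n)"
  note c = fourier_const_pos[where 'n='n]
  \<comment> \<open>\<open>4 * s\<close> comes from the level set bound and the layer cake formula,
    the power of \<open>2 * ?c\<close> from the truncation height \<open>T\<close> below, and
    \<open>1 / (s - 2)\<close> from integrating \<open>t powr (s - 3)\<close> from 0. The last
    factor explodes as \<open>s\<close> tends to 2.\<close>
  define C where "C = 4 * s * (2 * ?c) powr (s - 2) / (s - 2)"
  have C: "C > 0" unfolding C_def using s2 c by simp
  have main: "(\<integral>\<^sup>+\<xi>. ennreal (norm (fourier h \<xi>) powr s) \<partial>lborel) \<le> ennreal C * epow (\<integral>\<^sup>+x. ennreal (norm (h x) powr r) \<partial>lborel) (s / r)"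
    if h: "integrable lborel h" for h :: "real^'n \<Rightarrow> complex"
  proof -
    have [measurable]: "h \<in> borel_measurable borel" "fourier h \<in> borel_measurable borel" using h by auto
    let ?A = "\<integral>\<^sup>+x. ennreal (norm (h x) powr r) \<partial>lborel"
    show ?thesis
    proof (cases "?A = 0 \<or> ?A = \<infinity>")
      case True
      then show ?thesis
      proof
        assume "?A = 0"
        then have "AE x in lborel. ennreal (norm (h x) powr r) = 0" by (subst (asm) nn_integral_0_iff_AE) auto
        then have "AE x in lborel. h x = 0" by eventually_elim (auto simp: ennreal_eq_0_iff powr_nonneg_iff)
        then have "(LINT x|lborel. cis (- (x \<bullet> \<xi>)) * h x) = (LINT x|(lborel::(real^'n) measure). 0)" for \<xi>
          by (intro integral_cong_AE) auto
        then show ?thesis by (simp add: fourier_eq)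
      next
        assume "?A = \<infinity>"
        then show ?thesis using C by (simp add: ennreal_mult_top)
      qed
    next
      case False
      then obtain a where a: "?A = ennreal a" "a > 0" by (cases ?A) (auto simp: order.order_iff_strict)
      define l where "l t = (2 * ?c * a / t) powr (s - 1)" for t
      have [measurable]: "l \<in> borel_measurable borel" unfolding l_def by measurable
      have lev: "(\<integral>\<^sup>+\<xi>. indicator {\<xi>. t < norm (fourier h \<xi>)} \<xi> \<partial>lborel) \<le>
          ennreal (4 / t\<^sup>2) * (\<integral>\<^sup>+x. ennreal ((norm (h x))\<^sup>2) * indicator {x. norm (h x) \<le> l t} x \<partial>lborel)" if t: "t > 0" for t
      proof (rule nn_integral_fourier_level_set[OF h r(1) t _ a(1)])
        show "0 < l t" using t a c by (simp add: l_def)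
        have "(s - 1) * (1 - r) = -1" using s1 by (simp add: algebra_simps)
        then have "l t powr (1 - r) = (2 * ?c * a / t) powr (-1)" unfolding l_def by (simp add: powr_powr)
        also have "\<dots> = t / (2 * ?c * a)" using t a c by (simp add: powr_minus)
        finally show "?c * (l t powr (1 - r) * a) \<le> t / 2" using t a c by simp
      qed (use a in auto)
      have "(\<integral>\<^sup>+\<xi>. ennreal (norm (fourier h \<xi>) powr s) \<partial>lborel) =
          (\<integral>\<^sup>+\<xi>. \<integral>\<^sup>+t. ennreal (s * t powr (s - 1)) * indicator {0<..<norm (fourier h \<xi>)} t \<partial>lborel \<partial>lborel)"
        using s2 by (intro nn_integral_cong nn_integral_powr_layer_cake) auto
      also have "\<dots> = (\<integral>\<^sup>+t. \<integral>\<^sup>+\<xi>. ennreal (s * t powr (s - 1)) * indicator {0<..<norm (fourier h \<xi>)} t \<partial>lborel \<partial>lborel)"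
        by (rule lborel_pair.Fubini'[symmetric]) (auto simp: indicator_def greaterThanLessThan_def)
      \<comment> \<open>The truncation condition is rewritten as a set of heights for fixed
        \<open>x\<close>, so that after the exchange of integrals the inner one can be evaluated in
        \<open>t\<close>.\<close>
      also have "\<dots> \<le> (\<integral>\<^sup>+t. \<integral>\<^sup>+x. ennreal (4 * s) * (ennreal ((norm (h x))\<^sup>2) * (ennreal (t powr (s - 3)) * indicator {t. 0 < t \<and> norm (h x) \<le> l t} t)) \<partial>lborel \<partial>lborel)"
      proof (rule nn_integral_mono)
        fix t :: real
        show "(\<integral>\<^sup>+\<xi>. ennreal (s * t powr (s - 1)) * indicator {0<..<norm (fourier h \<xi>)} t \<partial>lborel) \<le>
          (\<integral>\<^sup>+x. ennreal (4 * s) * (ennreal ((norm (h x))\<^sup>2) * (ennreal (t powr (s - 3)) * indicator {t. 0 < t \<and> norm (h x) \<le> l t} t)) \<partial>lborel)"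
        proof (cases "t > 0")
          case True
          have e: "s * t powr (s - 1) * (4 / t\<^sup>2) = 4 * s * t powr (s - 3)"
          proof -
            have "t powr (s - 1) = t powr (s - 3) * t powr 2" by (simp add: powr_add[symmetric])
            then show ?thesis using True by simp
          qed
          have "(\<integral>\<^sup>+\<xi>. ennreal (s * t powr (s - 1)) * indicator {0<..<norm (fourier h \<xi>)} t \<partial>lborel)
            = (\<integral>\<^sup>+\<xi>. ennreal (s * t powr (s - 1)) * indicator {\<xi>. t < norm (fourier h \<xi>)} \<xi> \<partial>lborel)"
            using True by (intro nn_integral_cong) (auto simp: indicator_def)
          also have "\<dots> = ennreal (s * t powr (s - 1)) * (\<integral>\<^sup>+\<xi>. indicator {\<xi>. t < norm (fourier h \<xi>)} \<xi> \<partial>lborel)"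
            by (rule nn_integral_cmult) measurable
          also have "\<dots> \<le> ennreal (s * t powr (s - 1)) * (ennreal (4 / t\<^sup>2) * (\<integral>\<^sup>+x. ennreal ((norm (h x))\<^sup>2) * indicator {x. norm (h x) \<le> l t} x \<partial>lborel))"
            by (intro mult_left_mono lev True) simp
          also have "\<dots> = ennreal (4 * s * t powr (s - 3)) * (\<integral>\<^sup>+x. ennreal ((norm (h x))\<^sup>2) * indicator {x. norm (h x) \<le> l t} x \<partial>lborel)"
            unfolding mult.assoc[symmetric] e[unfolded mult.assoc[symmetric], symmetric] using s2 True
            by (subst ennreal_mult[symmetric]) auto
          also have "\<dots> = (\<integral>\<^sup>+x. ennreal (4 * s * t powr (s - 3)) * (ennreal ((norm (h x))\<^sup>2) * indicator {x. norm (h x) \<le> l t} x) \<partial>lborel)"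
            by (rule nn_integral_cmult[symmetric]) measurable
          also have "\<dots> = (\<integral>\<^sup>+x. ennreal (4 * s) * (ennreal ((norm (h x))\<^sup>2) * (ennreal (t powr (s - 3)) * indicator {t. 0 < t \<and> norm (h x) \<le> l t} t)) \<partial>lborel)"
            using True s2 by (intro nn_integral_cong) (auto simp: indicator_def ennreal_mult mult_ac)
          finally show ?thesis .
        qed simp
      qed
      also have "\<dots> = (\<integral>\<^sup>+x. \<integral>\<^sup>+t. ennreal (4 * s) * (ennreal ((norm (h x))\<^sup>2) * (ennreal (t powr (s - 3)) * indicator {t. 0 < t \<and> norm (h x) \<le> l t} t)) \<partial>lborel \<partial>lborel)"
        by (rule lborel_pair.Fubini') (simp add: indicator_def)
      also have "\<dots> \<le> (\<integral>\<^sup>+x. ennreal (C * a powr (s - 2)) * ennreal (norm (h x) powr r) \<partial>lborel)"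
      proof (rule nn_integral_mono)
        fix x
        show "(\<integral>\<^sup>+t. ennreal (4 * s) * (ennreal ((norm (h x))\<^sup>2) * (ennreal (t powr (s - 3)) * indicator {t. 0 < t \<and> norm (h x) \<le> l t} t)) \<partial>lborel)
          \<le> ennreal (C * a powr (s - 2)) * ennreal (norm (h x) powr r)"
        proof (cases "h x = 0")
          case False
          then have hx: "norm (h x) > 0" by simp
          \<comment> \<open>\<open>T\<close> is the condition \<open>norm (h x) \<le> l t\<close>
            solved for \<open>t\<close>, using \<open>(s - 1) * (r - 1) = 1\<close>: beyond this
            height \<open>x\<close> no longer belongs to the bounded part.\<close>
          define T where "T = 2 * ?c * a * norm (h x) powr (1 - r)"
          have T: "T > 0" using hx a c by (simp add: T_def)
          have sub: "t \<le> T" if t: "0 < t" and le: "norm (h x) \<le> l t" for t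
          proof -
            have "norm (h x) powr (r - 1) \<le> l t powr (r - 1)" using hx r le by (intro powr_mono2) auto
            also have "\<dots> = 2 * ?c * a / t" unfolding l_def using t a c s1 by (simp add: powr_powr)
            finally have "t * norm (h x) powr (r - 1) \<le> 2 * ?c * a" using t by (simp add: field_simps)
            moreover have "T = 2 * ?c * a / norm (h x) powr (r - 1)"
              unfolding T_def divide_inverse using powr_minus[of "norm (h x)" "r - 1"] by simp
            ultimately show ?thesis using hx by (simp add: pos_le_divide_eq)
          qed
          have "(\<integral>\<^sup>+t. ennreal (4 * s) * (ennreal ((norm (h x))\<^sup>2) * (ennreal (t powr (s - 3)) * indicator {t. 0 < t \<and> norm (h x) \<le> l t} t)) \<partial>lborel)
            \<le> (\<integral>\<^sup>+t. ennreal (4 * s) * (ennreal ((norm (h x))\<^sup>2) * (ennreal (t powr (s - 3)) * indicator {0..T} t)) \<partial>lborel)"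
            by (intro nn_integral_mono mult_left_mono) (auto simp: indicator_def sub)
          also have "\<dots> = ennreal (4 * s) * (ennreal ((norm (h x))\<^sup>2) * ennreal (T powr (s - 2) / (s - 2)))"
            using nn_integral_powr_from_0[of "s - 3" T] s2 T by (simp add: nn_integral_cmult)
          also have "\<dots> = ennreal (4 * s * ((norm (h x))\<^sup>2 * (T powr (s - 2) / (s - 2))))"
            using s2 by (subst ennreal_mult[symmetric], simp, simp)+ simp
          also have "4 * s * ((norm (h x))\<^sup>2 * (T powr (s - 2) / (s - 2))) = C * a powr (s - 2) * norm (h x) powr r"
          proof -
            have "(1 - r) * (s - 2) = r - 2" using s3 by (simp add: algebra_simps)
            then have "T powr (s - 2) = (2 * ?c) powr (s - 2) * a powr (s - 2) * norm (h x) powr (r - 2)"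
              unfolding T_def using a c by (simp add: powr_mult powr_powr)
            moreover have "(norm (h x))\<^sup>2 * norm (h x) powr (r - 2) = norm (h x) powr r"
            proof -
              have "(norm (h x))\<^sup>2 = norm (h x) powr 2" using hx by simp
              then show ?thesis by (simp only: powr_add[symmetric]) simp
            qed
            ultimately show ?thesis unfolding C_def by (simp add: mult_ac)
          qed
          finally show ?thesis using C by (simp add: ennreal_mult)
        qed simp
      qed
      also have "\<dots> = ennreal (C * a powr (s - 2)) * ennreal a"
        using a by (simp add: nn_integral_cmult)
      also have "\<dots> = ennreal C * epow ?A (s / r)"
      proof -
        have "a powr (s - 2) * a = a powr (s - 1)" using a powr_add[of a "s - 2" 1] by simp
        then show ?thesis using a C by (simp add: epow_ennreal s4 ennreal_mult[symmetric] mult.assoc)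
      qed
      finally show ?thesis .
    qed
  qed
  show ?thesis by (rule that[OF C main])
qed


text \<open>At \<open>r = 2\<close> the interpolation constant degenerates, and the Plancherel
  inequality gives the bound with constant 1.\<close>

lemma hausdorff_young_integrable:
  fixes r s :: real
  assumes r: "1 < r" "r \<le> 2" and rs: "1 / r + 1 / s = 1"
  obtains C where "C > 0" "\<And>h::real^'n::finite \<Rightarrow> complex. integrable lborel h \<Longrightarrow>
    (\<integral>\<^sup>+\<xi>. ennreal (norm (fourier h \<xi>) powr s) \<partial>lborel) \<le> ennreal C * epow (\<integral>\<^sup>+x. ennreal (norm (h x) powr r) \<partial>lborel) (s / r)"
proof (cases "r = 2")
  case True
  then have s: "s = 2" using rs by (cases "s = 0") (auto simp: field_simps)
  have "norm z powr 2 = (norm z)\<^sup>2" for z :: complex by (cases "z = 0") auto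
  then show ?thesis using that[of 1] plancherel_le[where 'n='n] True s by auto
next
  case False
  then have "r < 2" using r(2) by simp
  show ?thesis by (rule hausdorff_young_integrable_less_2[OF r(1) \<open>r < 2\<close> rs, where 'n='n]) (rule that)
qed

text \<open>Asking for \<open>m \<ge> k\<close> makes any choice of radii \<open>m k\<close> tend to
  infinity, so the cut-off balls exhaust the space although the radii need not be monotone.\<close>

lemma nn_integral_tail_small:
  fixes f :: "'a::euclidean_space \<Rightarrow> ennreal"
  assumes [measurable]: "f \<in> borel_measurable borel" and fin: "(\<integral>\<^sup>+x. f x \<partial>lborel) < \<infinity>" and d: "d > 0"
  shows "\<exists>m\<ge>k. (\<integral>\<^sup>+x. f x * indicator {x. real m \<le> norm x} x \<partial>lborel) \<le> d"
proof -
  have "(\<lambda>m. \<integral>\<^sup>+x. f x * indicator {x. real m \<le> norm x} x \<partial>lborel) \<longlonglongrightarrow> (\<integral>\<^sup>+x. 0 \<partial>(lborel :: 'a measure))"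
  proof (rule nn_integral_dominated_convergence[where w=f])
    show "AE x in lborel. (\<lambda>m. f x * indicator {x. real m \<le> norm x} x) \<longlonglongrightarrow> 0"
    proof (intro AE_I2 tendsto_eventually)
      fix x :: 'a
      obtain N where "norm x < real N" using reals_Archimedean2 by blast
      then show "\<forall>\<^sub>F m in sequentially. f x * indicator {x. real m \<le> norm x} x = 0"
        by (intro eventually_sequentiallyI[of N]) (auto simp: indicator_def)
    qed
  qed (use fin in \<open>auto simp: indicator_def\<close>)
  then have "\<forall>\<^sub>F m in sequentially. (\<integral>\<^sup>+x. f x * indicator {x. real m \<le> norm x} x \<partial>lborel) < d"
    using d by (intro order_tendstoD(2)[where a=d]) auto
  then obtain N where "\<And>m. m \<ge> N \<Longrightarrow> (\<integral>\<^sup>+x. f x * indicator {x. real m \<le> norm x} x \<partial>lborel) < d"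
    by (auto simp: eventually_sequentially)
  then show ?thesis by (intro exI[of _ "max k N"]) (auto intro: less_imp_le)
qed

lemma convergent_if_geometric_increments:
  fixes G :: "nat \<Rightarrow> complex"
  assumes "\<And>k. norm (G (Suc k) - G k) \<le> B * (1 / 2) ^ k"
  shows "convergent G"
proof -
  have "summable (\<lambda>k. G (Suc k) - G k)"
    by (rule summable_comparison_test[of _ "\<lambda>k. B * (1 / 2) ^ k"])
      (use assms in \<open>auto intro!: summable_mult summable_geometric\<close>)
  then show ?thesis by (simp add: summable_iff_convergent sum_lessThan_telescope convergent_diff_const_right_iff)
qed

text \<open>For general \<open>f\<close> in \<open>L\<^sub>r\<close> the transform is the limit of the transforms of \<open>f\<close> cut off to balls. The radii
  are chosen so that the increments decay geometrically, which yields convergence almost everywhere.\<close>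

theorem hausdorff_young:
  fixes r s :: real
  assumes r: "1 < r" "r \<le> 2" and rs: "1 / r + 1 / s = 1"
  obtains C where "C > 0" "\<And>f :: real^'n::finite \<Rightarrow> complex. f \<in> borel_measurable borel \<Longrightarrow> Lp_fun_norm (ennreal r) f < \<infinity> \<Longrightarrow>
    \<exists>g. represents g (\<lambda>\<psi>. LINT x|lborel. f x * fourier \<psi> x) \<and> Lp_fun_norm (ennreal s) g \<le> ennreal C * Lp_fun_norm (ennreal r) f"
proof -
  obtain C where C: "C > 0" and HY: "\<And>h::real^'n \<Rightarrow> complex. integrable lborel h \<Longrightarrow>
    (\<integral>\<^sup>+\<xi>. ennreal (norm (fourier h \<xi>) powr s) \<partial>lborel) \<le> ennreal C * epow (\<integral>\<^sup>+x. ennreal (norm (h x) powr r) \<partial>lborel) (s / r)"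
    using hausdorff_young_integrable[OF r rs, where 'n='n] by blast
  have s: "s > 1"
  proof -
    have "1 / s = 1 - 1 / r" using rs by simp
    moreover have "0 < 1 - 1 / r" "1 - 1 / r < 1" using r by auto
    ultimately have "0 < 1 / s" "1 / s < 1" by auto
    then show ?thesis by (simp add: field_simps zero_less_divide_iff split: if_splits)
  qed
  have pe: "ennreal r \<ge> 1" "ennreal s \<ge> 1" "inv_exp (ennreal r) + inv_exp (ennreal s) = 1"
    using r s rs by (auto simp: inv_exp_ennreal)
  have main: "\<exists>g. represents g (\<lambda>\<psi>. LINT x|lborel. f x * fourier \<psi> x) \<and> Lp_fun_norm (ennreal s) g \<le> ennreal (C powr (1/s)) * Lp_fun_norm (ennreal r) f"
    if fm[measurable]: "f \<in> borel_measurable borel" and fin: "Lp_fun_norm (ennreal r) f < \<infinity>" for f :: "real^'n \<Rightarrow> complex"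
  proof -
    let ?P = "\<lambda>h::real^'n \<Rightarrow> complex. \<integral>\<^sup>+x. ennreal (norm (h x) powr r) \<partial>lborel"
    let ?Q = "\<lambda>h::real^'n \<Rightarrow> complex. \<integral>\<^sup>+x. ennreal (norm (h x) powr s) \<partial>lborel"
    have finP: "?P f < \<infinity>" using fin r by (simp add: Lp_fun_norm_real)
    \<comment> \<open>Chosen so that \<open>C * \<delta> k powr (s / r)\<close> equals
      \<open>4^(-k s)\<close>: the increments of the transforms then have \<open>L_s\<close> norm at
      most \<open>4^(-k)\<close>.\<close>
    define \<delta> where "\<delta> k = ((1/4) powr (real k * s) / C) powr (r / s)" for k :: nat
    have \<delta>0: "\<delta> k > 0" for k using C by (simp add: \<delta>_def)
    have \<delta>C: "C * \<delta> k powr (s / r) = (1/4) powr (real k * s)" for k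
      using C r s by (simp add: \<delta>_def powr_powr)
    have \<delta>mono: "\<delta> j \<le> \<delta> k" if "k \<le> j" for j k
      unfolding \<delta>_def using that r s C
      by (intro powr_mono2 divide_right_mono powr_mono') (auto intro!: mult_right_mono)
    have "\<exists>m\<ge>k. (\<integral>\<^sup>+x. ennreal (norm (f x) powr r) * indicator {x. real m \<le> norm x} x \<partial>lborel) \<le> ennreal (\<delta> k)" for k
      using \<delta>0[of k] finP by (intro nn_integral_tail_small) auto
    then obtain m where m: "\<And>k. m k \<ge> k"
      "\<And>k. (\<integral>\<^sup>+x. ennreal (norm (f x) powr r) * indicator {x. real (m k) \<le> norm x} x \<partial>lborel) \<le> ennreal (\<delta> k)"
      by metis
    define F where "F k x = f x * indicator {x. norm x < real (m k)} x" for k x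
    have [measurable]: "F k \<in> borel_measurable borel" for k unfolding F_def by measurable
    have iF: "integrable lborel (F k)" for k
      unfolding F_def
    proof (rule Lp_Hoelder_integrable[OF pe])
      have "{x::real^'n. norm x < real (m k)} = ball 0 (real (m k))" by (auto simp: dist_norm)
      then have "integrable lborel (indicator {x. norm x < real (m k)} :: real^'n \<Rightarrow> complex)"
        using emeasure_lborel_ball_finite[of "0::real^'n" "real (m k)"] by (intro integrable_complex_indicator) auto
      then show "Lp_fun_norm (ennreal s) (indicator {x. norm x < real (m k)} :: real^'n \<Rightarrow> complex) < \<infinity>"
        by (rule Lp_fun_norm_bounded_integrable[OF pe(2), of _ 1]) (auto simp: indicator_def)
    qed (use fin in auto)
    have Pdiff: "?P (\<lambda>x. F j x - F k x) \<le> ennreal (\<delta> k)" if "k \<le> j" for j k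
    proof -
      \<comment> \<open>The radii are not ordered like their indices. The difference of two cut-offs
        lives outside the smaller ball, and \<open>l\<close> is the index belonging to it.\<close>
      define l where "l = (if m k \<le> m j then k else j)"
      have l: "real (m l) = min (real (m k)) (real (m j))" "\<delta> l \<le> \<delta> k"
        using \<delta>mono[OF that] by (auto simp: l_def)
      have "?P (\<lambda>x. F j x - F k x) \<le> (\<integral>\<^sup>+x. ennreal (norm (f x) powr r) * indicator {x. real (m l) \<le> norm x} x \<partial>lborel)"
        by (intro nn_integral_mono) (auto simp: F_def indicator_def l)
      also have "\<dots> \<le> ennreal (\<delta> l)" by (rule m)
      also have "\<dots> \<le> ennreal (\<delta> k)" using l by (intro ennreal_leI)
      finally show ?thesis .
    qed
    define G where "G k = fourier (F k)" for k
    have [measurable]: "G k \<in> borel_measurable borel" for k unfolding G_def using iF by auto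
    have Qdiff: "?Q (\<lambda>x. G j x - G k x) \<le> ennreal ((1/4) powr (real k * s))" if "k \<le> j" for j k
    proof -
      have "?Q (\<lambda>x. G j x - G k x) = ?Q (fourier (\<lambda>x. F j x - F k x))"
        by (simp add: G_def fourier_diff iF)
      also have "\<dots> \<le> ennreal C * epow (?P (\<lambda>x. F j x - F k x)) (s / r)"
        by (intro HY Bochner_Integration.integrable_diff iF)
      also have "\<dots> \<le> ennreal C * epow (ennreal (\<delta> k)) (s / r)"
        using r s by (intro mult_left_mono epow_mono Pdiff that) auto
      also have "\<dots> = ennreal ((1/4) powr (real k * s))"
        using \<delta>0[of k] C by (simp add: epow_ennreal less_imp_le ennreal_mult[symmetric] \<delta>C)
      finally show ?thesis .
    qed
    have conv: "AE x in lborel. convergent (\<lambda>k. G k x)"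
    proof -
      \<comment> \<open>The weight \<open>2^(k s)\<close> uses up only part of the decay
        \<open>4^(-k s)\<close>: the integral of the series is still finite, while finiteness at a
        point bounds the increments there by a multiple of \<open>2^(-k)\<close>.\<close>
      let ?S = "\<lambda>x. \<Sum>k. ennreal (2 powr (real k * s)) * ennreal (norm (G (Suc k) x - G k x) powr s)"
      have "(\<integral>\<^sup>+x. ?S x \<partial>lborel) = (\<Sum>k. ennreal (2 powr (real k * s)) * ?Q (\<lambda>x. G (Suc k) x - G k x))"
        by (simp add: nn_integral_suminf nn_integral_cmult)
      also have "\<dots> \<le> (\<Sum>k. ennreal (((1/2) powr s) ^ k))"
      proof (intro suminf_le)
        fix k
        have "ennreal (2 powr (real k * s)) * ?Q (\<lambda>x. G (Suc k) x - G k x) \<le> ennreal (2 powr (real k * s)) * ennreal ((1/4) powr (real k * s))"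
          by (intro mult_left_mono Qdiff) auto
        also have "\<dots> = ennreal (((1/2) powr s) ^ k)"
        proof -
          have "2 powr (real k * s) * (1/4) powr (real k * s) = (1/2::real) powr (real k * s)"
            by (simp add: powr_mult[symmetric])
          also have "\<dots> = ((1/2) powr s) ^ k" by (simp add: powr_powr powr_realpow[symmetric] mult.commute)
          finally show ?thesis by (simp add: ennreal_mult[symmetric])
        qed
        finally show "ennreal (2 powr (real k * s)) * ?Q (\<lambda>x. G (Suc k) x - G k x) \<le> ennreal (((1/2) powr s) ^ k)" .
      qed auto
      also have "\<dots> < \<infinity>"
      proof -
        have "(1/2::real) powr s < 1 powr s" using s by (intro powr_less_mono2) auto
        then have "summable (\<lambda>k. ((1/2::real) powr s) ^ k)" by (intro summable_geometric) auto
        then show ?thesis by (subst suminf_ennreal2) auto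
      qed
      finally have "(\<integral>\<^sup>+x. ?S x \<partial>lborel) < \<infinity>" .
      then have "AE x in lborel. ?S x \<noteq> \<infinity>" by (intro nn_integral_PInf_AE) auto
      then show ?thesis
      proof eventually_elim
        fix x assume "?S x \<noteq> \<infinity>"
        then obtain b where b: "?S x = ennreal b" "b \<ge> 0" by (cases "?S x") auto
        show "convergent (\<lambda>k. G k x)"
        proof (rule convergent_if_geometric_increments)
          fix k
          have "ennreal (2 powr (real k * s)) * ennreal (norm (G (Suc k) x - G k x) powr s) \<le> ?S x"
            using sum_le_suminf[of "\<lambda>k. ennreal (2 powr (real k * s)) * ennreal (norm (G (Suc k) x - G k x) powr s)" "{k}"] by simp
          then have "2 powr (real k * s) * norm (G (Suc k) x - G k x) powr s \<le> b"
            using b by (simp add: ennreal_mult[symmetric] ennreal_le_iff)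
          then have "(2 powr real k * norm (G (Suc k) x - G k x)) powr s \<le> b"
            by (simp add: powr_mult powr_powr)
          then have "((2 powr real k * norm (G (Suc k) x - G k x)) powr s) powr (1/s) \<le> b powr (1/s)"
            using s by (intro powr_mono2) auto
          then have "2 ^ k * norm (G (Suc k) x - G k x) \<le> b powr (1/s)"
            using s by (simp add: powr_powr powr_realpow)
          then show "norm (G (Suc k) x - G k x) \<le> b powr (1/s) * (1/2) ^ k"
            by (simp add: field_simps power_divide)
        qed
      qed
    qed
    \<comment> \<open>Where the sequence diverges the value of \<open>lim\<close> is arbitrary; this
      concerns a null set only.\<close>
    define g where "g x = lim (\<lambda>k. G k x)" for x
    have gm[measurable]: "g \<in> borel_measurable borel" unfolding g_def by (rule borel_measurable_lim_metric) simp
    have Glim: "AE x in lborel. (\<lambda>k. G k x) \<longlonglongrightarrow> g x"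
      using conv by eventually_elim (simp add: g_def convergent_LIMSEQ_iff)
    \<comment> \<open>Used twice: with \<open>H = 0\<close> it gives the norm bound for
      \<open>g\<close>, and with \<open>H = G k\<close> it gives convergence of \<open>G k\<close>
      to \<open>g\<close> in \<open>L_s\<close>.\<close>
    have fatou: "?Q (\<lambda>x. g x - H x) \<le> B" if [measurable]: "H \<in> borel_measurable borel"
      and B: "\<And>j. j \<ge> N \<Longrightarrow> ?Q (\<lambda>x. G j x - H x) \<le> B" for H B N
    proof -
      have "?Q (\<lambda>x. g x - H x) = (\<integral>\<^sup>+x. liminf (\<lambda>j. ennreal (norm (G j x - H x) powr s)) \<partial>lborel)"
      proof (rule nn_integral_cong_AE)
        show "AE x in lborel. ennreal (norm (g x - H x) powr s) = liminf (\<lambda>j. ennreal (norm (G j x - H x) powr s))"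
          using Glim
        proof eventually_elim
          fix x assume l: "(\<lambda>k. G k x) \<longlonglongrightarrow> g x"
          have "(\<lambda>j. norm (G j x - H x) powr s) \<longlonglongrightarrow> norm (g x - H x) powr s"
            using s by (intro tendsto_powr' tendsto_norm tendsto_diff l tendsto_const) auto
          then have "(\<lambda>j. ennreal (norm (G j x - H x) powr s)) \<longlonglongrightarrow> ennreal (norm (g x - H x) powr s)"
            by (rule tendsto_ennrealI)
          then show "ennreal (norm (g x - H x) powr s) = liminf (\<lambda>j. ennreal (norm (G j x - H x) powr s))"
            by (rule lim_imp_Liminf[OF sequentially_bot, symmetric])
        qed
      qed
      also have "\<dots> \<le> liminf (\<lambda>j. ?Q (\<lambda>x. G j x - H x))" by (rule nn_integral_liminf) measurable
      also have "\<dots> \<le> B"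
        by (intro Liminf_le) (auto intro!: eventually_sequentiallyI[of N] B)
      finally show ?thesis .
    qed
    have Qg: "?Q g \<le> ennreal C * epow (?P f) (s / r)"
    proof -
      have "?Q (\<lambda>x. G j x - 0) \<le> ennreal C * epow (?P f) (s / r)" for j
      proof -
        have "?Q (G j) \<le> ennreal C * epow (?P (F j)) (s / r)" unfolding G_def by (intro HY iF)
        also have "\<dots> \<le> ennreal C * epow (?P f) (s / r)"
          using r s by (intro mult_left_mono epow_mono nn_integral_mono) (auto simp: F_def indicator_def)
        finally show ?thesis by simp
      qed
      from fatou[of "\<lambda>_. 0" 0, OF _ this] show ?thesis by simp
    qed
    have norm_g: "Lp_fun_norm (ennreal s) g \<le> ennreal (C powr (1/s)) * Lp_fun_norm (ennreal r) f"
    proof -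
      have "epow (?Q g) (1/s) \<le> epow (ennreal C * epow (?P f) (s / r)) (1/s)" using s by (intro epow_mono Qg) auto
      also have "\<dots> = ennreal (C powr (1/s)) * epow (?P f) (1 / r)"
        using C s by (simp add: epow_mult epow_epow epow_ennreal less_imp_le)
      finally show ?thesis using r s by (simp add: Lp_fun_norm_real)
    qed
    have fing: "Lp_fun_norm (ennreal s) g < \<infinity>"
      using le_less_trans[OF norm_g] fin by (simp add: ennreal_mult_less_top)
    have "represents g (\<lambda>\<psi>. LINT x|lborel. f x * fourier \<psi> x)"
      unfolding represents_def
    proof (intro conjI ballI)
      fix \<psi> :: "real^'n \<Rightarrow> complex" assume \<psi>: "\<psi> \<in> schwartz"
      note [measurable] = schwartz_measurable[OF \<psi>] schwartz_measurable[OF schwartz_fourier[OF \<psi>]]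
      show int: "integrable lborel (\<lambda>x. g x * \<psi> x)"
        by (rule Lp_Hoelder_integrable[of "ennreal s" "ennreal r"]) (use pe fing Lp_fun_norm_schwartz[OF pe(1) \<psi>] in \<open>auto simp: add.commute\<close>)
      have intf: "integrable lborel (\<lambda>x. f x * fourier \<psi> x)"
        by (rule Lp_Hoelder_integrable[OF pe]) (use fin Lp_fun_norm_schwartz[OF pe(2) schwartz_fourier[OF \<psi>]] in auto)
      have intG: "integrable lborel (\<lambda>x. G k x * \<psi> x)" for k
      proof -
        have "Lp_fun_norm \<infinity> (G k) \<le> ennreal (fourier_const TYPE('n) * (LINT x|lborel. norm (F k x)))"
          unfolding G_def by (intro Lp_fun_norm_top_le AE_I2 ennreal_leI norm_fourier_le iF)
        then have "Lp_fun_norm \<infinity> (G k) < \<infinity>" using ennreal_less_top le_less_trans by (metis infinity_ennreal_def)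
        then show ?thesis
          by (intro Lp_Hoelder_integrable[of \<infinity> 1]) (use Lp_fun_norm_schwartz[OF _ \<psi>, of 1] in \<open>auto simp: inv_exp_def\<close>)
      qed
      \<comment> \<open>Both sides of the multiplication formula for \<open>F k\<close> pass to the
        limit: this side by dominated convergence, the side with \<open>G k\<close> by convergence
        in \<open>L_s\<close> and Hoelder's inequality.\<close>
      have "(\<lambda>k. LINT x|lborel. F k x * fourier \<psi> x) \<longlonglongrightarrow> (LINT x|lborel. f x * fourier \<psi> x)"
      proof (rule integral_dominated_convergence[where w = "\<lambda>x. norm (f x * fourier \<psi> x)"])
        show "AE x in lborel. (\<lambda>k. F k x * fourier \<psi> x) \<longlonglongrightarrow> f x * fourier \<psi> x"
        proof (intro AE_I2 tendsto_eventually)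
          fix x :: "real^'n"
          obtain N where N: "norm x < real N" using reals_Archimedean2 by blast
          have "norm x < real (m k)" if "k \<ge> N" for k
            using N m(1)[of k] that by linarith
          then show "\<forall>\<^sub>F k in sequentially. F k x * fourier \<psi> x = f x * fourier \<psi> x"
            by (intro eventually_sequentiallyI[of N]) (auto simp: F_def)
        qed
        show "AE x in lborel. norm (F k x * fourier \<psi> x) \<le> norm (f x * fourier \<psi> x)" for k
          by (intro AE_I2) (auto simp: F_def indicator_def)
      qed (use intf in auto)
      moreover have "(LINT x|lborel. F k x * fourier \<psi> x) = (LINT x|lborel. G k x * \<psi> x)" for k
        unfolding G_def by (rule fourier_multiplication_formula[OF iF schwartz_integrable[OF \<psi>], symmetric])
      ultimately have lim1: "(\<lambda>k. LINT x|lborel. G k x * \<psi> x) \<longlonglongrightarrow> (LINT x|lborel. f x * fourier \<psi> x)" by simp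
      obtain b where b: "Lp_fun_norm (ennreal r) \<psi> = ennreal b" "b \<ge> 0"
        using Lp_fun_norm_schwartz[OF pe(1) \<psi>] by (cases "Lp_fun_norm (ennreal r) \<psi>") auto
      have bd: "norm ((LINT x|lborel. G k x * \<psi> x) - (LINT x|lborel. g x * \<psi> x)) \<le> (1/4) ^ k * b" for k
      proof -
        have "ennreal (norm ((LINT x|lborel. g x * \<psi> x) - (LINT x|lborel. G k x * \<psi> x))) = ennreal (norm (LINT x|lborel. (g x - G k x) * \<psi> x))"
          by (simp add: left_diff_distrib int intG)
        also have "\<dots> \<le> (\<integral>\<^sup>+x. ennreal (norm ((g x - G k x) * \<psi> x)) \<partial>lborel)"
          by (rule integral_norm_bound_ennreal) (simp add: left_diff_distrib int intG)
        also have "\<dots> \<le> Lp_fun_norm (ennreal s) (\<lambda>x. g x - G k x) * Lp_fun_norm (ennreal r) \<psi>"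
          unfolding norm_mult by (rule Lp_fun_norm_Hoelder) (use pe in \<open>auto simp: add.commute\<close>)
        also have "Lp_fun_norm (ennreal s) (\<lambda>x. g x - G k x) \<le> ennreal ((1/4) ^ k)"
        proof -
          have "?Q (\<lambda>x. g x - G k x) \<le> ennreal ((1/4) powr (real k * s))" by (rule fatou[of _ k]) (auto intro: Qdiff)
          then have "epow (?Q (\<lambda>x. g x - G k x)) (1/s) \<le> epow (ennreal ((1/4) powr (real k * s))) (1/s)"
            using s by (intro epow_mono) auto
          also have "\<dots> = ennreal ((1/4) ^ k)" using s by (simp add: epow_ennreal powr_powr powr_realpow)
          finally show ?thesis using s by (simp add: Lp_fun_norm_real)
        qed
        finally have "ennreal (norm ((LINT x|lborel. g x * \<psi> x) - (LINT x|lborel. G k x * \<psi> x))) \<le> ennreal ((1/4) ^ k * b)"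
          using b by (simp add: mult_right_mono ennreal_mult)
        then show ?thesis using b by (simp add: ennreal_le_iff norm_minus_commute)
      qed
      have "(\<lambda>k. (LINT x|lborel. G k x * \<psi> x) - (LINT x|lborel. g x * \<psi> x)) \<longlonglongrightarrow> 0"
      proof (rule tendsto_norm_zero_cancel, rule tendsto_sandwich[OF _ _ tendsto_const])
        show "(\<lambda>k. (1/4) ^ k * b) \<longlonglongrightarrow> 0" by (intro tendsto_mult_left_zero LIMSEQ_realpow_zero) auto
      qed (use bd in auto)
      then have "(\<lambda>k. LINT x|lborel. G k x * \<psi> x) \<longlonglongrightarrow> (LINT x|lborel. g x * \<psi> x)" by (rule LIM_zero_cancel)
      then show "(LINT x|lborel. f x * fourier \<psi> x) = (LINT x|lborel. g x * \<psi> x)"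
        using lim1 LIMSEQ_unique by blast
    qed simp
    with norm_g show ?thesis by blast
  qed
  show ?thesis by (rule that[OF _ main]) (use C in auto)
qed

section \<open>Littlewood--Paley pieces of Fourier transforms\<close>

lemma Lp_fun_norm_of_real_weight:
  assumes "p \<ge> 1"
  shows "Lp_fun_norm p (\<lambda>x::real^'n::finite. complex_of_real (schwartz_weight x)) < \<infinity>"
proof (rule Lp_fun_norm_bounded_integrable[OF assms])
  show "integrable lborel (\<lambda>x::real^'n. complex_of_real (schwartz_weight x))"
    using schwartz_weight_integrable by (simp only: complex_of_real_integrable_eq)
  show "norm (complex_of_real (schwartz_weight (x::real^'n))) \<le> 1" for x
  proof -
    have "schwartz_weight x \<le> 1" unfolding schwartz_weight_def
      by (intro inverse_le_1_iff[THEN iffD2] disjI2 one_le_power) simp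
    then show ?thesis using schwartz_weight_pos[of x] by simp
  qed
qed

text \<open>Linearity is inherited from \<open>u\<close>. Continuity comes from the representative:
  \<open>fourier_decr\<close> bounds \<open>fourier \<psi>\<close> by a seminorm of \<psi> times the
  weight, and the weight has a finite \<open>L_p'\<close> norm to set against \<open>f\<close> in
  Hoelder's inequality.\<close>

lemma fourier_dist_tempered:
  fixes f :: "real^'n::finite \<Rightarrow> complex"
  assumes p: "p \<ge> 1" "p' \<ge> 1" "inv_exp p + inv_exp p' = 1"
    and u: "u \<in> tempered" and f: "represents f u" "Lp_fun_norm p f < \<infinity>"
  shows "fourier_dist u \<in> tempered"
proof -
  have lin: "u (\<lambda>x. \<phi> x + \<psi> x) = u \<phi> + u \<psi>" if "\<phi> \<in> schwartz" "\<psi> \<in> schwartz" for \<phi> \<psi>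
    using u that by (auto simp: tempered_def)
  have scal: "u (\<lambda>x. c * \<phi> x) = c * u \<phi>" if "\<phi> \<in> schwartz" for \<phi> c
    using u that by (auto simp: tempered_def)
  have [measurable]: "f \<in> borel_measurable borel" using representsD[OF f(1)] by simp
  obtain C where C: "C \<ge> 0" "\<And>\<psi> (\<xi>::real^'n). \<psi> \<in> schwartz \<Longrightarrow>
      (1 + norm \<xi>) ^ (2 * CARD('n)) * norm (fourier \<psi> \<xi>) \<le> C * schwartz_seminorm (2 * CARD('n)) (2 * CARD('n)) \<psi>"
    using fourier_decr[where 'n='n and k="2 * CARD('n)"] by blast
  let ?w = "\<lambda>x::real^'n. complex_of_real (schwartz_weight x)"
  let ?S = "schwartz_seminorm (2 * CARD('n)) (2 * CARD('n))"
  obtain W where W: "Lp_fun_norm p' ?w = ennreal W" "W \<ge> 0"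
    using Lp_fun_norm_of_real_weight[OF p(2), where 'n='n] by (cases "Lp_fun_norm p' ?w") auto
  obtain a where a: "Lp_fun_norm p f = ennreal a" "a \<ge> 0" using f(2) by (cases "Lp_fun_norm p f") auto
  have "norm (u (fourier \<psi>)) \<le> (a * C * W) * ?S \<psi>" if \<psi>: "\<psi> \<in> schwartz" for \<psi>
  proof -
    note F\<psi> = schwartz_fourier[OF \<psi>]
    note [measurable] = schwartz_measurable[OF F\<psi>]
    have S0: "?S \<psi> \<ge> 0" by (rule schwartz_seminorm_nonneg[OF \<psi>])
    have le: "norm (fourier \<psi> \<xi>) \<le> norm (of_real (C * ?S \<psi>) * ?w \<xi>)" for \<xi>
    proof -
      have "norm (fourier \<psi> \<xi>) \<le> (C * ?S \<psi>) * schwartz_weight \<xi>"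
        using C(2)[OF \<psi>, of \<xi>] by (simp only: le_schwartz_weight_iff)
      then show ?thesis using C(1) S0 less_imp_le[OF schwartz_weight_pos[of \<xi>]] by (simp add: norm_mult abs_mult)
    qed
    have "Lp_fun_norm p' (fourier \<psi>) \<le> Lp_fun_norm p' (\<lambda>\<xi>. of_real (C * ?S \<psi>) * ?w \<xi>)"
      by (rule Lp_fun_norm_mono[OF p(2)]) (use le in auto)
    also have "\<dots> \<le> ennreal (norm (complex_of_real (C * ?S \<psi>))) * Lp_fun_norm p' ?w"
      by (rule Lp_fun_norm_cmult_le[OF p(2)]) measurable
    also have "\<dots> = ennreal (C * ?S \<psi> * W)" using W C(1) S0 by (simp add: norm_mult ennreal_mult')
    finally have b: "Lp_fun_norm p' (fourier \<psi>) \<le> ennreal (C * ?S \<psi> * W)" .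
    have "ennreal (norm (u (fourier \<psi>))) = ennreal (norm (LINT x|lborel. f x * fourier \<psi> x))"
      using representsD(3)[OF f(1) F\<psi>] by simp
    also have "\<dots> \<le> (\<integral>\<^sup>+x. ennreal (norm (f x * fourier \<psi> x)) \<partial>lborel)"
      by (rule integral_norm_bound_ennreal[OF representsD(2)[OF f(1) F\<psi>]])
    also have "\<dots> \<le> Lp_fun_norm p f * Lp_fun_norm p' (fourier \<psi>)"
      unfolding norm_mult by (rule Lp_fun_norm_Hoelder[OF p]) measurable
    also have "\<dots> \<le> ennreal a * ennreal (C * ?S \<psi> * W)" unfolding a by (intro mult_left_mono b) simp
    also have "\<dots> = ennreal ((a * C * W) * ?S \<psi>)" using a W C(1) S0 by (simp add: ennreal_mult[symmetric] mult_ac)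
    finally show ?thesis using a W C(1) S0 by (simp add: ennreal_le_iff)
  qed
  then have bound: "\<exists>C k m. \<forall>\<psi>\<in>schwartz. norm (fourier_dist u \<psi>) \<le> C * schwartz_seminorm k m \<psi>"
    unfolding fourier_dist_def by blast
  have add: "fourier_dist u (\<lambda>x. \<phi> x + \<psi> x) = fourier_dist u \<phi> + fourier_dist u \<psi>" if "\<phi> \<in> schwartz" "\<psi> \<in> schwartz" for \<phi> \<psi>
  proof -
    have "fourier (\<lambda>x. \<phi> x + \<psi> x) = (\<lambda>\<xi>. fourier \<phi> \<xi> + fourier \<psi> \<xi>)"
      using that by (intro ext fourier_add schwartz_integrable)
    then show ?thesis unfolding fourier_dist_def using that by (simp add: lin schwartz_fourier)
  qed
  have smul: "fourier_dist u (\<lambda>x. c * \<phi> x) = c * fourier_dist u \<phi>" if "\<phi> \<in> schwartz" for \<phi> c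
    unfolding fourier_dist_def fourier_cmult using that by (simp add: scal schwartz_fourier)
  show ?thesis unfolding tempered_def using add smul bound by blast
qed

lemma maps_boundedly_fourier_distI:
  fixes B :: "((real^'n::finite \<Rightarrow> complex) \<Rightarrow> complex) set"
  assumes p: "p \<ge> 1" "p' \<ge> 1" "inv_exp p + inv_exp p' = 1"
    and B: "B = {u. u \<in> tempered \<and> N u < \<infinity>}"
    and bd: "\<And>u. N (fourier_dist u) \<le> ennreal C * Lp_norm p u"
  shows "maps_boundedly (Lp_space p) (Lp_norm p) B N fourier_dist"
proof -
  have "fourier_dist u \<in> B" if "u \<in> Lp_space p" for u
  proof -
    have u: "u \<in> tempered" "Lp_norm p u < \<infinity>" using that by (auto simp: Lp_space_def)
    then obtain f where "represents f u" "Lp_fun_norm p f < \<infinity>" using Lp_norm_lessD by blast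
    then have "fourier_dist u \<in> tempered" by (rule fourier_dist_tempered[OF p u(1)])
    moreover have "N (fourier_dist u) < \<infinity>"
      using le_less_trans[OF bd[of u]] u(2) by (simp add: ennreal_mult_less_top)
    ultimately show ?thesis by (simp add: B)
  qed
  then show ?thesis unfolding maps_boundedly_def using bd by blast
qed

lemma besov_norm_top_leI:
  assumes "C > 0" and le: "\<And>j. Lp_norm p (lp_piece \<phi>0 j u) \<le> ennreal (C * 2 powr (- (real j * s))) * N"
  shows "besov_norm \<phi>0 s p \<infinity> u \<le> ennreal C * N"
proof -
  have "ennreal (2 powr (real j * s)) * Lp_norm p (lp_piece \<phi>0 j u) \<le> ennreal C * N" for j
  proof -
    have "ennreal (2 powr (real j * s)) * Lp_norm p (lp_piece \<phi>0 j u) \<le> ennreal (2 powr (real j * s)) * (ennreal (C * 2 powr (- (real j * s))) * N)"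
      by (intro mult_left_mono le) simp
    also have "\<dots> = ennreal (2 powr (real j * s) * (C * 2 powr (- (real j * s)))) * N"
      using assms(1) by (subst ennreal_mult) (auto simp: mult.assoc)
    also have "2 powr (real j * s) * (C * 2 powr (- (real j * s))) = C" by (simp add: powr_minus)
    finally show ?thesis .
  qed
  then show ?thesis by (simp add: besov_norm_def SUP_least)
qed

lemma Lp_fun_norm_top_fourier:
  fixes h :: "real^'n::finite \<Rightarrow> complex"
  assumes h: "integrable lborel h"
  shows "Lp_fun_norm \<infinity> (fourier h) \<le> ennreal (fourier_const TYPE('n)) * (\<integral>\<^sup>+x. ennreal (norm (h x)) \<partial>lborel)"
proof (intro Lp_fun_norm_top_le AE_I2)
  fix \<xi>
  have "ennreal (norm (fourier h \<xi>)) \<le> ennreal (fourier_const TYPE('n) * (LINT x|lborel. norm (h x)))"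
    by (intro ennreal_leI norm_fourier_le h)
  also have "\<dots> = ennreal (fourier_const TYPE('n)) * (\<integral>\<^sup>+x. ennreal (norm (h x)) \<partial>lborel)"
    using fourier_const_pos[where 'n='n] h by (subst nn_integral_eq_integral) (auto simp: ennreal_mult)
  finally show "ennreal (norm (fourier h \<xi>)) \<le> ennreal (fourier_const TYPE('n)) * (\<integral>\<^sup>+x. ennreal (norm (h x)) \<partial>lborel)" .
qed

lemma integrable_fourier_mult:
  fixes h :: "real^'n::finite \<Rightarrow> complex"
  assumes h: "integrable lborel h" and \<psi>: "integrable lborel \<psi>"
  shows "integrable lborel (\<lambda>x. fourier h x * \<psi> x)"
proof -
  have [measurable]: "fourier h \<in> borel_measurable borel" "\<psi> \<in> borel_measurable borel" using h \<psi> by auto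
  let ?B = "fourier_const TYPE('n) * (LINT x|lborel. norm (h x))"
  have "integrable lborel (\<lambda>x. ?B * norm (\<psi> x))" by (intro integrable_mult_right integrable_norm \<psi>)
  then show ?thesis
  proof (rule Bochner_Integration.integrable_bound)
    have "norm (fourier h x * \<psi> x) \<le> ?B * norm (\<psi> x)" for x
      unfolding norm_mult by (intro mult_right_mono norm_fourier_le h) simp
    then show "AE x in lborel. norm (fourier h x * \<psi> x) \<le> norm (?B * norm (\<psi> x))"
      by (intro AE_I2) (metis abs_ge_self order_trans real_norm_def)
  qed measurable
qed

text \<open>Every \<open>\<phi>\<^sub>j\<close> is a dilation of one of only two functions, which makes all bounds uniform in \<open>j\<close>.\<close>

definition dyadic_base :: "(real^'n::finite \<Rightarrow> complex) \<Rightarrow> nat \<Rightarrow> real^'n \<Rightarrow> complex" where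
  "dyadic_base \<phi>0 j = (if j = 0 then \<phi>0 else (\<lambda>x. \<phi>0 x - \<phi>0 (2 *\<^sub>R x)))"

lemma dyadic_eq: "dyadic \<phi>0 j x = dyadic_base \<phi>0 j ((2::real) powr (- real j) *\<^sub>R x)"
proof -
  have "(2::real) powr (1 - real j) = 2 * 2 powr (- real j)"
    using powr_add[of 2 1 "- real j"] by simp
  then show ?thesis by (simp add: dyadic_def dyadic_base_def)
qed

section \<open>Pieces of the transform of a Lebesgue function\<close>

context
  fixes \<phi>0 :: "real^'n::finite \<Rightarrow> complex"
  assumes phi0: "admissible_phi0 \<phi>0"
begin

lemma phi0_schwartz: "\<phi>0 \<in> schwartz" using phi0 by (simp add: admissible_phi0_def)

lemma phi0_1: "norm x \<le> 1 \<Longrightarrow> \<phi>0 x = 1" using phi0 by (simp add: admissible_phi0_def)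

lemma phi0_0: "norm x \<ge> 3/2 \<Longrightarrow> \<phi>0 x = 0" using phi0 by (simp add: admissible_phi0_def)

lemma dyadic_base_schwartz: "dyadic_base \<phi>0 j \<in> schwartz"
  unfolding dyadic_base_def using schwartz_diff[OF phi0_schwartz schwartz_dil[OF phi0_schwartz, of 2]] phi0_schwartz by simp

lemma dyadic_schwartz: "dyadic \<phi>0 j \<in> schwartz"
  unfolding dyadic_eq[abs_def] by (rule schwartz_dil[OF dyadic_base_schwartz]) simp

lemma dyadic_base_bound:
  fixes N :: "(real^'n \<Rightarrow> complex) \<Rightarrow> ennreal"
  assumes "\<And>f. f \<in> schwartz \<Longrightarrow> N f < \<infinity>"
  obtains K where "K > 0" "\<And>j. N (dyadic_base \<phi>0 j) \<le> ennreal K"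
proof -
  obtain a where a: "N (dyadic_base \<phi>0 0) = ennreal a" "a \<ge> 0"
    using assms[OF dyadic_base_schwartz[of 0]] by (cases "N (dyadic_base \<phi>0 0)") auto
  obtain b where b: "N (dyadic_base \<phi>0 1) = ennreal b" "b \<ge> 0"
    using assms[OF dyadic_base_schwartz[of 1]] by (cases "N (dyadic_base \<phi>0 1)") auto
  \<comment> \<open>Only the values at \<open>j = 0\<close> and \<open>j = 1\<close> occur; the
    summand 1 makes the constant positive.\<close>
  have "N (dyadic_base \<phi>0 j) \<le> ennreal (a + b + 1)" for j
  proof (cases "j = 0")
    case True
    then show ?thesis using a b by (auto intro!: ennreal_leI)
  next
    case False
    then have "dyadic_base \<phi>0 j = dyadic_base \<phi>0 1" by (simp add: dyadic_base_def)
    then show ?thesis using a b by (auto intro!: ennreal_leI)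
  qed
  then show ?thesis using that[of "a + b + 1"] a b by simp
qed

text \<open>The growth in \<open>j\<close> is the dilation factor alone. The argument is reflected
  because two transforms in a row produce a reflection.\<close>

lemma dyadic_Lp_bound:
  assumes q: "q \<ge> 1"
  obtains K where "K > 0" "\<And>j. Lp_fun_norm q (\<lambda>x. dyadic \<phi>0 j (- x)) \<le> ennreal (K * 2 powr (real j * (real CARD('n) * inv_exp q)))"
proof -
  obtain K where K: "K > 0" "\<And>j. Lp_fun_norm q (dyadic_base \<phi>0 j) \<le> ennreal K"
    using dyadic_base_bound[of "Lp_fun_norm q"] Lp_fun_norm_schwartz[OF q] by blast
  have "Lp_fun_norm q (\<lambda>x. dyadic \<phi>0 j (- x)) \<le> ennreal (K * 2 powr (real j * (real CARD('n) * inv_exp q)))" for j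
  proof -
    have "Lp_fun_norm q (\<lambda>x. dyadic \<phi>0 j (- x)) \<le> Lp_fun_norm q (dyadic \<phi>0 j)"
      by (rule Lp_fun_norm_reflect_le[OF q schwartz_measurable[OF dyadic_schwartz]])
    also have "\<dots> \<le> ennreal (\<bar>2 powr (- real j)\<bar> powr (- real CARD('n) * inv_exp q)) * Lp_fun_norm q (dyadic_base \<phi>0 j)"
      unfolding dyadic_eq[abs_def] by (rule Lp_fun_norm_dilate_le[OF q _ schwartz_measurable[OF dyadic_base_schwartz]]) simp
    also have "\<dots> \<le> ennreal (\<bar>2 powr (- real j)\<bar> powr (- real CARD('n) * inv_exp q)) * ennreal K"
      by (intro mult_left_mono K) simp
    also have "\<dots> = ennreal (K * 2 powr (real j * (real CARD('n) * inv_exp q)))"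
      using K(1) by (simp add: ennreal_mult[symmetric] powr_powr mult.commute)
    finally show ?thesis .
  qed
  then show ?thesis using that K(1) by blast
qed

text \<open>Unfolding leaves two transforms applied to \<phi>_j times the inverse transform of
  \<psi>, and inversion reduces them to a reflection. The frequency cutoff of the transformed
  distribution thus becomes a spatial cutoff of \<open>u\<close>.\<close>

lemma lp_piece_fourier_dist:
  assumes \<psi>: "\<psi> \<in> schwartz"
  shows "lp_piece \<phi>0 j (fourier_dist u) \<psi> = u (\<lambda>x. dyadic \<phi>0 j (- x) * fourier \<psi> x)"
proof -
  have "(\<lambda>\<xi>. dyadic \<phi>0 j \<xi> * inv_fourier \<psi> \<xi>) \<in> schwartz"
    by (intro schwartz_mult dyadic_schwartz schwartz_inv_fourier \<psi>)
  then have "fourier (fourier (\<lambda>\<xi>. dyadic \<phi>0 j \<xi> * inv_fourier \<psi> \<xi>)) = (\<lambda>x. dyadic \<phi>0 j (- x) * fourier \<psi> x)"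
    by (intro ext) (simp add: fourier_fourier inv_fourier_eq)
  then show ?thesis by (simp add: lp_piece_def fourier_dist_def)
qed

text \<open>Localisation makes \<open>f\<close> integrable, so the piece is represented by a
  transform that exists pointwise, even if \<open>fourier_dist u\<close> itself is no
  function.\<close>

lemma lp_piece_fourier_dist_represents:
  assumes f: "represents f u" and i: "integrable lborel (\<lambda>x. f x * dyadic \<phi>0 j (- x))"
  shows "represents (fourier (\<lambda>x. f x * dyadic \<phi>0 j (- x))) (lp_piece \<phi>0 j (fourier_dist u))"
  unfolding represents_def
proof (intro conjI ballI)
  show "fourier (\<lambda>x. f x * dyadic \<phi>0 j (- x)) \<in> borel_measurable lborel" using fourier_measurable[OF i] by simp
  fix \<psi> :: "real^'n \<Rightarrow> complex" assume \<psi>: "\<psi> \<in> schwartz"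
  show "integrable lborel (\<lambda>x. fourier (\<lambda>x. f x * dyadic \<phi>0 j (- x)) x * \<psi> x)"
    by (rule integrable_fourier_mult[OF i schwartz_integrable[OF \<psi>]])
  have "(\<lambda>x. dyadic \<phi>0 j (- x) * fourier \<psi> x) \<in> schwartz"
    by (rule schwartz_mult[OF schwartz_reflect[OF dyadic_schwartz] schwartz_fourier[OF \<psi>]])
  from representsD(3)[OF f this]
  show "lp_piece \<phi>0 j (fourier_dist u) \<psi> = (LINT x|lborel. fourier (\<lambda>x. f x * dyadic \<phi>0 j (- x)) x * \<psi> x)"
    by (simp add: lp_piece_fourier_dist[OF \<psi>] fourier_multiplication_formula[OF i schwartz_integrable[OF \<psi>]] mult.assoc)
qed

lemma lp_piece_fourier_dist_integrable:
  assumes p: "p \<ge> 1" "p' \<ge> 1" "inv_exp p + inv_exp p' = 1"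
    and f: "f \<in> borel_measurable borel" "Lp_fun_norm p f < \<infinity>"
  shows "integrable lborel (\<lambda>x. f x * dyadic \<phi>0 j (- x))"
proof (rule Lp_Hoelder_integrable[OF p f(1) _ f(2)])
  have s: "(\<lambda>x. dyadic \<phi>0 j (- x)) \<in> schwartz" by (rule schwartz_reflect[OF dyadic_schwartz])
  show "(\<lambda>x. dyadic \<phi>0 j (- x)) \<in> borel_measurable borel" by (rule schwartz_measurable[OF s])
  show "Lp_fun_norm p' (\<lambda>x. dyadic \<phi>0 j (- x)) < \<infinity>" by (rule Lp_fun_norm_schwartz[OF p(2) s])
qed

text \<open>The weight \<open>2^(j s)\<close> cancels exactly the growth \<open>2^(j n / p')\<close>
  of the \<open>L_p'\<close> norm of \<phi>_j; this fixes the smoothness exponent.\<close>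

theorem fourier_Lp_to_Zygmund:
  assumes p: "p \<ge> 1" "p' \<ge> 1" "inv_exp p + inv_exp p' = 1"
  shows "maps_boundedly (Lp_space p) (Lp_norm p) (besov \<phi>0 (- real CARD('n) * inv_exp p') \<infinity> \<infinity>)
    (besov_norm \<phi>0 (- real CARD('n) * inv_exp p') \<infinity> \<infinity>) fourier_dist"
proof -
  let ?s = "- real CARD('n) * inv_exp p'"
  let ?c = "fourier_const TYPE('n)"
  note c = fourier_const_pos[where 'n='n]
  obtain K where K: "K > 0" "\<And>j. Lp_fun_norm p' (\<lambda>x. dyadic \<phi>0 j (- x)) \<le> ennreal (K * 2 powr (real j * (real CARD('n) * inv_exp p')))"
    using dyadic_Lp_bound[OF p(2)] by blast
  have bd: "besov_norm \<phi>0 ?s \<infinity> \<infinity> (fourier_dist u) \<le> ennreal (?c * K) * Lp_norm p u" for u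
  proof (rule le_Lp_normI)
    fix f assume f: "represents f u" "Lp_fun_norm p f < \<infinity>"
    note [measurable] = representsD(1)[OF f(1)] schwartz_measurable[OF schwartz_reflect[OF dyadic_schwartz]]
    show "besov_norm \<phi>0 ?s \<infinity> \<infinity> (fourier_dist u) \<le> ennreal (?c * K) * Lp_fun_norm p f"
    proof (rule besov_norm_top_leI)
      fix j
      let ?h = "\<lambda>x. f x * dyadic \<phi>0 j (- x)"
      have i: "integrable lborel ?h" by (rule lp_piece_fourier_dist_integrable[OF p]) (use f in auto)
      have "Lp_norm \<infinity> (lp_piece \<phi>0 j (fourier_dist u)) \<le> Lp_fun_norm \<infinity> (fourier ?h)"
        by (rule Lp_norm_le[OF lp_piece_fourier_dist_represents[OF f(1) i]])
      also have "\<dots> \<le> ennreal ?c * (\<integral>\<^sup>+x. ennreal (norm (?h x)) \<partial>lborel)" by (rule Lp_fun_norm_top_fourier[OF i])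
      also have "\<dots> \<le> ennreal ?c * (Lp_fun_norm p f * Lp_fun_norm p' (\<lambda>x. dyadic \<phi>0 j (- x)))"
        unfolding norm_mult by (intro mult_left_mono Lp_fun_norm_Hoelder[OF p]) auto
      also have "\<dots> \<le> ennreal ?c * (Lp_fun_norm p f * ennreal (K * 2 powr (- (real j * ?s))))"
        using K(2)[of j] by (intro mult_left_mono) auto
      also have "\<dots> = ennreal (?c * K * 2 powr (- (real j * ?s))) * Lp_fun_norm p f"
        using c K(1) by (simp add: ennreal_mult mult_ac)
      finally show "Lp_norm \<infinity> (lp_piece \<phi>0 j (fourier_dist u)) \<le> ennreal (?c * K * 2 powr (- (real j * ?s))) * Lp_fun_norm p f" .
    qed (use c K in simp)
  qed (use c K in simp)
  show ?thesis by (rule maps_boundedly_fourier_distI[OF p _ bd]) (simp add: besov_def)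
qed

end

section \<open>Fourier multipliers as convolutions\<close>

text \<open>The convolution of \<open>g\<close> with the inverse transform of \<eta>, with the usual
  factor. Since \<open>inv_fourier\<close> is the reflected \<open>fourier\<close>, the kernel at
  \<open>y - x\<close> appears as \<open>fourier \<eta>\<close> at \<open>x - y\<close>.\<close>

definition multiplier_kernel :: "(real^'n::finite \<Rightarrow> complex) \<Rightarrow> (real^'n \<Rightarrow> complex) \<Rightarrow> real^'n \<Rightarrow> complex" where
  "multiplier_kernel \<eta> g y = of_real (fourier_const TYPE('n)) * (LINT x|lborel. g x * fourier \<eta> (x - y))"

lemma fourier_mult_inv_fourier:
  fixes \<eta> \<psi> :: "real^'n::finite \<Rightarrow> complex"
  assumes \<eta>: "\<eta> \<in> schwartz" and \<psi>: "\<psi> \<in> schwartz"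
  shows "fourier (\<lambda>\<xi>. \<eta> \<xi> * inv_fourier \<psi> \<xi>) x = of_real (fourier_const TYPE('n)) * (LINT y|lborel. fourier \<eta> (x - y) * \<psi> y)"
proof -
  have i\<psi>: "integrable lborel \<psi>" and i\<eta>: "integrable lborel \<eta>" using \<eta> \<psi> by (auto intro: schwartz_integrable)
  have ir: "integrable lborel (\<lambda>y. \<psi> (- y))" by (rule schwartz_integrable[OF schwartz_reflect[OF \<psi>]])
  have im: "integrable lborel (\<lambda>\<xi>. cis (- (\<xi> \<bullet> x)) * \<eta> \<xi>)" by (rule integrable_cis_mult[OF i\<eta>])
  have "(LINT \<xi>|lborel. cis (- (\<xi> \<bullet> x)) * (\<eta> \<xi> * inv_fourier \<psi> \<xi>)) =
      (LINT \<xi>|lborel. fourier (\<lambda>y. \<psi> (- y)) \<xi> * (cis (- (\<xi> \<bullet> x)) * \<eta> \<xi>))"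
    by (simp add: inv_fourier_eq fourier_reflect[OF i\<psi>] mult_ac)
  also have "\<dots> = (LINT y|lborel. \<psi> (- y) * fourier \<eta> (y + x))"
    by (subst fourier_multiplication_formula[OF ir im], subst fourier_modulate, rule refl)
  also have "\<dots> = (LINT y|lborel. fourier \<eta> (x - y) * \<psi> y)"
  proof -
    have t: "integrable lborel (\<lambda>y. fourier (\<lambda>\<xi>. cis (- (\<xi> \<bullet> x)) * \<eta> \<xi>) y * \<psi> (- y))"
      by (rule integrable_fourier_mult[OF im ir])
    from lborel_integral_affine[OF t[unfolded fourier_modulate], of "-1" 0] show ?thesis
      by (simp add: mult.commute)
  qed
  finally show ?thesis unfolding fourier_eq[of "\<lambda>\<xi>. \<eta> \<xi> * inv_fourier \<psi> \<xi>"] by simp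
qed

text \<open>A function that is not integrable has integral 0 by convention, so the bound holds for
  it as well; kernel estimates can then be stated for arbitrary \<open>g\<close>.\<close>

lemma norm_lebesgue_integral_le: "ennreal (norm (integral\<^sup>L M f)) \<le> (\<integral>\<^sup>+x. ennreal (norm (f x)) \<partial>M)"
  by (cases "integrable M f") (auto intro: integral_norm_bound_ennreal simp: not_integrable_integral_eq)

lemma norm_multiplier_kernel_le:
  "ennreal (norm (multiplier_kernel \<eta> g y)) \<le> ennreal (fourier_const TYPE('n::finite)) *
    (\<integral>\<^sup>+x. ennreal (norm (g x) * norm (fourier \<eta> ((x::real^'n) - y))) \<partial>lborel)"
proof -
  have "ennreal (norm (multiplier_kernel \<eta> g y)) = ennreal (fourier_const TYPE('n)) * ennreal (norm (LINT x|lborel. g x * fourier \<eta> (x - y)))"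
    using fourier_const_pos[where 'n='n] by (simp add: multiplier_kernel_def norm_mult ennreal_mult)
  also have "\<dots> \<le> ennreal (fourier_const TYPE('n)) * (\<integral>\<^sup>+x. ennreal (norm (g x * fourier \<eta> (x - y))) \<partial>lborel)"
    by (intro mult_left_mono norm_lebesgue_integral_le) simp
  finally show ?thesis by (simp add: norm_mult)
qed

lemma nn_integral_kernel_Hoelder:
  assumes q: "q \<ge> 1" "q' \<ge> 1" "inv_exp q + inv_exp q' = 1" and \<eta>: "\<eta> \<in> schwartz" and [measurable]: "g \<in> borel_measurable borel"
  shows "(\<integral>\<^sup>+x. ennreal (norm (g x) * norm (fourier \<eta> ((x::real^'n::finite) - y))) \<partial>lborel) \<le> Lp_fun_norm q g * Lp_fun_norm q' (fourier \<eta>)"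
proof -
  note [measurable] = schwartz_measurable[OF schwartz_fourier[OF \<eta>]]
  have "(\<integral>\<^sup>+x. ennreal (norm (g x) * norm (fourier \<eta> (x - y))) \<partial>lborel) \<le> Lp_fun_norm q g * Lp_fun_norm q' (\<lambda>x. fourier \<eta> (x - y))"
    by (rule Lp_fun_norm_Hoelder[OF q]) measurable
  also have "\<dots> \<le> Lp_fun_norm q g * Lp_fun_norm q' (fourier \<eta>)"
    by (intro mult_left_mono Lp_fun_norm_translate_le q) auto
  finally show ?thesis .
qed

lemma multiplier_kernel_top_le:
  fixes g :: "real^'n::finite \<Rightarrow> complex"
  assumes q: "q \<ge> 1" "q' \<ge> 1" "inv_exp q + inv_exp q' = 1" and \<eta>: "\<eta> \<in> schwartz" and g: "g \<in> borel_measurable borel"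
  shows "Lp_fun_norm \<infinity> (multiplier_kernel \<eta> g) \<le> ennreal (fourier_const TYPE('n)) * (Lp_fun_norm q g * Lp_fun_norm q' (fourier \<eta>))"
  by (intro Lp_fun_norm_top_le AE_I2 order_trans[OF norm_multiplier_kernel_le] mult_left_mono nn_integral_kernel_Hoelder[OF q \<eta> g]) simp

lemma multiplier_kernel_measurable:
  assumes \<eta>: "\<eta> \<in> schwartz" and [measurable]: "(g :: real^'n::finite \<Rightarrow> complex) \<in> borel_measurable borel"
  shows "multiplier_kernel \<eta> g \<in> borel_measurable borel"
proof -
  note [measurable] = schwartz_measurable[OF schwartz_fourier[OF \<eta>]]
  have "(\<lambda>y. LINT x|lborel. g x * fourier \<eta> (x - y)) \<in> borel_measurable borel"
    by (rule lborel.borel_measurable_lebesgue_integral) measurable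
  then show ?thesis unfolding multiplier_kernel_def[abs_def] by measurable
qed

text \<open>The multiplier is moved from the test function to \<open>g\<close> by Fubini. Absolute
  integrability holds because Hoelder's inequality bounds the integral over \<open>x\<close>
  uniformly in \<open>y\<close>, and \<psi> is integrable.\<close>

lemma multiplier_kernel_represents:
  fixes g :: "real^'n::finite \<Rightarrow> complex"
  assumes q: "q \<ge> 1" "q' \<ge> 1" "inv_exp q + inv_exp q' = 1" and \<eta>: "\<eta> \<in> schwartz"
    and g: "represents g v" "Lp_fun_norm q g < \<infinity>"
  shows "represents (multiplier_kernel \<eta> g) (\<lambda>\<psi>. v (fourier (\<lambda>\<xi>. \<eta> \<xi> * inv_fourier \<psi> \<xi>)))"
  unfolding represents_def
proof (intro conjI ballI)
  let ?K = "fourier \<eta>" and ?c = "fourier_const TYPE('n)"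
  note gm[measurable] = representsD(1)[OF g(1)]
  note [measurable] = schwartz_measurable[OF schwartz_fourier[OF \<eta>]]
  show "multiplier_kernel \<eta> g \<in> borel_measurable lborel" using multiplier_kernel_measurable[OF \<eta> gm] by simp
  fix \<psi> :: "real^'n \<Rightarrow> complex" assume \<psi>: "\<psi> \<in> schwartz"
  note [measurable] = schwartz_measurable[OF \<psi>]
  let ?f = "\<lambda>x y. g x * ?K (x - y) * \<psi> y"
  have int: "integrable (lborel \<Otimes>\<^sub>M lborel) (\<lambda>(x, y). ?f x y)"
  proof (rule integrableI_bounded)
    have "(\<integral>\<^sup>+z. ennreal (norm (case z of (x, y) \<Rightarrow> ?f x y)) \<partial>(lborel \<Otimes>\<^sub>M lborel)) =
        (\<integral>\<^sup>+y. \<integral>\<^sup>+x. ennreal (norm (?f x y)) \<partial>lborel \<partial>lborel)"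
      by (subst lborel_pair.nn_integral_snd[symmetric]) auto
    also have "\<dots> = (\<integral>\<^sup>+y. ennreal (norm (\<psi> y)) * (\<integral>\<^sup>+x. ennreal (norm (g x) * norm (?K (x - y))) \<partial>lborel) \<partial>lborel)"
      by (intro nn_integral_cong, subst nn_integral_cmult[symmetric]) (auto simp: norm_mult ennreal_mult mult_ac intro!: nn_integral_cong)
    also have "\<dots> \<le> (\<integral>\<^sup>+y. ennreal (norm (\<psi> y)) * (Lp_fun_norm q g * Lp_fun_norm q' ?K) \<partial>lborel)"
      by (intro nn_integral_mono mult_left_mono nn_integral_kernel_Hoelder[OF q \<eta> gm]) simp
    also have "\<dots> = (\<integral>\<^sup>+y. ennreal (norm (\<psi> y)) \<partial>lborel) * (Lp_fun_norm q g * Lp_fun_norm q' ?K)"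
      by (rule nn_integral_multc) measurable
    also have "\<dots> < \<infinity>"
      using schwartz_integrable[OF \<psi>] g(2) Lp_fun_norm_schwartz[OF q(2) schwartz_fourier[OF \<eta>]]
      by (auto simp: integrable_iff_bounded ennreal_mult_less_top)
    finally show "(\<integral>\<^sup>+z. ennreal (norm (case z of (x, y) \<Rightarrow> ?f x y)) \<partial>(lborel \<Otimes>\<^sub>M lborel)) < \<infinity>" .
  qed measurable
  have mk: "multiplier_kernel \<eta> g y * \<psi> y = of_real ?c * (LINT x|lborel. ?f x y)" for y
    unfolding multiplier_kernel_def integral_mult_left_zero by (rule mult.assoc)
  have "integrable lborel (\<lambda>y. LINT x|lborel. ?f x y)" by (rule lborel_pair.integrable_snd[OF int])
  then show "integrable lborel (\<lambda>y. multiplier_kernel \<eta> g y * \<psi> y)"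
    unfolding mk by (rule integrable_mult_right)
  have "(\<lambda>\<xi>. \<eta> \<xi> * inv_fourier \<psi> \<xi>) \<in> schwartz" by (intro schwartz_mult \<eta> schwartz_inv_fourier \<psi>)
  from representsD(3)[OF g(1) schwartz_fourier[OF this]]
  have "v (fourier (\<lambda>\<xi>. \<eta> \<xi> * inv_fourier \<psi> \<xi>)) = (LINT x|lborel. of_real ?c * (LINT y|lborel. ?f x y))"
    unfolding fourier_mult_inv_fourier[OF \<eta> \<psi>] mult.assoc[of "g _"] integral_mult_right_zero
    by (simp only: mult.left_commute[of "g _"] integral_mult_right_zero)
  also have "\<dots> = of_real ?c * (LINT x|lborel. LINT y|lborel. ?f x y)" by simp
  also have "(LINT x|lborel. LINT y|lborel. ?f x y) = (LINT y|lborel. LINT x|lborel. ?f x y)"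
    by (rule lborel_pair.Fubini_integral[OF int, symmetric])
  also have "of_real ?c * \<dots> = (LINT y|lborel. multiplier_kernel \<eta> g y * \<psi> y)"
    unfolding mk by (rule integral_mult_right_zero[symmetric])
  finally show "v (fourier (\<lambda>\<xi>. \<eta> \<xi> * inv_fourier \<psi> \<xi>)) = (LINT y|lborel. multiplier_kernel \<eta> g y * \<psi> y)" .
qed

lemma Lp_fun_norm_2: "Lp_fun_norm 2 g = epow (\<integral>\<^sup>+ x. ennreal ((norm (g x))\<^sup>2) \<partial>lborel) (1 / 2)"
proof -
  have "norm z powr 2 = (norm z)\<^sup>2" for z :: complex by (cases "z = 0") auto
  then show ?thesis using Lp_fun_norm_real[of 2 g] by simp
qed

text \<open>Young's inequality for a kernel in \<open>L_1\<close> acting on \<open>L_2\<close>.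
  Splitting the kernel's modulus into two square roots, one of them kept with \<open>g\<close>,
  Cauchy-Schwarz gives a pointwise bound whose integral is evaluated by exchanging the order of
  integration.\<close>

lemma multiplier_kernel_2_le:
  fixes g :: "real^'n::finite \<Rightarrow> complex"
  assumes \<eta>: "\<eta> \<in> schwartz" and gm[measurable]: "g \<in> borel_measurable borel"
  shows "Lp_fun_norm 2 (multiplier_kernel \<eta> g) \<le> ennreal (fourier_const TYPE('n)) * (Lp_fun_norm 1 (fourier \<eta>) * Lp_fun_norm 2 g)"
proof -
  let ?K = "fourier \<eta>" and ?c = "fourier_const TYPE('n)"
  note [measurable] = schwartz_measurable[OF schwartz_fourier[OF \<eta>]] multiplier_kernel_measurable[OF \<eta> gm]
  let ?k = "\<integral>\<^sup>+x. ennreal (norm (?K x)) \<partial>lborel"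
  have shift: "(\<integral>\<^sup>+x. ennreal (norm (?K (x - y))) \<partial>lborel) = ?k" for y
    using nn_integral_lborel_affine[of "\<lambda>x. ennreal (norm (?K x))" 1 "- y"] by simp
  have shift': "(\<integral>\<^sup>+y. ennreal (norm (?K (x - y))) \<partial>lborel) = ?k" for x
    using nn_integral_lborel_affine[of "\<lambda>x. ennreal (norm (?K x))" "-1" x] by simp
  have sq: "epow (ennreal a) 2 = ennreal (a\<^sup>2)" if "a \<ge> 0" for a
    using that by (cases "a = 0") (auto simp: epow_ennreal)
  have pt: "ennreal ((norm (multiplier_kernel \<eta> g y))\<^sup>2) \<le> ennreal (?c\<^sup>2) * ((\<integral>\<^sup>+x. ennreal ((norm (g x))\<^sup>2) * ennreal (norm (?K (x - y))) \<partial>lborel) * ?k)" for y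
  proof -
    let ?u = "\<lambda>x. norm (g x) * sqrt (norm (?K (x - y)))" and ?v = "\<lambda>x. sqrt (norm (?K (x - y)))"
    have uv: "?u x powr 2 = (norm (g x))\<^sup>2 * norm (?K (x - y))" "?v x powr 2 = norm (?K (x - y))" for x
      by (cases "g x = 0 \<or> ?K (x - y) = 0"; auto simp: power_mult_distrib)+
    have "(\<integral>\<^sup>+x. ennreal (norm (g x) * norm (?K (x - y))) \<partial>lborel) = (\<integral>\<^sup>+x. ennreal (?u x * ?v x) \<partial>lborel)"
      by (simp add: mult.assoc)
    also have "\<dots> \<le> epow (\<integral>\<^sup>+x. ennreal (?u x powr 2) \<partial>lborel) (1 / 2) * epow (\<integral>\<^sup>+x. ennreal (?v x powr 2) \<partial>lborel) (1 / 2)"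
      by (rule nn_integral_Hoelder) auto
    also have "\<dots> = epow ((\<integral>\<^sup>+x. ennreal ((norm (g x))\<^sup>2) * ennreal (norm (?K (x - y))) \<partial>lborel) * ?k) (1 / 2)"
      unfolding uv shift epow_mult by (simp add: ennreal_mult)
    finally have "(\<integral>\<^sup>+x. ennreal (norm (g x) * norm (?K (x - y))) \<partial>lborel) \<le> epow ((\<integral>\<^sup>+x. ennreal ((norm (g x))\<^sup>2) * ennreal (norm (?K (x - y))) \<partial>lborel) * ?k) (1 / 2)" .
    then have "ennreal (norm (multiplier_kernel \<eta> g y)) \<le> ennreal ?c * epow ((\<integral>\<^sup>+x. ennreal ((norm (g x))\<^sup>2) * ennreal (norm (?K (x - y))) \<partial>lborel) * ?k) (1 / 2)"
      by (intro order_trans[OF norm_multiplier_kernel_le] mult_left_mono) auto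
    from epow_mono[OF _ this, of 2] show ?thesis
      using fourier_const_pos[where 'n='n] by (simp add: epow_mult epow_epow sq)
  qed
  have "(\<integral>\<^sup>+y. ennreal ((norm (multiplier_kernel \<eta> g y))\<^sup>2) \<partial>lborel) \<le>
      (\<integral>\<^sup>+y. ennreal (?c\<^sup>2) * ((\<integral>\<^sup>+x. ennreal ((norm (g x))\<^sup>2) * ennreal (norm (?K (x - y))) \<partial>lborel) * ?k) \<partial>lborel)"
    by (intro nn_integral_mono pt)
  also have "\<dots> = ennreal (?c\<^sup>2) * ((\<integral>\<^sup>+y. \<integral>\<^sup>+x. ennreal ((norm (g x))\<^sup>2) * ennreal (norm (?K (x - y))) \<partial>lborel \<partial>lborel) * ?k)"
    by (simp add: nn_integral_cmult nn_integral_multc)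
  also have "(\<integral>\<^sup>+y. \<integral>\<^sup>+x. ennreal ((norm (g x))\<^sup>2) * ennreal (norm (?K (x - y))) \<partial>lborel \<partial>lborel) =
      (\<integral>\<^sup>+x. \<integral>\<^sup>+y. ennreal ((norm (g x))\<^sup>2) * ennreal (norm (?K (x - y))) \<partial>lborel \<partial>lborel)"
    by (rule lborel_pair.Fubini') measurable
  also have "\<dots> = (\<integral>\<^sup>+x. ennreal ((norm (g x))\<^sup>2) \<partial>lborel) * ?k"
    by (simp add: nn_integral_cmult nn_integral_multc shift')
  finally have "(\<integral>\<^sup>+y. ennreal ((norm (multiplier_kernel \<eta> g y))\<^sup>2) \<partial>lborel) \<le> ennreal (?c\<^sup>2) * ((\<integral>\<^sup>+x. ennreal ((norm (g x))\<^sup>2) \<partial>lborel) * ?k * ?k)" .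
  from epow_mono[OF _ this, of "1/2"] have "Lp_fun_norm 2 (multiplier_kernel \<eta> g) \<le> epow (ennreal (?c\<^sup>2) * ((\<integral>\<^sup>+x. ennreal ((norm (g x))\<^sup>2) \<partial>lborel) * ?k * ?k)) (1/2)"
    by (simp add: Lp_fun_norm_2)
  also have "\<dots> = ennreal ?c * (epow ?k (1/2) * epow ?k (1/2) * Lp_fun_norm 2 g)"
    unfolding epow_mult Lp_fun_norm_2 using fourier_const_pos[where 'n='n]
    by (simp add: sq[symmetric] epow_epow mult_ac)
  also have "epow ?k (1/2) * epow ?k (1/2) = Lp_fun_norm 1 ?K"
    by (simp add: epow_add[symmetric] Lp_fun_norm_1)
  finally show ?thesis .
qed

text \<open>Pointwise, \<open>\<bar>h\<bar>^r\<close> is at most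
  \<open>M^(r-2) * \<bar>h\<bar>^2\<close>. Together with the bounds for exponents 2 and infinity
  this replaces Young's convolution inequality for intermediate exponents.\<close>

lemma Lp_fun_norm_interpolate:
  fixes h :: "real^'n::finite \<Rightarrow> complex"
  assumes r: "r > 2" and [measurable]: "h \<in> borel_measurable borel" and M: "Lp_fun_norm \<infinity> h \<le> ennreal M" "M \<ge> 0"
  shows "Lp_fun_norm (ennreal r) h \<le> ennreal (M powr (1 - 2 / r)) * epow (Lp_fun_norm 2 h) (2 / r)"
proof -
  have "(\<integral>\<^sup>+x. ennreal (norm (h x) powr r) \<partial>lborel) \<le> (\<integral>\<^sup>+x. ennreal (M powr (r - 2)) * ennreal ((norm (h x))\<^sup>2) \<partial>lborel)"
  proof (rule nn_integral_mono_AE)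
    show "AE x in lborel. ennreal (norm (h x) powr r) \<le> ennreal (M powr (r - 2)) * ennreal ((norm (h x))\<^sup>2)"
      using Lp_fun_norm_top_AE[of h]
    proof eventually_elim
      fix x assume "ennreal (norm (h x)) \<le> Lp_fun_norm \<infinity> h"
      then have "ennreal (norm (h x)) \<le> ennreal M" using M(1) by (rule order_trans)
      then have "norm (h x) \<le> M" using M(2) by (simp add: ennreal_le_iff)
      then have "norm (h x) powr (r - 2) * (norm (h x))\<^sup>2 \<le> M powr (r - 2) * (norm (h x))\<^sup>2"
        using r by (intro mult_right_mono powr_mono2) auto
      moreover have "norm (h x) powr r = norm (h x) powr (r - 2) * (norm (h x))\<^sup>2"
      proof (cases "h x = 0")
        case False
        then have "norm (h x) powr r = norm (h x) powr (r - 2) * norm (h x) powr 2" by (simp only: powr_add[symmetric]) simp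
        then show ?thesis using False by simp
      qed simp
      ultimately show "ennreal (norm (h x) powr r) \<le> ennreal (M powr (r - 2)) * ennreal ((norm (h x))\<^sup>2)"
        by (simp add: ennreal_mult[symmetric] ennreal_leI)
    qed
  qed
  also have "\<dots> = ennreal (M powr (r - 2)) * (\<integral>\<^sup>+x. ennreal ((norm (h x))\<^sup>2) \<partial>lborel)"
    by (rule nn_integral_cmult) measurable
  finally have "epow (\<integral>\<^sup>+x. ennreal (norm (h x) powr r) \<partial>lborel) (1 / r) \<le> epow (ennreal (M powr (r - 2)) * (\<integral>\<^sup>+x. ennreal ((norm (h x))\<^sup>2) \<partial>lborel)) (1 / r)"
    using r by (intro epow_mono) auto
  also have "\<dots> = ennreal (M powr (1 - 2 / r)) * epow (Lp_fun_norm 2 h) (2 / r)"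
    unfolding Lp_fun_norm_2 epow_mult using r by (simp add: epow_ennreal powr_powr epow_epow diff_divide_distrib)
  finally show ?thesis using r by (simp add: Lp_fun_norm_real)
qed

text \<open>The transform contributes \<open>a^(-n)\<close> and the norm of the inverse dilation
  contributes \<open>a^(n/q)\<close>. For \<open>q = 1\<close> the two cancel, so kernels of dilated
  multipliers are bounded in \<open>L_1\<close> uniformly in the scale.\<close>

lemma Lp_fun_norm_fourier_dilate_le:
  fixes f :: "real^'n::finite \<Rightarrow> complex"
  assumes q: "q \<ge> 1" and a: "a > 0" and f: "f \<in> schwartz"
  shows "Lp_fun_norm q (fourier (\<lambda>x. f (a *\<^sub>R x))) \<le> ennreal (a powr (- real CARD('n) * (1 - inv_exp q))) * Lp_fun_norm q (fourier f)"
proof -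
  note [measurable] = schwartz_measurable[OF schwartz_fourier[OF f]]
  have "fourier (\<lambda>x. f (a *\<^sub>R x)) = (\<lambda>\<xi>. of_real (inverse (\<bar>a\<bar> ^ CARD('n))) * fourier f (inverse a *\<^sub>R \<xi>))"
    using a by (intro ext fourier_dilate schwartz_integrable f) simp
  then have "Lp_fun_norm q (fourier (\<lambda>x. f (a *\<^sub>R x))) = Lp_fun_norm q (\<lambda>\<xi>. of_real (inverse (\<bar>a\<bar> ^ CARD('n))) * fourier f (inverse a *\<^sub>R \<xi>))"
    by (rule arg_cong)
  also have "\<dots> \<le> ennreal (norm (complex_of_real (inverse (\<bar>a\<bar> ^ CARD('n))))) * Lp_fun_norm q (\<lambda>\<xi>. fourier f (inverse a *\<^sub>R \<xi>))"
    by (rule Lp_fun_norm_cmult_le[OF q]) measurable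
  also have "\<dots> \<le> ennreal (norm (complex_of_real (inverse (\<bar>a\<bar> ^ CARD('n))))) * (ennreal (\<bar>inverse a\<bar> powr (- real CARD('n) * inv_exp q)) * Lp_fun_norm q (fourier f))"
    using a by (intro mult_left_mono Lp_fun_norm_dilate_le[OF q]) auto
  also have "\<dots> = ennreal (a powr (- real CARD('n) * (1 - inv_exp q))) * Lp_fun_norm q (fourier f)"
  proof -
    have "norm (complex_of_real (inverse (\<bar>a\<bar> ^ CARD('n)))) * \<bar>inverse a\<bar> powr (- real CARD('n) * inv_exp q) = a powr (- real CARD('n)) * a powr (real CARD('n) * inv_exp q)"
    proof -
      have "\<bar>inverse a\<bar> = a powr (- 1)" using a by (simp add: powr_minus)
      then have "\<bar>inverse a\<bar> powr (- real CARD('n) * inv_exp q) = a powr (real CARD('n) * inv_exp q)"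
        by (simp only: powr_powr) simp
      moreover have "norm (complex_of_real (inverse (\<bar>a\<bar> ^ CARD('n)))) = a powr (- real CARD('n))"
        unfolding norm_of_real using a by (simp add: powr_minus powr_realpow)
      ultimately show ?thesis by simp
    qed
    also have "\<dots> = a powr (- real CARD('n) * (1 - inv_exp q))"
      by (simp add: powr_add[symmetric] algebra_simps)
    finally show ?thesis by (simp add: mult.assoc[symmetric] ennreal_mult[symmetric])
  qed
  finally show ?thesis .
qed

section \<open>Embeddings\<close>

lemma conjugate_exponent:
  assumes "q \<ge> 1" obtains q' where "q' \<ge> 1" "inv_exp q + inv_exp q' = 1"
  using assms
proof (cases q rule: ennreal_ge_1_cases)
  case 1
  then show ?thesis using that[of 1] by (simp add: inv_exp_def)
next
  case (2 r)
  show ?thesis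
  proof (cases "r = 1")
    case True
    then show ?thesis using that[of \<infinity>] 2 by (simp add: inv_exp_def)
  next
    case False
    then have r: "r > 1" using 2 by simp
    have "1 \<le> r / (r - 1)" using r by (simp add: field_simps)
    moreover have "1 / r + 1 / (r / (r - 1)) = 1" using r by (simp add: field_simps)
    ultimately show ?thesis using that[of "ennreal (r / (r - 1))"] 2 r by (auto simp: inv_exp_ennreal)
  qed
qed

lemma inv_exp_2: "inv_exp 2 = 1 / 2" by (simp add: inv_exp_def)

lemma besov_norm_le_pieces:
  assumes q: "q \<ge> 1" and C: "C > 0"
    and le: "\<And>j. Lp_norm p1 (lp_piece \<phi>0 j u) \<le> ennreal (C * 2 powr (real j * (t - s))) * Lp_norm p2 (lp_piece \<phi>0 j v)"
  shows "besov_norm \<phi>0 s p1 q u \<le> ennreal C * besov_norm \<phi>0 t p2 q v"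
proof -
  have e: "2 powr (real j * s) * (C * 2 powr (real j * (t - s))) = C * 2 powr (real j * t)" for j
  proof -
    have "2 powr (real j * s) * (C * 2 powr (real j * (t - s))) = C * (2 powr (real j * s) * 2 powr (real j * (t - s)))" by simp
    also have "\<dots> = C * 2 powr (real j * t)" by (simp add: powr_add[symmetric] algebra_simps)
    finally show ?thesis .
  qed
  have le': "ennreal (2 powr (real j * s)) * Lp_norm p1 (lp_piece \<phi>0 j u) \<le> ennreal C * (ennreal (2 powr (real j * t)) * Lp_norm p2 (lp_piece \<phi>0 j v))" for j
  proof -
    have "ennreal (2 powr (real j * s)) * Lp_norm p1 (lp_piece \<phi>0 j u) \<le> ennreal (2 powr (real j * s)) * (ennreal (C * 2 powr (real j * (t - s))) * Lp_norm p2 (lp_piece \<phi>0 j v))"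
      by (intro mult_left_mono le) simp
    also have "\<dots> = ennreal (2 powr (real j * s) * (C * 2 powr (real j * (t - s)))) * Lp_norm p2 (lp_piece \<phi>0 j v)"
      using C by (subst ennreal_mult) (auto simp: mult.assoc)
    also have "\<dots> = ennreal C * (ennreal (2 powr (real j * t)) * Lp_norm p2 (lp_piece \<phi>0 j v))"
      unfolding e using C by (simp add: ennreal_mult mult.assoc)
    finally show ?thesis .
  qed
  show ?thesis using q
  proof (cases q rule: ennreal_ge_1_cases)
    case 1
    have "(SUP j. ennreal (2 powr (real j * s)) * Lp_norm p1 (lp_piece \<phi>0 j u)) \<le> ennreal C * (SUP j. ennreal (2 powr (real j * t)) * Lp_norm p2 (lp_piece \<phi>0 j v))"
      by (rule SUP_least, rule order_trans[OF le'], rule mult_left_mono, rule SUP_upper) auto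
    then show ?thesis using 1 by (simp add: besov_norm_def)
  next
    case (2 r)
    have pw: "ennreal (2 powr (real j * s * r)) * epow N r = epow (ennreal (2 powr (real j * s)) * N) r" for j s N
      by (simp add: epow_mult epow_ennreal powr_powr)
    let ?A = "\<Sum>j. epow (ennreal (2 powr (real j * s)) * Lp_norm p1 (lp_piece \<phi>0 j u)) r"
    let ?B = "\<Sum>j. epow (ennreal (2 powr (real j * t)) * Lp_norm p2 (lp_piece \<phi>0 j v)) r"
    have "?A \<le> (\<Sum>j. ennreal (C powr r) * epow (ennreal (2 powr (real j * t)) * Lp_norm p2 (lp_piece \<phi>0 j v)) r)"
    proof (rule suminf_le)
      fix j
      have "epow (ennreal (2 powr (real j * s)) * Lp_norm p1 (lp_piece \<phi>0 j u)) r \<le> epow (ennreal C * (ennreal (2 powr (real j * t)) * Lp_norm p2 (lp_piece \<phi>0 j v))) r"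
        using 2 by (intro epow_mono le') auto
      then show "epow (ennreal (2 powr (real j * s)) * Lp_norm p1 (lp_piece \<phi>0 j u)) r \<le> ennreal (C powr r) * epow (ennreal (2 powr (real j * t)) * Lp_norm p2 (lp_piece \<phi>0 j v)) r"
        using C by (subst (asm) epow_mult) (simp add: epow_ennreal less_imp_le)
    qed auto
    also have "\<dots> = ennreal (C powr r) * ?B" by simp
    finally have "epow ?A (1 / r) \<le> epow (ennreal (C powr r) * ?B) (1 / r)" using 2 by (intro epow_mono) auto
    also have "\<dots> = ennreal C * epow ?B (1 / r)"
      using 2 C by (simp add: epow_mult[of "ennreal (C powr r)"] epow_ennreal powr_powr less_imp_le)
    finally show ?thesis using 2 by (simp add: besov_norm_def pw)
  qed
qed

lemma besov_norm_top_le: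
  assumes q: "q \<ge> 1"
  shows "besov_norm \<phi>0 s p \<infinity> u \<le> besov_norm \<phi>0 s p q u"
  using q
proof (cases q rule: ennreal_ge_1_cases)
  case 1
  then show ?thesis by simp
next
  case (2 r)
  have "ennreal (2 powr (real j * s)) * Lp_norm p (lp_piece \<phi>0 j u) \<le> besov_norm \<phi>0 s p q u" for j
  proof -
    let ?a = "\<lambda>j. ennreal (2 powr (real j * s * r)) * epow (Lp_norm p (lp_piece \<phi>0 j u)) r"
    have "epow (ennreal (2 powr (real j * s)) * Lp_norm p (lp_piece \<phi>0 j u)) r = ?a j"
      by (simp add: epow_mult epow_ennreal powr_powr)
    also have "\<dots> \<le> (\<Sum>j. ?a j)" using sum_le_suminf[of ?a "{j}"] by simp
    finally show ?thesis using 2 by (simp add: besov_norm_def epow_inverse_le_iff)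
  qed
  then show ?thesis by (simp add: besov_norm_def[of _ _ _ top] SUP_least)
qed

lemma maps_boundedly_besov_id:
  assumes "C > 0" "\<And>u. besov_norm \<phi>0 t p2 q2 u \<le> ennreal C * besov_norm \<phi>0 s p1 q1 u"
  shows "maps_boundedly (besov \<phi>0 s p1 q1) (besov_norm \<phi>0 s p1 q1) (besov \<phi>0 t p2 q2) (besov_norm \<phi>0 t p2 q2) id"
proof -
  have "u \<in> besov \<phi>0 t p2 q2" if "u \<in> besov \<phi>0 s p1 q1" for u
    using that le_less_trans[OF assms(2)[of u]] by (simp add: besov_def ennreal_mult_less_top)
  then show ?thesis unfolding maps_boundedly_def using assms by auto
qed

text \<open>The cutoff equals 1 on the support of \<open>\<phi>\<^sub>j\<close>, so every piece is reproduced by convolution with its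
  transform; this gives the Nikol'skii inequalities below.\<close>

definition dyadic_cutoff :: "(real^'n::finite \<Rightarrow> complex) \<Rightarrow> nat \<Rightarrow> real^'n \<Rightarrow> complex" where
  "dyadic_cutoff \<phi>0 j x = \<phi>0 ((2::real) powr (- real (Suc j)) *\<^sub>R x)"

section \<open>Nikol'skii inequalities and embeddings\<close>

context
  fixes \<phi>0 :: "real^'n::finite \<Rightarrow> complex"
  assumes phi0: "admissible_phi0 \<phi>0"
begin

lemma dyadic_fourier_Lp_bound:
  assumes q: "q \<ge> 1"
  obtains K where "K > 0" "\<And>j. Lp_fun_norm q (fourier (dyadic \<phi>0 j)) \<le> ennreal (K * 2 powr (real j * (real CARD('n) * (1 - inv_exp q))))"
proof -
  have "Lp_fun_norm q (fourier f) < \<infinity>" if "f \<in> schwartz" for f :: "real^'n \<Rightarrow> complex"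
    using Lp_fun_norm_schwartz[OF q schwartz_fourier[OF that]] .
  then obtain K where K: "K > 0" "\<And>j. Lp_fun_norm q (fourier (dyadic_base \<phi>0 j)) \<le> ennreal K"
    using dyadic_base_bound[OF phi0, of "\<lambda>f. Lp_fun_norm q (fourier f)"] by blast
  have "Lp_fun_norm q (fourier (dyadic \<phi>0 j)) \<le> ennreal (K * 2 powr (real j * (real CARD('n) * (1 - inv_exp q))))" for j
  proof -
    have "Lp_fun_norm q (fourier (dyadic \<phi>0 j)) \<le> ennreal ((2 powr (- real j)) powr (- real CARD('n) * (1 - inv_exp q))) * Lp_fun_norm q (fourier (dyadic_base \<phi>0 j))"
      unfolding dyadic_eq[abs_def] by (rule Lp_fun_norm_fourier_dilate_le[OF q _ dyadic_base_schwartz[OF phi0]]) simp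
    also have "\<dots> \<le> ennreal ((2 powr (- real j)) powr (- real CARD('n) * (1 - inv_exp q))) * ennreal K"
      by (intro mult_left_mono K) simp
    also have "\<dots> = ennreal (K * 2 powr (real j * (real CARD('n) * (1 - inv_exp q))))"
      using K(1) by (simp add: ennreal_mult[symmetric] powr_powr mult.commute)
    finally show ?thesis .
  qed
  then show ?thesis using that K(1) by blast
qed

text \<open>Each piece is the convolution of the representative with the transform of \<phi>_j. The
  conjugate norm of this kernel grows at most like \<open>2^(j n / p')\<close>, which the weight of
  the target space cancels.\<close>

theorem Lp_embedded_Zygmund:
  assumes p: "p' \<ge> 1"
  shows "maps_boundedly (Lp_space p') (Lp_norm p') (besov \<phi>0 (- real CARD('n) * inv_exp p') \<infinity> \<infinity>)
    (besov_norm \<phi>0 (- real CARD('n) * inv_exp p') \<infinity> \<infinity>) id"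
proof -
  let ?s = "- real CARD('n) * inv_exp p'"
  let ?c = "fourier_const TYPE('n)"
  note c = fourier_const_pos[where 'n='n]
  obtain p where p': "p \<ge> 1" "inv_exp p' + inv_exp p = 1" using conjugate_exponent[OF p] .
  obtain K where K: "K > 0" "\<And>j. Lp_fun_norm p (fourier (dyadic \<phi>0 j)) \<le> ennreal (K * 2 powr (real j * (real CARD('n) * (1 - inv_exp p))))"
    using dyadic_fourier_Lp_bound[OF p'(1)] by blast
  have 1: "1 - inv_exp p = inv_exp p'" using p' by simp
  have bd: "besov_norm \<phi>0 ?s \<infinity> \<infinity> u \<le> ennreal (?c * K) * Lp_norm p' u" for u
  proof (rule le_Lp_normI)
    fix g assume g: "represents g u" "Lp_fun_norm p' g < \<infinity>"
    show "besov_norm \<phi>0 ?s \<infinity> \<infinity> u \<le> ennreal (?c * K) * Lp_fun_norm p' g"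
    proof (rule besov_norm_top_leI)
      fix j
      have "represents (multiplier_kernel (dyadic \<phi>0 j) g) (lp_piece \<phi>0 j u)"
        unfolding lp_piece_def by (rule multiplier_kernel_represents[OF p p' dyadic_schwartz[OF phi0] g])
      then have "Lp_norm \<infinity> (lp_piece \<phi>0 j u) \<le> Lp_fun_norm \<infinity> (multiplier_kernel (dyadic \<phi>0 j) g)" by (rule Lp_norm_le)
      also have "\<dots> \<le> ennreal ?c * (Lp_fun_norm p' g * Lp_fun_norm p (fourier (dyadic \<phi>0 j)))"
        by (rule multiplier_kernel_top_le[OF p p' dyadic_schwartz[OF phi0] representsD(1)[OF g(1)]])
      also have "\<dots> \<le> ennreal ?c * (Lp_fun_norm p' g * ennreal (K * 2 powr (- (real j * ?s))))"
        using K(2)[of j] unfolding 1 by (intro mult_left_mono) auto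
      also have "\<dots> = ennreal (?c * K * 2 powr (- (real j * ?s))) * Lp_fun_norm p' g"
        using c K(1) by (simp add: ennreal_mult mult_ac)
      finally show "Lp_norm \<infinity> (lp_piece \<phi>0 j u) \<le> ennreal (?c * K * 2 powr (- (real j * ?s))) * Lp_fun_norm p' g" .
    qed (use c K in simp)
  qed (use c K in simp)
  have "u \<in> besov \<phi>0 ?s \<infinity> \<infinity>" if u: "u \<in> Lp_space p'" for u
    using u le_less_trans[OF bd[of u]] by (simp add: besov_def Lp_space_def ennreal_mult_less_top)
  then show ?thesis unfolding maps_boundedly_def using bd by auto
qed

lemma dyadic_cutoff_schwartz: "dyadic_cutoff \<phi>0 j \<in> schwartz"
  unfolding dyadic_cutoff_def[abs_def] by (rule schwartz_dil[OF phi0_schwartz[OF phi0]]) simp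

lemma dyadic_support:
  assumes "dyadic \<phi>0 j x \<noteq> 0" shows "norm x < 3/2 * 2 powr real j"
proof (rule ccontr)
  assume n: "\<not> norm x < 3/2 * 2 powr real j"
  define y where "y = (2::real) powr (- real j) *\<^sub>R x"
  have y: "norm y \<ge> 3/2" using n by (simp add: y_def powr_minus field_simps)
  moreover have "norm ((2::real) *\<^sub>R y) \<ge> 3/2" unfolding norm_scaleR using y by simp
  ultimately have "\<phi>0 y = 0" "\<phi>0 (2 *\<^sub>R y) = 0" by (auto intro: phi0_0[OF phi0] simp del: norm_scaleR)
  then have "dyadic_base \<phi>0 j y = 0" by (simp add: dyadic_base_def)
  then have "dyadic \<phi>0 j x = 0" by (simp add: dyadic_eq y_def)
  with assms show False by simp
qed

lemma dyadic_mult_cutoff: "dyadic \<phi>0 j x * dyadic_cutoff \<phi>0 j x = dyadic \<phi>0 j x"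
proof (cases "dyadic \<phi>0 j x = 0")
  case False
  \<comment> \<open>The gap between the support radius \<open>3/2 * 2^j\<close> and the radius
    \<open>2^(j+1)\<close>, inside which the cutoff is 1, is what makes the product formula
    work.\<close>
  from dyadic_support[OF this] have "norm x \<le> 2 * 2 powr real j" using powr_gt_zero[of 2 "real j"] by linarith
  also have "\<dots> = 2 powr real (Suc j)" by (simp add: powr_add)
  finally have "norm ((2::real) powr (- real (Suc j)) *\<^sub>R x) \<le> 1"
    unfolding norm_scaleR powr_minus by (simp add: field_simps)
  from phi0_1[OF phi0 this] show ?thesis by (simp add: dyadic_cutoff_def)
qed simp

lemma lp_piece_cutoff:
  assumes \<psi>: "\<psi> \<in> schwartz"
  shows "lp_piece \<phi>0 j u (fourier (\<lambda>\<xi>. dyadic_cutoff \<phi>0 j \<xi> * inv_fourier \<psi> \<xi>)) = lp_piece \<phi>0 j u \<psi>"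
proof -
  have "(\<lambda>\<xi>. dyadic_cutoff \<phi>0 j \<xi> * inv_fourier \<psi> \<xi>) \<in> schwartz"
    by (intro schwartz_mult dyadic_cutoff_schwartz schwartz_inv_fourier \<psi>)
  then show ?thesis
    by (simp add: lp_piece_def inv_fourier_fourier mult.assoc[symmetric] dyadic_mult_cutoff)
qed

lemma lp_piece_kernel_represents:
  assumes q: "q \<ge> 1" "q' \<ge> 1" "inv_exp q + inv_exp q' = 1"
    and g: "represents g (lp_piece \<phi>0 j u)" "Lp_fun_norm q g < \<infinity>"
  shows "represents (multiplier_kernel (dyadic_cutoff \<phi>0 j) g) (lp_piece \<phi>0 j u)"
  using multiplier_kernel_represents[OF q dyadic_cutoff_schwartz g, of j]
  by (simp add: represents_def lp_piece_cutoff)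

lemma dyadic_cutoff_Lp_bound:
  assumes q: "q \<ge> 1"
  obtains K where "K > 0" "\<And>j. Lp_fun_norm q (fourier (dyadic_cutoff \<phi>0 j)) \<le> ennreal (K * 2 powr (real j * (real CARD('n) * (1 - inv_exp q))))"
proof -
  note s = phi0_schwartz[OF phi0]
  obtain k where k: "Lp_fun_norm q (fourier \<phi>0) = ennreal k" "k \<ge> 0"
    using Lp_fun_norm_schwartz[OF q schwartz_fourier[OF s]] by (cases "Lp_fun_norm q (fourier \<phi>0)") auto
  let ?e = "real CARD('n) * (1 - inv_exp q)"
  \<comment> \<open>The cutoff lives at scale \<open>2^(j+1)\<close> rather than \<open>2^j\<close>;
    the factor \<open>2 powr ?e\<close> absorbs this shift, and the summand 1 makes \<open>K\<close>
    positive.\<close>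
  define K where "K = (k + 1) * 2 powr ?e"
  have "Lp_fun_norm q (fourier (dyadic_cutoff \<phi>0 j)) \<le> ennreal (K * 2 powr (real j * ?e))" for j
  proof -
    have "Lp_fun_norm q (fourier (dyadic_cutoff \<phi>0 j)) \<le> ennreal ((2 powr (- real (Suc j))) powr (- real CARD('n) * (1 - inv_exp q))) * Lp_fun_norm q (fourier \<phi>0)"
      unfolding dyadic_cutoff_def[abs_def] by (rule Lp_fun_norm_fourier_dilate_le[OF q _ s]) simp
    also have "\<dots> = ennreal (2 powr (real (Suc j) * ?e)) * ennreal k"
      unfolding k powr_powr by (simp only: mult_minus_left mult_minus_right minus_minus mult.assoc)
    also have "\<dots> = ennreal (2 powr (real (Suc j) * ?e) * k)" using k by (simp add: ennreal_mult)
    also have "\<dots> \<le> ennreal (K * 2 powr (real j * ?e))"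
    proof (rule ennreal_leI)
      have "2 powr (real (Suc j) * ?e) = 2 powr ?e * 2 powr (real j * ?e)"
        by (simp add: powr_add[symmetric] algebra_simps)
      then show "2 powr (real (Suc j) * ?e) * k \<le> K * 2 powr (real j * ?e)"
        by (simp add: K_def algebra_simps)
    qed
    finally show ?thesis .
  qed
  then show ?thesis using that[of K] k by (simp add: K_def add_nonneg_pos)
qed

text \<open>An arbitrary representative \<open>g\<close> of the piece is exchanged for its
  convolution with the cutoff kernel, which represents the same distribution. Hoelder's inequality
  bounds it by the conjugate norm of the kernel, and that norm carries the power of 2.\<close>

lemma nikolskii_top:
  assumes q: "q \<ge> 1"
  obtains C where "C > 0" "\<And>j u. Lp_norm \<infinity> (lp_piece \<phi>0 j u) \<le> ennreal (C * 2 powr (real j * (real CARD('n) * inv_exp q))) * Lp_norm q (lp_piece \<phi>0 j u)"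
proof -
  let ?c = "fourier_const TYPE('n)"
  note c = fourier_const_pos[where 'n='n]
  obtain q' where q': "q' \<ge> 1" "inv_exp q + inv_exp q' = 1" using conjugate_exponent[OF q] .
  obtain K where K: "K > 0" "\<And>j. Lp_fun_norm q' (fourier (dyadic_cutoff \<phi>0 j)) \<le> ennreal (K * 2 powr (real j * (real CARD('n) * (1 - inv_exp q'))))"
    using dyadic_cutoff_Lp_bound[OF q'(1)] by blast
  have 1: "1 - inv_exp q' = inv_exp q" using q' by simp
  have "Lp_norm \<infinity> (lp_piece \<phi>0 j u) \<le> ennreal ((?c * K) * 2 powr (real j * (real CARD('n) * inv_exp q))) * Lp_norm q (lp_piece \<phi>0 j u)" for j u
  proof (rule le_Lp_normI)
    fix g assume g: "represents g (lp_piece \<phi>0 j u)" "Lp_fun_norm q g < \<infinity>"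
    have "Lp_norm \<infinity> (lp_piece \<phi>0 j u) \<le> Lp_fun_norm \<infinity> (multiplier_kernel (dyadic_cutoff \<phi>0 j) g)"
      by (rule Lp_norm_le[OF lp_piece_kernel_represents[OF q q' g]])
    also have "\<dots> \<le> ennreal ?c * (Lp_fun_norm q g * Lp_fun_norm q' (fourier (dyadic_cutoff \<phi>0 j)))"
      by (rule multiplier_kernel_top_le[OF q q' dyadic_cutoff_schwartz representsD(1)[OF g(1)]])
    also have "\<dots> \<le> ennreal ?c * (Lp_fun_norm q g * ennreal (K * 2 powr (real j * (real CARD('n) * inv_exp q))))"
      using K(2)[of j] unfolding 1 by (intro mult_left_mono) auto
    also have "\<dots> = ennreal ((?c * K) * 2 powr (real j * (real CARD('n) * inv_exp q))) * Lp_fun_norm q g"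
      using c K(1) by (simp add: ennreal_mult mult_ac)
    finally show "Lp_norm \<infinity> (lp_piece \<phi>0 j u) \<le> ennreal ((?c * K) * 2 powr (real j * (real CARD('n) * inv_exp q))) * Lp_fun_norm q g" .
  qed (use c K in simp)
  then show ?thesis using that[of "?c * K"] c K by simp
qed

text \<open>Convolution with the cutoff kernel costs \<open>2^(j n / 2)\<close> from
  \<open>L_2\<close> to the bounded functions and a constant from \<open>L_2\<close> to itself.
  Interpolation with weights \<open>1 - 2/r\<close> and \<open>2/r\<close> leaves
  \<open>2^(j n (1/2 - 1/r))\<close>.\<close>

lemma nikolskii_2:
  assumes p: "2 < p"
  obtains C where "C > 0" "\<And>j u. Lp_norm p (lp_piece \<phi>0 j u) \<le> ennreal (C * 2 powr (real j * (real CARD('n) * (1/2 - inv_exp p)))) * Lp_norm 2 (lp_piece \<phi>0 j u)"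
proof -
  have two: "(2::ennreal) \<ge> 1" "inv_exp 2 + inv_exp 2 = 1" by (auto simp: inv_exp_2)
  have p1: "p \<ge> 1" using p two(1) by (meson less_imp_le order_trans)
  show ?thesis using p1
  proof (cases p rule: ennreal_ge_1_cases)
    case 1
    then show ?thesis using nikolskii_top[OF two(1)] that by (auto simp: inv_exp_2)
  next
    case (2 r)
    then have r: "r > 2" using p by (metis ennreal_less_iff ennreal_numeral zero_le_numeral)
    let ?c = "fourier_const TYPE('n)"
    note c = fourier_const_pos[where 'n='n]
    obtain A where A: "A > 0" "\<And>j. Lp_fun_norm 2 (fourier (dyadic_cutoff \<phi>0 j)) \<le> ennreal (A * 2 powr (real j * (real CARD('n) * (1 - inv_exp 2))))"
      using dyadic_cutoff_Lp_bound[OF two(1)] by blast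
    obtain B where B: "B > 0" "\<And>j. Lp_fun_norm 1 (fourier (dyadic_cutoff \<phi>0 j)) \<le> ennreal (B * 2 powr (real j * (real CARD('n) * (1 - inv_exp 1))))"
      using dyadic_cutoff_Lp_bound[of 1] by blast
    define C where "C = (?c * A) powr (1 - 2/r) * (?c * B) powr (2/r)"
    have C: "C > 0" using c A B by (simp add: C_def)
    have "Lp_norm p (lp_piece \<phi>0 j u) \<le> ennreal (C * 2 powr (real j * (real CARD('n) * (1/2 - inv_exp p)))) * Lp_norm 2 (lp_piece \<phi>0 j u)" for j u
    proof (rule le_Lp_normI)
      fix g assume g: "represents g (lp_piece \<phi>0 j u)" "Lp_fun_norm 2 g < \<infinity>"
      let ?h = "multiplier_kernel (dyadic_cutoff \<phi>0 j) g"
      note gm = representsD(1)[OF g(1)]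
      obtain \<gamma> where \<gamma>: "Lp_fun_norm 2 g = ennreal \<gamma>" "\<gamma> \<ge> 0" using g(2) by (cases "Lp_fun_norm 2 g") auto
      let ?t = "2 powr (real j * (real CARD('n) / 2))"
      have "Lp_fun_norm \<infinity> ?h \<le> ennreal ?c * (Lp_fun_norm 2 g * Lp_fun_norm 2 (fourier (dyadic_cutoff \<phi>0 j)))"
        by (rule multiplier_kernel_top_le[OF two(1) two(1) two(2) dyadic_cutoff_schwartz gm])
      also have "\<dots> \<le> ennreal ?c * (ennreal \<gamma> * ennreal (A * ?t))"
        unfolding \<gamma> using A(2)[of j] by (intro mult_left_mono) (auto simp: inv_exp_2)
      also have "\<dots> = ennreal (?c * A * ?t * \<gamma>)" using \<gamma> c A(1) by (simp add: ennreal_mult[symmetric] mult_ac)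
      finally have top: "Lp_fun_norm \<infinity> ?h \<le> ennreal (?c * A * ?t * \<gamma>)" .
      have "Lp_fun_norm 2 ?h \<le> ennreal ?c * (Lp_fun_norm 1 (fourier (dyadic_cutoff \<phi>0 j)) * Lp_fun_norm 2 g)"
        by (rule multiplier_kernel_2_le[OF dyadic_cutoff_schwartz gm])
      also have "\<dots> \<le> ennreal ?c * (ennreal B * ennreal \<gamma>)"
        unfolding \<gamma> using B(2)[of j] by (intro mult_left_mono mult_right_mono) (auto simp: inv_exp_def)
      also have "\<dots> = ennreal (?c * B * \<gamma>)" using \<gamma> c B(1) by (simp add: ennreal_mult[symmetric] mult_ac)
      finally have l2: "Lp_fun_norm 2 ?h \<le> ennreal (?c * B * \<gamma>)" .
      have "Lp_norm p (lp_piece \<phi>0 j u) \<le> Lp_fun_norm p ?h"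
        by (rule Lp_norm_le[OF lp_piece_kernel_represents[OF two(1) two(1) two(2) g]])
      also have "\<dots> \<le> ennreal ((?c * A * ?t * \<gamma>) powr (1 - 2/r)) * epow (Lp_fun_norm 2 ?h) (2/r)"
        unfolding 2 using c A \<gamma> by (intro Lp_fun_norm_interpolate[OF r multiplier_kernel_measurable[OF dyadic_cutoff_schwartz gm] top]) auto
      also have "\<dots> \<le> ennreal ((?c * A * ?t * \<gamma>) powr (1 - 2/r)) * epow (ennreal (?c * B * \<gamma>)) (2/r)"
        using r by (intro mult_left_mono epow_mono l2) auto
      also have "\<dots> = ennreal ((?c * A * ?t * \<gamma>) powr (1 - 2/r) * (?c * B * \<gamma>) powr (2/r))"
        using c B \<gamma> by (subst epow_ennreal) (auto simp: ennreal_mult)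
      also have "(?c * A * ?t * \<gamma>) powr (1 - 2/r) * (?c * B * \<gamma>) powr (2/r) = C * ?t powr (1 - 2/r) * (\<gamma> powr (1 - 2/r) * \<gamma> powr (2/r))"
        using c A B \<gamma> by (simp add: C_def powr_mult mult_ac)
      \<comment> \<open>The weights add up to 1, so the bound is linear in the norm of
        \<open>g\<close>.\<close>
      also have "\<gamma> powr (1 - 2/r) * \<gamma> powr (2/r) = \<gamma>" using \<gamma> by (simp add: powr_add[symmetric])
      also have "?t powr (1 - 2/r) = 2 powr (real j * (real CARD('n) * (1/2 - inv_exp p)))"
      proof -
        have "real j * (real CARD('n) / 2) * (1 - 2/r) = real j * (real CARD('n) * (1/2 - inv_exp p))"
          unfolding 2 using r by (simp add: inv_exp_ennreal field_simps)
        then show ?thesis unfolding powr_powr by (rule arg_cong)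
      qed
      finally show "Lp_norm p (lp_piece \<phi>0 j u) \<le> ennreal (C * 2 powr (real j * (real CARD('n) * (1/2 - inv_exp p)))) * Lp_fun_norm 2 g"
        using C \<gamma> by (simp add: ennreal_mult)
    qed (use C in simp)
    then show ?thesis using that C by blast
  qed
qed

text \<open>Passing from \<open>L_2\<close> to \<open>L_p\<close> costs smoothness
  \<open>n (1/2 - 1/p)\<close>. The source already has minus this number as its smoothness, which
  explains the factor 2 in the target exponent.\<close>

theorem besov_2_p_embedded_p_p:
  assumes p: "2 < p"
  shows "maps_boundedly (besov \<phi>0 (- real CARD('n) * (1/2 - inv_exp p)) 2 p) (besov_norm \<phi>0 (- real CARD('n) * (1/2 - inv_exp p)) 2 p)
    (besov \<phi>0 (2 * real CARD('n) * (inv_exp p - 1/2)) p p) (besov_norm \<phi>0 (2 * real CARD('n) * (inv_exp p - 1/2)) p p) id"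
proof -
  obtain C where C: "C > 0" "\<And>j u. Lp_norm p (lp_piece \<phi>0 j u) \<le> ennreal (C * 2 powr (real j * (real CARD('n) * (1/2 - inv_exp p)))) * Lp_norm 2 (lp_piece \<phi>0 j u)"
    using nikolskii_2[OF p] by blast
  have e: "- real CARD('n) * (1/2 - inv_exp p) - 2 * real CARD('n) * (inv_exp p - 1/2) = real CARD('n) * (1/2 - inv_exp p)"
    by (simp add: algebra_simps)
  have "p \<ge> 1" using p by (meson less_imp_le one_le_numeral order_trans)
  then show ?thesis
    by (intro maps_boundedly_besov_id[OF C(1)] besov_norm_le_pieces C(1)) (assumption, subst e, rule C(2))
qed

text \<open>The two smoothness exponents differ by exactly \<open>n/p\<close>, the cost of passing
  from \<open>L_p\<close> to bounded pieces; afterwards the sum over the pieces is weakened to a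
  supremum.\<close>

theorem besov_p_p_embedded_Zygmund:
  assumes p: "p \<ge> 1" "inv_exp p + inv_exp p' = 1"
  shows "maps_boundedly (besov \<phi>0 (2 * real CARD('n) * (inv_exp p - 1/2)) p p) (besov_norm \<phi>0 (2 * real CARD('n) * (inv_exp p - 1/2)) p p)
    (besov \<phi>0 (- real CARD('n) * inv_exp p') \<infinity> \<infinity>) (besov_norm \<phi>0 (- real CARD('n) * inv_exp p') \<infinity> \<infinity>) id"
proof -
  let ?t = "2 * real CARD('n) * (inv_exp p - 1/2)" and ?s = "- real CARD('n) * inv_exp p'"
  obtain C where C: "C > 0" "\<And>j u. Lp_norm \<infinity> (lp_piece \<phi>0 j u) \<le> ennreal (C * 2 powr (real j * (real CARD('n) * inv_exp p))) * Lp_norm p (lp_piece \<phi>0 j u)"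
    using nikolskii_top[OF p(1)] by blast
  have "inv_exp p' = 1 - inv_exp p" using p(2) by simp
  then have e: "?t - ?s = real CARD('n) * inv_exp p" by (simp only:) (simp add: algebra_simps)
  have "besov_norm \<phi>0 ?s \<infinity> \<infinity> u \<le> ennreal C * besov_norm \<phi>0 ?t p p u" for u
  proof -
    have "besov_norm \<phi>0 ?s \<infinity> \<infinity> u \<le> ennreal C * besov_norm \<phi>0 ?t p \<infinity> u"
      by (rule besov_norm_le_pieces[OF _ C(1)]) (simp, subst e, rule C(2))
    also have "\<dots> \<le> ennreal C * besov_norm \<phi>0 ?t p p u" by (intro mult_left_mono besov_norm_top_le p) simp
    finally show ?thesis .
  qed
  then show ?thesis by (rule maps_boundedly_besov_id[OF C(1)])
qed

end

section \<open>Mapping properties of the Fourier transform\<close>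

lemma conjugate_exponent_finite:
  assumes "p' \<ge> 1" "1 / r + inv_exp p' = 1" "1 < r"
  obtains s where "p' = ennreal s" "s \<ge> 1" "1 / r + 1 / s = 1"
  using assms(1)
proof (cases p' rule: ennreal_ge_1_cases)
  case 1
  then show ?thesis using assms by simp
next
  case (2 s)
  then show ?thesis using that[of s] assms by (simp add: inv_exp_ennreal)
qed

text \<open>For \<open>p = 1\<close> the conjugate exponent is infinite and the pointwise transform
  is itself the representative. The remaining cases have two real exponents and come from
  \<open>hausdorff_young\<close>.\<close>

lemma hausdorff_young_dist:
  assumes p: "p \<ge> 1" "p' \<ge> 1" "inv_exp p + inv_exp p' = 1" and p2: "p \<le> 2"
  obtains C where "C > 0" "\<And>u (f :: real^'n::finite \<Rightarrow> complex). represents f u \<Longrightarrow> Lp_fun_norm p f < \<infinity> \<Longrightarrow>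
    \<exists>g. represents g (fourier_dist u) \<and> Lp_fun_norm p' g \<le> ennreal C * Lp_fun_norm p f"
  using p(1)
proof (cases p rule: ennreal_ge_1_cases)
  case 1
  then show ?thesis using p2 by (simp add: top_unique)
next
  case (2 r)
  show ?thesis
  proof (cases "r = 1")
    case True
    then have p1: "p = 1" using 2 by simp
    have "inv_exp p' = 0" using p(3) 2 True by (simp add: inv_exp_def)
    then have p': "p' = \<infinity>" using p(2) inv_exp_eq_0 by blast
    have "\<exists>g. represents g (fourier_dist u) \<and> Lp_fun_norm p' g \<le> ennreal (fourier_const TYPE('n)) * Lp_fun_norm p f"
      if f: "represents f u" "Lp_fun_norm p f < \<infinity>" for u and f :: "real^'n \<Rightarrow> complex"
    proof (intro exI[of _ "fourier f"] conjI)
      have i: "integrable lborel f"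
        using f(2) representsD(1)[OF f(1)] by (auto simp: integrable_iff_bounded p1 Lp_fun_norm_1)
      show "Lp_fun_norm p' (fourier f) \<le> ennreal (fourier_const TYPE('n)) * Lp_fun_norm p f"
        using Lp_fun_norm_top_fourier[OF i] by (simp add: p1 p' Lp_fun_norm_1)
      show "represents (fourier f) (fourier_dist u)"
        unfolding represents_def
      proof (intro conjI ballI)
        fix \<psi> :: "real^'n \<Rightarrow> complex" assume \<psi>: "\<psi> \<in> schwartz"
        show "integrable lborel (\<lambda>x. fourier f x * \<psi> x)" by (rule integrable_fourier_mult[OF i schwartz_integrable[OF \<psi>]])
        show "fourier_dist u \<psi> = (LINT x|lborel. fourier f x * \<psi> x)"
          using representsD(3)[OF f(1) schwartz_fourier[OF \<psi>]]
          by (simp add: fourier_dist_def fourier_multiplication_formula[OF i schwartz_integrable[OF \<psi>]])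
      qed (use fourier_measurable[OF i] in simp)
    qed
    then show ?thesis using that fourier_const_pos[where 'n='n] by blast
  next
    case False
    then have r: "1 < r" "r \<le> 2" using 2 p2 by (auto simp: ennreal_le_iff2 simp flip: ennreal_numeral)
    obtain s where s: "p' = ennreal s" "s \<ge> 1" "1 / r + 1 / s = 1"
      using conjugate_exponent_finite[OF p(2) _ r(1)] p(3) 2 by (auto simp: inv_exp_ennreal)
    obtain C where C: "C > 0" "\<And>f :: real^'n \<Rightarrow> complex. f \<in> borel_measurable borel \<Longrightarrow> Lp_fun_norm (ennreal r) f < \<infinity> \<Longrightarrow>
      \<exists>g. represents g (\<lambda>\<psi>. LINT x|lborel. f x * fourier \<psi> x) \<and> Lp_fun_norm (ennreal s) g \<le> ennreal C * Lp_fun_norm (ennreal r) f"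
      using hausdorff_young[OF r s(3), where 'n='n] by blast
    have "\<exists>g. represents g (fourier_dist u) \<and> Lp_fun_norm p' g \<le> ennreal C * Lp_fun_norm p f"
      if f: "represents f u" "Lp_fun_norm p f < \<infinity>" for u and f :: "real^'n \<Rightarrow> complex"
    proof -
      obtain g where g: "represents g (\<lambda>\<psi>. LINT x|lborel. f x * fourier \<psi> x)" "Lp_fun_norm p' g \<le> ennreal C * Lp_fun_norm p f"
        using C(2)[OF representsD(1)[OF f(1)]] f(2) 2 s by blast
      have "represents g (fourier_dist u)"
        using g(1) representsD(3)[OF f(1) schwartz_fourier] by (simp add: represents_def fourier_dist_def)
      then show ?thesis using g(2) by blast
    qed
    then show ?thesis using that C(1) by blast
  qed
qed

theorem fourier_Lp_to_conjugate_Lp: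
  assumes p: "p \<ge> 1" "p' \<ge> 1" "inv_exp p + inv_exp p' = 1" and p2: "p \<le> 2"
  shows "maps_boundedly (Lp_space p) (Lp_norm p) (Lp_space p') (Lp_norm p')
    (fourier_dist :: ((real^'n::finite \<Rightarrow> complex) \<Rightarrow> complex) \<Rightarrow> _)"
proof -
  obtain C where C: "C > 0" "\<And>u (f :: real^'n \<Rightarrow> complex). represents f u \<Longrightarrow> Lp_fun_norm p f < \<infinity> \<Longrightarrow>
    \<exists>g. represents g (fourier_dist u) \<and> Lp_fun_norm p' g \<le> ennreal C * Lp_fun_norm p f"
    using hausdorff_young_dist[OF p p2, where 'n='n] by blast
  have bd: "Lp_norm p' (fourier_dist u) \<le> ennreal C * Lp_norm p u" for u :: "(real^'n \<Rightarrow> complex) \<Rightarrow> complex"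
    by (rule le_Lp_normI[OF C(1)]) (use C(2) Lp_norm_le in \<open>blast intro: order_trans\<close>)
  show ?thesis by (rule maps_boundedly_fourier_distI[OF p _ bd]) (simp add: Lp_space_def)
qed

text \<open>Concrete integrable functions enter the space of distributions here; the sequence that
  refutes compactness consists of such functions.\<close>

lemma integral_dist_represents:
  fixes F :: "real^'n::finite \<Rightarrow> complex"
  assumes F: "integrable lborel F"
  shows "represents F (\<lambda>\<psi>. LINT x|lborel. F x * \<psi> x)" "(\<lambda>\<psi>. LINT x|lborel. F x * \<psi> x) \<in> tempered"
proof -
  have [measurable]: "F \<in> borel_measurable borel" using F by auto
  have int: "integrable lborel (\<lambda>x. F x * \<psi> x)" and bd: "norm (LINT x|lborel. F x * \<psi> x) \<le> (LINT x|lborel. norm (F x)) * schwartz_seminorm 0 0 \<psi>"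
    if \<psi>: "\<psi> \<in> schwartz" for \<psi>
  proof -
    note [measurable] = schwartz_measurable[OF \<psi>]
    have b: "norm (\<psi> x) \<le> schwartz_seminorm 0 0 \<psi>" for x
      using schwartz_seminorm_upper[OF \<psi>, of "[]" 0 x 0] by simp
    have le: "norm (F x * \<psi> x) \<le> norm (F x) * schwartz_seminorm 0 0 \<psi>" for x
      unfolding norm_mult by (intro mult_left_mono b) simp
    have iF: "integrable lborel (\<lambda>x. norm (F x) * schwartz_seminorm 0 0 \<psi>)" by (intro integrable_mult_left integrable_norm F)
    show int: "integrable lborel (\<lambda>x. F x * \<psi> x)"
    proof (rule Bochner_Integration.integrable_bound[OF iF])
      show "AE x in lborel. norm (F x * \<psi> x) \<le> norm (norm (F x) * schwartz_seminorm 0 0 \<psi>)"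
        using le by (intro AE_I2) (metis abs_ge_self order_trans real_norm_def)
    qed measurable
    have "norm (LINT x|lborel. F x * \<psi> x) \<le> (LINT x|lborel. norm (F x * \<psi> x))" by (rule integral_norm_bound)
    also have "\<dots> \<le> (LINT x|lborel. norm (F x) * schwartz_seminorm 0 0 \<psi>)"
      by (intro integral_mono integrable_norm int iF le)
    finally show "norm (LINT x|lborel. F x * \<psi> x) \<le> (LINT x|lborel. norm (F x)) * schwartz_seminorm 0 0 \<psi>" by simp
  qed
  show "represents F (\<lambda>\<psi>. LINT x|lborel. F x * \<psi> x)" unfolding represents_def using int by auto
  have "\<exists>C k m. \<forall>\<psi>\<in>schwartz. norm (LINT x|lborel. F x * \<psi> x) \<le> C * schwartz_seminorm k m \<psi>" using bd by blast
  then show "(\<lambda>\<psi>. LINT x|lborel. F x * \<psi> x) \<in> tempered"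
    unfolding tempered_def using int by (auto simp: distrib_left mult.left_commute[of "F _"])
qed

text \<open>On \<open>2^k\<close> times this set \<open>\<phi>\<^sub>k = 1\<close> and all other \<open>\<phi>\<^sub>j\<close> vanish.\<close>

definition annulus :: "(real^'n::finite) set" where
  "annulus = {x. 3/4 < norm x \<and> norm x < 1}"

lemma annulus_open: "open annulus"
  unfolding annulus_def by (intro open_Collect_conj open_Collect_less continuous_intros)

lemma annulus_measurable[measurable]: "annulus \<in> sets borel"
  by (rule borel_open[OF annulus_open])

lemma emeasure_annulus_finite: "emeasure lborel (annulus :: (real^'n::finite) set) < \<infinity>"
proof -
  have "emeasure lborel (annulus :: (real^'n) set) \<le> emeasure lborel (ball 0 1 :: (real^'n) set)"
    by (intro emeasure_mono) (auto simp: annulus_def)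
  then show ?thesis using emeasure_lborel_ball_finite le_less_trans by blast
qed

lemma measure_annulus_pos: "measure lborel (annulus :: (real^'n::finite) set) > 0"
proof -
  have "(7/8) *\<^sub>R axis (undefined::'n) (1::real) \<in> annulus" by (simp add: annulus_def)
  then have "(annulus :: (real^'n) set) \<noteq> {}" by blast
  then have "\<not> negligible (annulus :: (real^'n) set)" using open_not_negligible annulus_open by blast
  then have "(annulus :: (real^'n) set) \<notin> null_sets lborel"
    using null_sets_completionI negligible_iff_null_sets by blast
  then have "emeasure lborel (annulus :: (real^'n) set) \<noteq> 0" by (auto simp: null_sets_def)
  then show ?thesis using emeasure_annulus_finite[where 'n='n]
    by (simp add: measure_def enn2real_positive_iff zero_less_iff_neq_zero)
qed

lemma integrable_annulus: "integrable lborel (indicator annulus :: real^'n::finite \<Rightarrow> complex)"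
  and integral_annulus: "(LINT x|lborel. indicator annulus (x::real^'n) :: complex) = of_real (measure lborel (annulus :: (real^'n) set))"
proof -
  show "integrable lborel (indicator annulus :: real^'n \<Rightarrow> complex)"
    using emeasure_annulus_finite[where 'n='n] by (intro integrable_complex_indicator) auto
  have "(LINT x|lborel. complex_of_real (indicator annulus (x::real^'n))) = of_real (LINT x|lborel. indicator annulus (x::real^'n))"
    by (rule integral_complex_of_real)
  then show "(LINT x|lborel. indicator annulus (x::real^'n) :: complex) = of_real (measure lborel (annulus :: (real^'n) set))"
    by (simp add: of_real_indicator)
qed

section \<open>Bounded overlap, exponents above 2, and failure of compactness\<close>

context
  fixes \<phi>0 :: "real^'n::finite \<Rightarrow> complex"
  assumes phi0: "admissible_phi0 \<phi>0"
begin

lemma dyadic_support_lower: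
  assumes "dyadic \<phi>0 j x \<noteq> 0" "j \<ge> 1" shows "2 powr (real j - 1) < norm x"
proof (rule ccontr)
  assume n: "\<not> 2 powr (real j - 1) < norm x"
  define y where "y = (2::real) powr (- real j) *\<^sub>R x"
  have "norm y \<le> 1/2" using n by (simp add: y_def powr_minus powr_diff field_simps)
  moreover have "norm ((2::real) *\<^sub>R y) \<le> 1" unfolding norm_scaleR using calculation by simp
  ultimately have "\<phi>0 y = 1" "\<phi>0 (2 *\<^sub>R y) = 1" by (auto intro: phi0_1[OF phi0] simp del: norm_scaleR)
  then have "dyadic_base \<phi>0 j y = 0" using assms(2) by (simp add: dyadic_base_def)
  then have "dyadic \<phi>0 j x = 0" by (simp add: dyadic_eq y_def)
  with assms show False by simp
qed

lemma dyadic_overlap: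
  assumes "dyadic \<phi>0 j x \<noteq> 0" "dyadic \<phi>0 k x \<noteq> 0" shows "k \<le> Suc j"
proof (rule ccontr)
  assume "\<not> k \<le> Suc j"
  then have k: "k \<ge> 1" "real j + 1 \<le> real k - 1" by auto
  have "2 powr (real j + 1) \<le> 2 powr (real k - 1)" using k by (intro powr_mono) auto
  also have "\<dots> < norm x" using dyadic_support_lower[OF assms(2) k(1)] .
  also have "\<dots> < 3/2 * 2 powr real j" using dyadic_support[OF phi0 assms(1)] .
  finally show False by (simp add: powr_add)
qed

lemma dyadic_bounded: obtains M where "M \<ge> 0" "\<And>j x. norm (dyadic \<phi>0 j x) \<le> M"
proof -
  obtain B where B: "B \<ge> 0" "\<And>x. norm (\<phi>0 x) \<le> B" using schwartz_bounded[OF phi0_schwartz[OF phi0]] by blast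
  have "norm (dyadic_base \<phi>0 j x) \<le> 2 * B" for j x
  proof -
    have "norm (\<phi>0 x) \<le> 2 * B" using B(2)[of x] B(1) by linarith
    moreover have "norm (\<phi>0 x - \<phi>0 (2 *\<^sub>R x)) \<le> 2 * B"
      using norm_triangle_ineq4[of "\<phi>0 x" "\<phi>0 (2 *\<^sub>R x)"] B(2)[of x] B(2)[of "2 *\<^sub>R x"] by linarith
    ultimately show ?thesis by (simp add: dyadic_base_def)
  qed
  then show ?thesis using that[of "2 * B"] B(1) by (auto simp: dyadic_eq)
qed

text \<open>If \<open>l\<close> is the least index active at \<open>x\<close>, only \<open>l\<close>
  and \<open>l + 1\<close> can be active, because supports two or more scales apart are disjoint.
  Hence at most two summands differ from 0.\<close>

lemma dyadic_powr_sum_bound: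
  assumes a: "a > 0"
  obtains M where "M > 0" "\<And>x. (\<Sum>j. ennreal (norm (dyadic \<phi>0 j x) powr a)) \<le> ennreal M"
proof -
  obtain B where B: "B \<ge> 0" "\<And>j x. norm (dyadic \<phi>0 j x) \<le> B" using dyadic_bounded by blast
  have "(\<Sum>j. ennreal (norm (dyadic \<phi>0 j x) powr a)) \<le> ennreal (2 * B powr a + 1)" for x
  proof (cases "\<exists>j. dyadic \<phi>0 j x \<noteq> 0")
    case True
    define l where "l = (LEAST j. dyadic \<phi>0 j x \<noteq> 0)"
    have l: "dyadic \<phi>0 l x \<noteq> 0" unfolding l_def using LeastI_ex[OF True] .
    have z: "dyadic \<phi>0 j x = 0" if "j \<notin> {l, Suc l}" for j
    proof (rule ccontr)
      assume j: "dyadic \<phi>0 j x \<noteq> 0"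
      have "l \<le> j" unfolding l_def by (rule Least_le) (rule j)
      moreover have "j \<le> Suc l" by (rule dyadic_overlap[OF l j])
      ultimately show False using that by auto
    qed
    have "(\<Sum>j. ennreal (norm (dyadic \<phi>0 j x) powr a)) = (\<Sum>j\<in>{l, Suc l}. ennreal (norm (dyadic \<phi>0 j x) powr a))"
      by (rule suminf_finite) (auto simp: z)
    also have "\<dots> \<le> (\<Sum>j\<in>{l, Suc l}. ennreal (B powr a))"
      using a B by (intro sum_mono ennreal_leI powr_mono2) auto
    also have "\<dots> = ennreal (2 * B powr a)" by (simp add: ennreal_mult)
    also have "\<dots> \<le> ennreal (2 * B powr a + 1)" by (rule ennreal_leI) simp
    finally show ?thesis .
  next
    case False
    then show ?thesis by simp
  qed
  moreover have "2 * B powr a + 1 > 0" by (intro add_nonneg_pos) auto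
  ultimately show ?thesis using that by blast
qed

text \<open>For finite \<open>p\<close>, Hoelder with exponent \<open>p/2\<close> is applied to \<open>|f \<phi>\<^sub>j|\<^sup>2 = (|f|\<^sup>2 |\<phi>\<^sub>j|) \<cdot> |\<phi>\<^sub>j|\<close>: the second factor
  produces the power of \<open>2\<close>, and the first one is summable in \<open>j\<close> by bounded overlap.\<close>

theorem fourier_Lp_to_besov_2_p:
  assumes p: "2 < p" "p' \<ge> 1" "inv_exp p + inv_exp p' = 1"
  shows "maps_boundedly (Lp_space p) (Lp_norm p) (besov \<phi>0 (- real CARD('n) * (1/2 - inv_exp p)) 2 p)
    (besov_norm \<phi>0 (- real CARD('n) * (1/2 - inv_exp p)) 2 p) fourier_dist"
proof -
  let ?s = "- real CARD('n) * (1/2 - inv_exp p)"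
  have p1: "p \<ge> 1" using p(1) by (meson less_imp_le one_le_numeral order_trans)
  have piece: "Lp_norm 2 (lp_piece \<phi>0 j (fourier_dist u)) \<le> Lp_fun_norm 2 (\<lambda>x. f x * dyadic \<phi>0 j (- x))"
    if f: "represents f u" "Lp_fun_norm p f < \<infinity>" for f u j
  proof -
    let ?h = "\<lambda>x. f x * dyadic \<phi>0 j (- x)"
    have i: "integrable lborel ?h"
      by (rule lp_piece_fourier_dist_integrable[OF phi0 p1 p(2,3)]) (use f representsD in auto)
    have "Lp_norm 2 (lp_piece \<phi>0 j (fourier_dist u)) \<le> Lp_fun_norm 2 (fourier ?h)"
      by (rule Lp_norm_le[OF lp_piece_fourier_dist_represents[OF phi0 f(1) i]])
    also have "\<dots> \<le> Lp_fun_norm 2 ?h" unfolding Lp_fun_norm_2 by (intro epow_mono plancherel_le i) simp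
    finally show ?thesis .
  qed
  have "\<exists>C>0. \<forall>u. besov_norm \<phi>0 ?s 2 p (fourier_dist u) \<le> ennreal C * Lp_norm p u"
    using p1
  proof (cases p rule: ennreal_ge_1_cases)
    case 1
    \<comment> \<open>For bounded \<open>f\<close> no Hoelder exponent is involved: \<open>f\<close>
      is replaced by its essential bound, and the \<open>L_2\<close> norm of \<phi>_j supplies the
      growth \<open>2^(j n / 2)\<close>.\<close>
    obtain K where K: "K > 0" "\<And>j. Lp_fun_norm 2 (\<lambda>x. dyadic \<phi>0 j (- x)) \<le> ennreal (K * 2 powr (real j * (real CARD('n) * inv_exp 2)))"
      using dyadic_Lp_bound[OF phi0, of 2] by auto
    have "besov_norm \<phi>0 ?s 2 p (fourier_dist u) \<le> ennreal K * Lp_norm p u" for u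
    proof (rule le_Lp_normI[OF K(1)])
      fix f assume f: "represents f u" "Lp_fun_norm p f < \<infinity>"
      note [measurable] = representsD(1)[OF f(1)] schwartz_measurable[OF schwartz_reflect[OF dyadic_schwartz[OF phi0]]]
      obtain a where a: "Lp_fun_norm p f = ennreal a" "a \<ge> 0" using f(2) by (cases "Lp_fun_norm p f") auto
      have le: "AE x in lborel. norm (f x) \<le> a"
        using Lp_fun_norm_top_AE[of f] by eventually_elim (use a 1 in \<open>simp add: ennreal_le_iff\<close>)
      show "besov_norm \<phi>0 ?s 2 p (fourier_dist u) \<le> ennreal K * Lp_fun_norm p f"
        unfolding 1
      proof (rule besov_norm_top_leI[OF K(1)])
        fix j
        have "Lp_norm 2 (lp_piece \<phi>0 j (fourier_dist u)) \<le> Lp_fun_norm 2 (\<lambda>x. f x * dyadic \<phi>0 j (- x))" by (rule piece[OF f])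
        also have "\<dots> \<le> Lp_fun_norm 2 (\<lambda>x. of_real a * dyadic \<phi>0 j (- x))"
          by (rule Lp_fun_norm_mono) (simp, use le in eventually_elim, use a in \<open>auto simp: norm_mult intro!: mult_right_mono\<close>)
        also have "\<dots> \<le> ennreal (norm (complex_of_real a)) * Lp_fun_norm 2 (\<lambda>x. dyadic \<phi>0 j (- x))"
          by (rule Lp_fun_norm_cmult_le) auto
        also have "\<dots> \<le> ennreal a * ennreal (K * 2 powr (real j * (real CARD('n) * inv_exp 2)))"
          using a K by (intro mult_mono) auto
        finally show "Lp_norm 2 (lp_piece \<phi>0 j (fourier_dist u)) \<le>
            ennreal (K * 2 powr (- (real j * (- real CARD('n) * (1/2 - inv_exp \<infinity>))))) * Lp_fun_norm \<infinity> f"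
          using a 1 by (simp add: inv_exp_2 mult.commute)
      qed
    qed
    then show ?thesis using K(1) by blast
  next
    case (2 r)
    then have r: "r > 2" using p(1) by (metis ennreal_less_iff ennreal_numeral zero_le_numeral)
    define \<theta> where "\<theta> = r / 2"
    define \<theta>' where "\<theta>' = \<theta> / (\<theta> - 1)"
    have \<theta>: "\<theta> > 1" "\<theta>' > 1" "1 / \<theta> + 1 / \<theta>' = 1" using r by (auto simp: \<theta>_def \<theta>'_def field_simps)
    obtain K where K: "K > 0" "\<And>j. Lp_fun_norm (ennreal \<theta>') (\<lambda>x. dyadic \<phi>0 j (- x)) \<le> ennreal (K * 2 powr (real j * (real CARD('n) * inv_exp (ennreal \<theta>'))))"
      using dyadic_Lp_bound[OF phi0, of "ennreal \<theta>'"] \<theta> by auto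
    have "\<theta> > 0" using \<theta> by simp
    from dyadic_powr_sum_bound[OF this]
    obtain M where M: "M > 0" "\<And>x. (\<Sum>j. ennreal (norm (dyadic \<phi>0 j x) powr \<theta>)) \<le> ennreal M"
      by blast
    define C where "C = (K powr \<theta> * M) powr (1 / r)"
    have C: "C > 0" using K M by (simp add: C_def)
    have "besov_norm \<phi>0 ?s 2 p (fourier_dist u) \<le> ennreal C * Lp_norm p u" for u
    proof (rule le_Lp_normI[OF C])
      fix f assume f: "represents f u" "Lp_fun_norm p f < \<infinity>"
      note [measurable] = representsD(1)[OF f(1)] schwartz_measurable[OF schwartz_reflect[OF dyadic_schwartz[OF phi0]]]
      let ?d = "\<lambda>j x. norm (dyadic \<phi>0 j (- x))"
      let ?A = "\<lambda>j. \<integral>\<^sup>+x. ennreal (norm (f x) powr r) * ennreal (?d j x powr \<theta>) \<partial>lborel"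
      have piece_pow: "ennreal (2 powr (real j * ?s * r)) * epow (Lp_norm 2 (lp_piece \<phi>0 j (fourier_dist u))) r \<le> ennreal (K powr \<theta>) * ?A j" for j
      proof -
        let ?u = "\<lambda>x. (norm (f x))\<^sup>2 * ?d j x"
        have u\<theta>: "?u x powr \<theta> = norm (f x) powr r * ?d j x powr \<theta>" for x
        proof -
          have "(norm (f x))\<^sup>2 powr \<theta> = norm (f x) powr r"
          proof (cases "f x = 0")
            case False
            then have "(norm (f x))\<^sup>2 = norm (f x) powr 2" by simp
            then show ?thesis by (simp only: powr_powr) (simp add: \<theta>_def)
          qed simp
          then show ?thesis by (simp add: powr_mult)
        qed
        have e: "(norm (f x * dyadic \<phi>0 j (- x)))\<^sup>2 = ?u x * ?d j x" for x
          by (simp add: norm_mult power2_eq_square mult_ac)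
        have "(\<integral>\<^sup>+x. ennreal ((norm (f x * dyadic \<phi>0 j (- x)))\<^sup>2) \<partial>lborel) \<le>
            epow (\<integral>\<^sup>+x. ennreal (?u x powr \<theta>) \<partial>lborel) (1 / \<theta>) * epow (\<integral>\<^sup>+x. ennreal (?d j x powr \<theta>') \<partial>lborel) (1 / \<theta>')"
          unfolding e using \<theta> by (intro nn_integral_Hoelder) auto
        also have "\<dots> = epow (?A j) (1 / \<theta>) * Lp_fun_norm (ennreal \<theta>') (\<lambda>x. dyadic \<phi>0 j (- x))"
          unfolding u\<theta> using \<theta> by (simp add: Lp_fun_norm_real ennreal_mult)
        also have "\<dots> \<le> epow (?A j) (1 / \<theta>) * ennreal (K * 2 powr (real j * (real CARD('n) * inv_exp (ennreal \<theta>'))))"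
          by (intro mult_left_mono K) simp
        finally have "epow (\<integral>\<^sup>+x. ennreal ((norm (f x * dyadic \<phi>0 j (- x)))\<^sup>2) \<partial>lborel) \<theta> \<le>
            epow (epow (?A j) (1 / \<theta>) * ennreal (K * 2 powr (real j * (real CARD('n) * inv_exp (ennreal \<theta>'))))) \<theta>"
          using \<theta> by (intro epow_mono) auto
        also have "\<dots> = ?A j * ennreal (K powr \<theta> * 2 powr (real j * (real CARD('n) * inv_exp (ennreal \<theta>')) * \<theta>))"
          using \<theta> K(1) unfolding epow_mult epow_epow by (simp add: epow_ennreal powr_mult powr_powr)
        finally have "epow (Lp_fun_norm 2 (\<lambda>x. f x * dyadic \<phi>0 j (- x))) r \<le> ?A j * ennreal (K powr \<theta> * 2 powr (real j * (real CARD('n) * inv_exp (ennreal \<theta>')) * \<theta>))"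
          unfolding Lp_fun_norm_2 epow_epow by (simp add: \<theta>_def)
        moreover have "epow (Lp_norm 2 (lp_piece \<phi>0 j (fourier_dist u))) r \<le> epow (Lp_fun_norm 2 (\<lambda>x. f x * dyadic \<phi>0 j (- x))) r"
          using r by (intro epow_mono piece[OF f]) auto
        ultimately have "ennreal (2 powr (real j * ?s * r)) * epow (Lp_norm 2 (lp_piece \<phi>0 j (fourier_dist u))) r \<le>
            ennreal (2 powr (real j * ?s * r)) * (?A j * ennreal (K powr \<theta> * 2 powr (real j * (real CARD('n) * inv_exp (ennreal \<theta>')) * \<theta>)))"
          by (intro mult_left_mono) auto
        also have "\<dots> = (ennreal (2 powr (real j * ?s * r)) * ennreal (K powr \<theta> * 2 powr (real j * (real CARD('n) * inv_exp (ennreal \<theta>')) * \<theta>))) * ?A j"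
          by (simp only: mult_ac)
        also have "ennreal (2 powr (real j * ?s * r)) * ennreal (K powr \<theta> * 2 powr (real j * (real CARD('n) * inv_exp (ennreal \<theta>')) * \<theta>)) =
            ennreal (K powr \<theta> * (2 powr (real j * ?s * r) * 2 powr (real j * (real CARD('n) * inv_exp (ennreal \<theta>')) * \<theta>)))"
          by (subst ennreal_mult[symmetric]) (auto simp: mult_ac)
        \<comment> \<open>The Besov weight cancels the growth of the second Hoelder factor exactly,
          since \<open>(1 - 2/r) * (r/2) = r * (1/2 - 1/r)\<close>. What is left depends on
          \<open>j\<close> only through the localised integral \<open>?A j\<close>.\<close>
        also have "2 powr (real j * ?s * r) * 2 powr (real j * (real CARD('n) * inv_exp (ennreal \<theta>')) * \<theta>) = 1"
        proof -
          have i: "inv_exp (ennreal \<theta>') = 1 - 2 / r" using \<theta> r by (simp add: inv_exp_ennreal \<theta>_def)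
          have "real j * ?s * r + real j * (real CARD('n) * inv_exp (ennreal \<theta>')) * \<theta> = 0"
            unfolding i unfolding 2 \<theta>_def using r by (simp add: inv_exp_ennreal field_simps)
          then show ?thesis by (simp only: powr_add[symmetric]) simp
        qed
        finally show ?thesis by simp
      qed
      have "(\<Sum>j. ennreal (2 powr (real j * ?s * r)) * epow (Lp_norm 2 (lp_piece \<phi>0 j (fourier_dist u))) r) \<le> (\<Sum>j. ennreal (K powr \<theta>) * ?A j)"
        by (intro suminf_le piece_pow) auto
      also have "\<dots> = ennreal (K powr \<theta>) * (\<Sum>j. ?A j)" by simp
      also have "(\<Sum>j. ?A j) = (\<integral>\<^sup>+x. (\<Sum>j. ennreal (norm (f x) powr r) * ennreal (?d j x powr \<theta>)) \<partial>lborel)"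
        by (rule nn_integral_suminf[symmetric]) measurable
      also have "\<dots> \<le> (\<integral>\<^sup>+x. ennreal (norm (f x) powr r) * ennreal M \<partial>lborel)"
        unfolding ennreal_suminf_cmult by (intro nn_integral_mono mult_left_mono M(2)) simp
      also have "\<dots> = (\<integral>\<^sup>+x. ennreal (norm (f x) powr r) \<partial>lborel) * ennreal M" by (rule nn_integral_multc) measurable
      finally have "(\<Sum>j. ennreal (2 powr (real j * ?s * r)) * epow (Lp_norm 2 (lp_piece \<phi>0 j (fourier_dist u))) r) \<le>
          ennreal (K powr \<theta>) * ((\<integral>\<^sup>+x. ennreal (norm (f x) powr r) \<partial>lborel) * ennreal M)" by (simp add: mult_left_mono)
      then have "epow (\<Sum>j. ennreal (2 powr (real j * ?s * r)) * epow (Lp_norm 2 (lp_piece \<phi>0 j (fourier_dist u))) r) (1 / r) \<le>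
          epow (ennreal (K powr \<theta>) * ((\<integral>\<^sup>+x. ennreal (norm (f x) powr r) \<partial>lborel) * ennreal M)) (1 / r)"
        using r by (intro epow_mono) auto
      also have "\<dots> = ennreal C * Lp_fun_norm p f"
        unfolding epow_mult 2 using r K M
        by (simp add: Lp_fun_norm_real epow_ennreal less_imp_le C_def powr_mult ennreal_mult mult_ac)
      finally show "besov_norm \<phi>0 ?s 2 p (fourier_dist u) \<le> ennreal C * Lp_fun_norm p f"
        using 2 r by (simp add: besov_norm_def)
    qed
    then show ?thesis using C by blast
  qed
  then obtain C where C: "C > 0" "\<And>u. besov_norm \<phi>0 ?s 2 p (fourier_dist u) \<le> ennreal C * Lp_norm p u" by blast
  show ?thesis by (rule maps_boundedly_fourier_distI[OF p1 p(2,3) _ C(2)]) (simp add: besov_def)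
qed

text \<open>Distinct members of the sequence live on distinct dyadic annuli, so the
  \<open>k\<close>-th piece of the difference of two transforms sees only \<open>f k\<close>. Its
  norm is bounded below by duality: pairing with a test function of controlled \<open>L_1\<close>
  norm bounds every representative, hence the infimum in \<open>Lp_norm\<close>.\<close>

theorem fourier_Lp_to_Zygmund_not_compact:
  fixes p p' :: ennreal
  assumes p: "p \<ge> 1" "p' \<ge> 1" "inv_exp p + inv_exp p' = 1"
  defines "s \<equiv> - real CARD('n) * inv_exp p'"
  obtains f :: "nat \<Rightarrow> (real^'n \<Rightarrow> complex) \<Rightarrow> complex" and \<delta> :: real
  where "\<delta> > 0" "\<And>k. f k \<in> Lp_space p" "\<And>k. Lp_norm p (f k) \<le> 1"
    "\<And>k l. k \<noteq> l \<Longrightarrow> ennreal \<delta> \<le> besov_norm \<phi>0 s \<infinity> \<infinity> (\<lambda>\<psi>. fourier_dist (f k) \<psi> - fourier_dist (f l) \<psi>)"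
proof -
  let ?I = "indicator annulus :: real^'n \<Rightarrow> complex"
  let ?n = "real CARD('n)"
  define \<alpha> where "\<alpha> = measure lborel (annulus :: (real^'n) set)"
  have \<alpha>: "\<alpha> > 0" unfolding \<alpha>_def by (rule measure_annulus_pos)
  have Im[measurable]: "?I \<in> borel_measurable borel" by measurable
  have "Lp_fun_norm p ?I < \<infinity>"
    by (rule Lp_fun_norm_bounded_integrable[OF p(1) integrable_annulus, of 1]) (auto simp: indicator_def)
  then obtain \<nu> where \<nu>: "Lp_fun_norm p ?I = ennreal \<nu>" "\<nu> \<ge> 0" by (cases "Lp_fun_norm p ?I") auto
  \<comment> \<open>The summand 1 avoids a division by zero and gives
    \<open>a * \<nu> \<le> 1\<close>.\<close>
  define a where "a = 1 / (\<nu> + 1)"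
  have a: "a > 0" "a * \<nu> \<le> 1" using \<nu> by (auto simp: a_def)
  \<comment> \<open>The power of 2 compensates the growth of the \<open>L_p\<close> norm under
    dilation, which keeps the sequence in the unit ball.\<close>
  define c where "c k = a * 2 powr (- real k * (?n * inv_exp p))" for k :: nat
  have c: "c k > 0" for k using a by (simp add: c_def)
  define F where "F k x = of_real (c k) * ?I ((2::real) powr (- real k) *\<^sub>R x)" for k x
  have iI: "integrable lborel (\<lambda>x. ?I ((2::real) powr (- real k) *\<^sub>R x))" for k
    using lborel_integrable_affine[OF integrable_annulus, of "2 powr (- real k)" 0] by simp
  have iF: "integrable lborel (F k)" for k unfolding F_def by (intro integrable_mult_right iI)
  \<comment> \<open>This integral is the value of the pairing used below. Its growth
    \<open>2^(k n / p')\<close> is just what the Besov weight \<open>2^(k s)\<close> removes, so the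
    lower bound is uniform in \<open>k\<close>.\<close>
  have intF: "(LINT x|lborel. F k x) = of_real (a * \<alpha> * 2 powr (real k * (?n * inv_exp p')))" for k
  proof -
    have "of_real \<alpha> = (2 powr (- real k)) ^ CARD('n) *\<^sub>R (LINT x|lborel. ?I ((2::real) powr (- real k) *\<^sub>R x))"
      using lborel_integral_affine[OF integrable_annulus[where 'n='n], of "2 powr (- real k)" 0] integral_annulus[where 'n='n] by (simp add: \<alpha>_def)
    moreover have "(2 powr (- real k)) ^ CARD('n) = 2 powr (- real k * ?n)"
      by (simp add: powr_powr powr_realpow[symmetric])
    ultimately have "of_real (2 powr (real k * ?n) * \<alpha>) = of_real (2 powr (real k * ?n)) * (of_real (2 powr (- real k * ?n)) * (LINT x|lborel. ?I ((2::real) powr (- real k) *\<^sub>R x)))"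
      by (simp add: scaleR_conv_of_real)
    also have "\<dots> = (LINT x|lborel. ?I ((2::real) powr (- real k) *\<^sub>R x))"
      unfolding mult.assoc[symmetric] of_real_mult[symmetric] powr_add[symmetric] by simp
    finally have "(LINT x|lborel. F k x) = of_real (c k) * of_real (2 powr (real k * ?n) * \<alpha>)"
      unfolding F_def by simp
    also have "\<dots> = of_real (a * \<alpha> * (2 powr (- real k * (?n * inv_exp p)) * 2 powr (real k * ?n)))"
      by (simp add: c_def)
    also have "2 powr (- real k * (?n * inv_exp p)) * 2 powr (real k * ?n) = 2 powr (real k * (?n * inv_exp p'))"
    proof -
      have "inv_exp p' = 1 - inv_exp p" using p(3) by simp
      then have "- real k * (?n * inv_exp p) + real k * ?n = real k * (?n * inv_exp p')"
        by (simp only:) (simp add: algebra_simps)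
      then show ?thesis by (simp only: powr_add[symmetric])
    qed
    finally show ?thesis .
  qed
  have nF: "Lp_fun_norm p (F k) \<le> 1" for k
  proof -
    have "Lp_fun_norm p (F k) \<le> ennreal (norm (complex_of_real (c k))) * Lp_fun_norm p (\<lambda>x. ?I ((2::real) powr (- real k) *\<^sub>R x))"
      unfolding F_def by (rule Lp_fun_norm_cmult_le[OF p(1)]) measurable
    also have "\<dots> \<le> ennreal (norm (complex_of_real (c k))) * (ennreal (\<bar>2 powr (- real k)\<bar> powr (- ?n * inv_exp p)) * Lp_fun_norm p ?I)"
      by (intro mult_left_mono Lp_fun_norm_dilate_le[OF p(1)]) auto
    also have "\<dots> = ennreal (c k * (2 powr (real k * (?n * inv_exp p)) * \<nu>))"
      using c[of k] \<nu> by (simp add: powr_powr ennreal_mult less_imp_le)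
    also have "c k * (2 powr (real k * (?n * inv_exp p)) * \<nu>) = a * \<nu> * (2 powr (- real k * (?n * inv_exp p)) * 2 powr (real k * (?n * inv_exp p)))"
      by (simp add: c_def)
    also have "\<dots> = a * \<nu>" by (simp add: powr_add[symmetric])
    also have "ennreal (a * \<nu>) \<le> ennreal 1" using a by (intro ennreal_leI)
    finally show ?thesis by simp
  qed
  define f where "f k = (\<lambda>\<psi>. LINT x|lborel. F k x * \<psi> x)" for k
  have rep: "represents (F k) (f k)" and temp: "f k \<in> tempered" for k
    unfolding f_def by (rule integral_dist_represents[OF iF])+
  have f1: "Lp_norm p (f k) \<le> 1" for k using order_trans[OF Lp_norm_le[OF rep] nF] .
  have f2: "f k \<in> Lp_space p" for k
    using temp le_less_trans[OF f1[of k]] by (simp add: Lp_space_def)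
  note \<phi>s = phi0_schwartz[OF phi0]
  obtain M where M: "Lp_fun_norm 1 (fourier \<phi>0) = ennreal M" "M \<ge> 0"
    using Lp_fun_norm_schwartz[of 1, OF _ schwartz_fourier[OF \<phi>s]] by (cases "Lp_fun_norm 1 (fourier \<phi>0)") auto
  \<comment> \<open>\<open>a * \<alpha>\<close> is the weighted pairing, and \<open>M + 1\<close>
    bounds the \<open>L_1\<close> norm of the test functions.\<close>
  define \<delta> where "\<delta> = a * \<alpha> / (M + 1)"
  have \<delta>: "\<delta> > 0" using a \<alpha> M by (simp add: \<delta>_def)
  have low: "ennreal \<delta> \<le> besov_norm \<phi>0 s \<infinity> \<infinity> (\<lambda>\<psi>. fourier_dist (f k) \<psi> - fourier_dist (f l) \<psi>)" if kl: "k \<noteq> l" for k l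
  proof -
    let ?D = "\<lambda>\<psi>. fourier_dist (f k) \<psi> - fourier_dist (f l) \<psi>"
    \<comment> \<open>The test function is the transform of a dilated \<phi>_0. Transforming it once
      more gives a function equal to 1 on the support of \<open>F k\<close>, and the dilation leaves
      the \<open>L_1\<close> bound \<open>M\<close> unchanged.\<close>
    let ?\<kappa> = "\<lambda>x. \<phi>0 ((2::real) powr (- real k) *\<^sub>R x)"
    let ?\<psi> = "fourier ?\<kappa>"
    have \<kappa>: "?\<kappa> \<in> schwartz" by (rule schwartz_dil[OF \<phi>s]) simp
    have \<psi>: "?\<psi> \<in> schwartz" by (rule schwartz_fourier[OF \<kappa>])
    have supp: "3/4 * 2 powr real m < norm x" "norm x < 2 powr real m" if "F m x \<noteq> 0" for m x
    proof -
      have "(2::real) powr (- real m) *\<^sub>R x \<in> annulus" using that by (auto simp: F_def indicator_def split: if_splits)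
      then show "3/4 * 2 powr real m < norm x" "norm x < 2 powr real m"
        by (auto simp: annulus_def powr_minus field_simps)
    qed
    have own: "F k x * (dyadic \<phi>0 k (- x) * fourier ?\<psi> x) = F k x" for x
    proof (cases "F k x = 0")
      case False
      define y where "y = (2::real) powr (- real k) *\<^sub>R (- x)"
      have y: "norm y \<le> 1" "norm ((2::real) *\<^sub>R y) \<ge> 3/2"
        using supp[OF False] unfolding norm_scaleR by (auto simp: y_def powr_minus field_simps)
      have "\<phi>0 y = 1" "\<phi>0 (2 *\<^sub>R y) = 0" using phi0_1[OF phi0 y(1)] phi0_0[OF phi0 y(2)] by auto
      then have "dyadic \<phi>0 k (- x) = 1" unfolding dyadic_eq y_def[symmetric] by (simp add: dyadic_base_def)
      moreover have "fourier ?\<psi> x = 1" unfolding fourier_fourier[OF \<kappa>] y_def[symmetric] by fact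
      ultimately show ?thesis by simp
    qed simp
    have other: "F l x * (dyadic \<phi>0 k (- x) * fourier ?\<psi> x) = 0" for x
    proof (rule ccontr)
      assume "F l x * (dyadic \<phi>0 k (- x) * fourier ?\<psi> x) \<noteq> 0"
      then have nz: "F l x \<noteq> 0" "dyadic \<phi>0 k (- x) \<noteq> 0" by auto
      show False
      \<comment> \<open>The radii of the annulus fit the dyadic supports. For \<open>l < k\<close>
        the support of \<open>F l\<close> stays inside radius \<open>2^(k-1)\<close>, where \<phi>_k
        vanishes. For \<open>l > k\<close> it lies outside \<open>3/4 * 2^(k+1) = 3/2 * 2^k\<close>,
        where \<phi>_k vanishes again.\<close>
      proof (cases "l < k")
        case True
        then have "2 powr real l \<le> 2 powr (real k - 1)" by (intro powr_mono) auto
        moreover have "2 powr (real k - 1) < norm (- x)" using dyadic_support_lower[OF nz(2)] True by simp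
        ultimately show False using supp(2)[OF nz(1)] unfolding norm_minus_cancel by linarith
      next
        case False
        then have "real k + 1 \<le> real l" using kl by simp
        then have "2 powr (real k + 1) \<le> 2 powr real l" by (intro powr_mono) auto
        moreover have "norm (- x) < 3/2 * 2 powr real k" by (rule dyadic_support[OF phi0 nz(2)])
        moreover have "2 powr (real k + 1) = 2 * 2 powr real k" by (simp add: powr_add)
        ultimately show False using supp(1)[OF nz(1)] unfolding norm_minus_cancel by linarith
      qed
    qed
    have val: "lp_piece \<phi>0 k ?D ?\<psi> = of_real (a * \<alpha> * 2 powr (real k * (?n * inv_exp p')))"
    proof -
      have "lp_piece \<phi>0 k ?D ?\<psi> = lp_piece \<phi>0 k (fourier_dist (f k)) ?\<psi> - lp_piece \<phi>0 k (fourier_dist (f l)) ?\<psi>"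
        by (simp add: lp_piece_def)
      also have "lp_piece \<phi>0 k (fourier_dist (f k)) ?\<psi> = (LINT x|lborel. F k x)"
        unfolding lp_piece_fourier_dist[OF phi0 \<psi>] by (simp only: f_def own)
      also have "lp_piece \<phi>0 k (fourier_dist (f l)) ?\<psi> = 0"
        unfolding lp_piece_fourier_dist[OF phi0 \<psi>] by (simp only: f_def other) simp
      finally show ?thesis using intF[of k] by simp
    qed
    have norm\<psi>: "Lp_fun_norm 1 ?\<psi> \<le> ennreal M"
      using Lp_fun_norm_fourier_dilate_le[of 1 "2 powr (- real k)" \<phi>0] \<phi>s M by (simp add: inv_exp_def)
    have "ennreal (a * \<alpha> * 2 powr (real k * (?n * inv_exp p'))) \<le> ennreal (M + 1) * Lp_norm \<infinity> (lp_piece \<phi>0 k ?D)"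
    proof (rule le_Lp_normI)
      fix g assume g: "represents g (lp_piece \<phi>0 k ?D)"
      note [measurable] = representsD(1)[OF g] schwartz_measurable[OF \<psi>]
      have "ennreal (a * \<alpha> * 2 powr (real k * (?n * inv_exp p'))) = ennreal (norm (lp_piece \<phi>0 k ?D ?\<psi>))"
        unfolding val norm_of_real using a \<alpha> by simp
      also have "\<dots> \<le> (\<integral>\<^sup>+x. ennreal (norm (g x * ?\<psi> x)) \<partial>lborel)"
        unfolding representsD(3)[OF g \<psi>] by (rule norm_lebesgue_integral_le)
      also have "\<dots> \<le> Lp_fun_norm \<infinity> g * Lp_fun_norm 1 ?\<psi>"
        unfolding norm_mult by (rule Lp_fun_norm_Hoelder) (auto simp: inv_exp_def)
      also have "\<dots> \<le> Lp_fun_norm \<infinity> g * ennreal (M + 1)"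
        by (intro mult_left_mono order_trans[OF norm\<psi>] ennreal_leI) auto
      finally show "ennreal (a * \<alpha> * 2 powr (real k * (?n * inv_exp p'))) \<le> ennreal (M + 1) * Lp_fun_norm \<infinity> g"
        by (simp add: mult.commute)
    qed (use M in simp)
    then have "ennreal (2 powr (real k * s) / (M + 1)) * ennreal (a * \<alpha> * 2 powr (real k * (?n * inv_exp p'))) \<le>
        ennreal (2 powr (real k * s) / (M + 1)) * (ennreal (M + 1) * Lp_norm \<infinity> (lp_piece \<phi>0 k ?D))"
      by (intro mult_left_mono) auto
    also have "\<dots> = ennreal (2 powr (real k * s)) * Lp_norm \<infinity> (lp_piece \<phi>0 k ?D)"
      unfolding mult.assoc[symmetric] using M by (subst ennreal_mult[symmetric]) auto
    also have "\<dots> \<le> besov_norm \<phi>0 s \<infinity> \<infinity> ?D"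
      unfolding besov_norm_def by (simp del: SUP_apply) (rule SUP_upper, simp)
    also have "ennreal (2 powr (real k * s) / (M + 1)) * ennreal (a * \<alpha> * 2 powr (real k * (?n * inv_exp p'))) = ennreal \<delta>"
    proof -
      have "2 powr (real k * s) / (M + 1) * (a * \<alpha> * 2 powr (real k * (?n * inv_exp p'))) = \<delta> * (2 powr (real k * s) * 2 powr (real k * (?n * inv_exp p')))"
        by (simp add: \<delta>_def)
      also have "\<dots> = \<delta>" by (simp add: powr_add[symmetric] s_def)
      finally show ?thesis using M a \<alpha> by (subst ennreal_mult[symmetric]) auto
    qed
    finally show ?thesis .
  qed
  show ?thesis by (rule that[OF \<delta> f2 f1 low])
qed

end

text \<open>Compactness is tested by Cauchy subsequences of images of sequences in the unit ball. A
  compact map would even have convergent ones, so refuting this form refutes compactness without any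
  appeal to completeness of the target space.\<close>

theorem theorem2p5:
  fixes \<phi>0 :: "real^'n::finite \<Rightarrow> complex" and p p' :: ennreal
  assumes phi0: "admissible_phi0 \<phi>0"
    and p: "1 \<le> p" and p': "1 \<le> p'" and conj: "inv_exp p + inv_exp p' = 1"
  defines "s \<equiv> - real CARD('n) * inv_exp p'"
  shows "maps_boundedly (Lp_space p) (Lp_norm p) (besov \<phi>0 s \<infinity> \<infinity>) (besov_norm \<phi>0 s \<infinity> \<infinity>) fourier_dist
    \<and> \<not> (\<forall>f :: nat \<Rightarrow> (real^'n \<Rightarrow> complex) \<Rightarrow> complex. (\<forall>k. f k \<in> Lp_space p \<and> Lp_norm p (f k) \<le> 1) \<longrightarrow>
            (\<exists>\<sigma> :: nat \<Rightarrow> nat. strict_mono \<sigma> \<and> (\<forall>\<epsilon>::real>0. \<exists>N. \<forall>i\<ge>N. \<forall>j\<ge>N.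
               besov_norm \<phi>0 s \<infinity> \<infinity>
                 (\<lambda>\<psi>. fourier_dist (f (\<sigma> i)) \<psi> - fourier_dist (f (\<sigma> j)) \<psi>) < ennreal \<epsilon>)))
    \<and> (p \<le> 2 \<longrightarrow>
         maps_boundedly (Lp_space p) (Lp_norm p) (Lp_space p') (Lp_norm p') fourier_dist
       \<and> maps_boundedly (Lp_space p') (Lp_norm p') (besov \<phi>0 s \<infinity> \<infinity>) (besov_norm \<phi>0 s \<infinity> \<infinity>) id)
    \<and> (2 < p \<longrightarrow>
         maps_boundedly (Lp_space p) (Lp_norm p)
           (besov \<phi>0 (- real CARD('n) * (1/2 - inv_exp p)) 2 p)
           (besov_norm \<phi>0 (- real CARD('n) * (1/2 - inv_exp p)) 2 p) fourier_dist
       \<and> maps_boundedly (besov \<phi>0 (- real CARD('n) * (1/2 - inv_exp p)) 2 p)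
           (besov_norm \<phi>0 (- real CARD('n) * (1/2 - inv_exp p)) 2 p)
           (besov \<phi>0 (2 * real CARD('n) * (inv_exp p - 1/2)) p p)
           (besov_norm \<phi>0 (2 * real CARD('n) * (inv_exp p - 1/2)) p p) id
       \<and> maps_boundedly (besov \<phi>0 (2 * real CARD('n) * (inv_exp p - 1/2)) p p)
           (besov_norm \<phi>0 (2 * real CARD('n) * (inv_exp p - 1/2)) p p)
           (besov \<phi>0 s \<infinity> \<infinity>) (besov_norm \<phi>0 s \<infinity> \<infinity>) id)"
proof -
  note pp = p p' conj
  have "\<not> (\<forall>f :: nat \<Rightarrow> (real^'n \<Rightarrow> complex) \<Rightarrow> complex. (\<forall>k. f k \<in> Lp_space p \<and> Lp_norm p (f k) \<le> 1) \<longrightarrow>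
            (\<exists>\<sigma> :: nat \<Rightarrow> nat. strict_mono \<sigma> \<and> (\<forall>\<epsilon>::real>0. \<exists>N. \<forall>i\<ge>N. \<forall>j\<ge>N.
               besov_norm \<phi>0 s \<infinity> \<infinity>
                 (\<lambda>\<psi>. fourier_dist (f (\<sigma> i)) \<psi> - fourier_dist (f (\<sigma> j)) \<psi>) < ennreal \<epsilon>)))"
    (is "\<not> (\<forall>f. ?bounded f \<longrightarrow> ?cauchy f)")
  proof
    assume all: "\<forall>f. ?bounded f \<longrightarrow> ?cauchy f"
    obtain f :: "nat \<Rightarrow> (real^'n \<Rightarrow> complex) \<Rightarrow> complex" and \<delta> where f: "\<delta> > 0" "?bounded f"
      "\<And>k l. k \<noteq> l \<Longrightarrow> ennreal \<delta> \<le> besov_norm \<phi>0 s \<infinity> \<infinity> (\<lambda>\<psi>. fourier_dist (f k) \<psi> - fourier_dist (f l) \<psi>)"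
      using fourier_Lp_to_Zygmund_not_compact[OF phi0 pp] unfolding s_def by metis
    obtain \<sigma> :: "nat \<Rightarrow> nat" and N where \<sigma>: "strict_mono \<sigma>" "\<forall>i\<ge>N. \<forall>j\<ge>N.
        besov_norm \<phi>0 s \<infinity> \<infinity> (\<lambda>\<psi>. fourier_dist (f (\<sigma> i)) \<psi> - fourier_dist (f (\<sigma> j)) \<psi>) < ennreal \<delta>"
      using all f(1,2) by blast
    \<comment> \<open>Two consecutive indices suffice: strict monotonicity makes their images
      distinct, and distinct members of the sequence stay \<delta> apart.\<close>
    have "\<sigma> N \<noteq> \<sigma> (Suc N)" using \<sigma>(1) by (metis lessI less_irrefl strict_mono_less)
    then show False using f(3) \<sigma>(2) by (meson le_SucI not_le order_refl)
  qed
  then show ?thesis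
    unfolding s_def
    by (intro conjI impI fourier_Lp_to_Zygmund fourier_Lp_to_conjugate_Lp Lp_embedded_Zygmund
      fourier_Lp_to_besov_2_p[where p'=p'] besov_2_p_embedded_p_p besov_p_p_embedded_Zygmund phi0 p p' conj)
qed

end
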